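(* No oblique isosceles triangle admits a $k$-splitting reptiling for any $k\ge 2$.
   Context: An $r$-reptiling of a triangle $T$ ($r\ge 2$) is a subdivision of $T$ into $r$ triangles (tiles) with pairwise disjoint interiors, each similar to $T$ and all mutually congruent. For $k\ge2$, a $k$-splitting reptiling of $T$ is a reptiling in which exactly $k$ tiles meet at one of the vertices of $T$. A triangle is oblique if it is not a right triangle. *)

theory Defs
  imports "HOL-Analysis.Analysis"
begin

type_synonym plane = "real ^ 2"

text \<open>A triangle is a closed, non-degenerate triangular region of the plane.\<close>

definition triangle_on :: "plane set \<Rightarrow> plane \<Rightarrow> plane \<Rightarrow> plane \<Rightarrow> bool" where
  "triangle_on T a b c \<longleftrightarrow> \<not> collinear {a, b, c} \<and> T = convex hull {a, b, c}"

definition is_triangle :: "plane set \<Rightarrow> bool" where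
  "is_triangle T \<longleftrightarrow> (\<exists>a b c. triangle_on T a b c)"

text \<open>
  The labelling of the vertices is existentially quantified, so there is no loss of generality in
  singling out \<open>a\<close>. Equilateral triangles count as isosceles.
\<close>

definition isosceles_triangle :: "plane set \<Rightarrow> bool" where
  "isosceles_triangle T \<longleftrightarrow> (\<exists>a b c. triangle_on T a b c \<and> dist a b = dist a c)"

definition right_triangle :: "plane set \<Rightarrow> bool" where
  "right_triangle T \<longleftrightarrow> (\<exists>a b c. triangle_on T a b c \<and> orthogonal (b - a) (c - a))"

definition oblique_triangle :: "plane set \<Rightarrow> bool" where
  "oblique_triangle T \<longleftrightarrow> is_triangle T \<and> \<not> right_triangle T"

text \<open>Similarities and congruences may reverse orientation.\<close>

definition similar_figures :: "plane set \<Rightarrow> plane set \<Rightarrow> bool" where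
  "similar_figures A B \<longleftrightarrow>
     (\<exists>s > 0. \<exists>f :: plane \<Rightarrow> plane. (\<forall>x y. dist (f x) (f y) = s * dist x y) \<and> f ` A = B)"

definition congruent_figures :: "plane set \<Rightarrow> plane set \<Rightarrow> bool" where
  "congruent_figures A B \<longleftrightarrow>
     (\<exists>f :: plane \<Rightarrow> plane. (\<forall>x y. dist (f x) (f y) = dist x y) \<and> f ` A = B)"

text \<open>
  The tiles are not required to meet edge to edge. The bound \<open>2 \<le> r\<close> makes \<open>card \<T> = r\<close> imply that
  \<open>\<T>\<close> is finite.
\<close>

definition reptiling :: "nat \<Rightarrow> plane set \<Rightarrow> plane set set \<Rightarrow> bool" where
  "reptiling r T \<T> \<longleftrightarrow>
     2 \<le> r \<and> card \<T> = r \<and> \<Union>\<T> = T \<and>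
     (\<forall>S\<in>\<T>. is_triangle S \<and> similar_figures S T) \<and>
     pairwise (\<lambda>S S'. disjnt (interior S) (interior S')) \<T> \<and>
     (\<forall>S\<in>\<T>. \<forall>S'\<in>\<T>. congruent_figures S S')"

text \<open>
  The vertices of a triangle are its extreme points.
\<close>

definition splitting_reptiling :: "nat \<Rightarrow> plane set \<Rightarrow> plane set set \<Rightarrow> bool" where
  "splitting_reptiling k T \<T> \<longleftrightarrow>
     2 \<le> k \<and> (\<exists>r. reptiling r T \<T>) \<and>
     (\<exists>v. v extreme_point_of T \<and> card {S \<in> \<T>. v \<in> S} = k)"

end

theory Submission
  imports Defs "HOL-Computational_Algebra.Polynomial"
begin

text \<open>
  Let \<open>\<beta>\<close> be the apex angle and \<open>\<alpha>\<close> the base angles. A split corner forces \<open>\<beta> = k \<alpha>\<close> or \<open>\<alpha> = k \<beta>\<close>.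
  Since there are twice as many base corners of tiles as apexes, counting both kinds of corners at every
  vertex of the tiling excludes everything except the angles (108, 36, 36) and (120, 30, 30) with
  split apex, and (36, 72, 72) with a split base corner.

  The tool for both the counting and the exceptional cases is that every function of directed edges that is
  additive on collinear points has the same total over the boundaries of the tiles as over the boundary of
  the tiled triangle. The function may be highly discontinuous, so it may involve field
  conjugation. For multiples of 36 degrees, replacing the square root of 5 by its negative maps all tiles to
  triangles of the same orientation, for which the angles subtended at the split corner no longer add
  up. For multiples of 30 degrees, an area argument with the conjugation of the square root of 3 shows
  that all edges lie in one triangular lattice, and a suitable quadratic functional then shows that all
  tiles have parallel bases, so that the apex is not split.
\<close>

section \<open>Oriented triangles and ray casting\<close>

text \<open>Three triangles survive the counting because of what fits around an interior point. If
  \<beta> = k \<alpha>, then 2 pi = (2k + 4) \<alpha>, so three apexes fit iff k \<le> 4; if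
  \<alpha> = k \<beta>, then 2 pi = (4k + 2) \<beta>, so five base corners fit iff k \<le> 2. Beyond
  these bounds the other vertices cannot make up for the imbalance at the split corner; k = 2 at the
  apex is the right triangle. Tiles need not meet edge to edge, so edges do not cancel in pairs;
  cancellation is proved on each line separately, by comparing the two sides of the line.
  Conjugation acts only on a ring of algebraic numbers, while tiles may a priori sit at arbitrary
  places and angles; hence the well-placed tiles are first shown to fill the whole area. For 120
  degrees a conjugate tile has the same shape and orientation again, so angle sums give no
  contradiction, which explains the change from angles to areas there.\<close>

definition cr :: "complex \<Rightarrow> complex \<Rightarrow> real" where
  "cr a b = Re a * Im b - Im a * Re b"

definition orient :: "complex \<Rightarrow> complex \<Rightarrow> complex \<Rightarrow> real" where
  "orient a b c = cr (b - a) (c - a)"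

text \<open>Degenerate case: \<open>lin p p\<close> is the whole plane.\<close>

definition lin :: "complex \<Rightarrow> complex \<Rightarrow> complex set" where
  "lin p q = {x. orient p q x = 0}"

definition tri :: "(complex \<Rightarrow> complex \<Rightarrow> 'b::plus) \<Rightarrow> complex \<Rightarrow> complex \<Rightarrow> complex \<Rightarrow> 'b" where
  "tri F a b c = F a b + F b c + F c a"

lemma orient_cyc: "orient b c a = orient a b c"
  by (simp add: orient_def cr_def algebra_simps)

lemma orient_swap: "orient a c b = - orient a b c"
  by (simp add: orient_def cr_def algebra_simps)

lemma orient_same [simp]: "orient p p x = 0" "orient p x p = 0" "orient x p p = 0"
  by (auto simp add: orient_def cr_def algebra_simps)

lemma orient_alt: "orient a b c = cr a b + cr b c + cr c a"
  by (simp add: orient_def cr_def algebra_simps)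

lemma orient_sum: "orient a b z + orient b c z + orient c a z = orient a b c"
  by (simp add: orient_def cr_def algebra_simps)

lemma lin_mem [simp]: "p \<in> lin p q" "q \<in> lin p q"
  by (auto simp: lin_def)

lemma cr_self [simp]: "cr z z = 0" "cr 0 z = 0" "cr z 0 = 0"
  by (simp_all add: cr_def)

lemma cr_rot: "cr (w * a) (w * b) = (norm w)\<^sup>2 * cr a b"
  unfolding cmod_power2 by (simp add: cr_def power2_eq_square algebra_simps)

lemma orient_rot: "orient (w * a) (w * b) (w * c) = (norm w)\<^sup>2 * orient a b c"
  unfolding orient_def right_diff_distrib[symmetric] by (rule cr_rot)

lemma collinear_param:
  assumes "p \<noteq> q" "orient p q x = 0"
  obtains t where "x = p + of_real t * (q - p)"
proof -
  define d where "d = q - p"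
  define t where "t = Re ((x - p) / d)"
  have "d \<noteq> 0" using assms d_def by auto
  have "Im ((x - p) / d) = 0"
    using assms(2) unfolding orient_def d_def[symmetric] cr_def
    by (simp add: Im_divide algebra_simps)
  then have "(x - p) / d = of_real t" by (simp add: t_def complex_eq_iff)
  then have "x = p + of_real t * d" using \<open>d \<noteq> 0\<close> by (simp add: field_simps)
  then show ?thesis using that d_def by blast
qed

lemma orient_param:
  "orient (p + of_real t * d) (p + of_real t' * d) z = (t' - t) * orient p (p + d) z"
  by (simp add: orient_def cr_def algebra_simps)

lemma lin_eq:
  assumes "p \<noteq> q" "x \<in> lin p q" "y \<in> lin p q" "x \<noteq> y"
  shows "lin x y = lin p q"
proof -
  obtain t where t: "x = p + of_real t * (q - p)"
    using collinear_param assms unfolding lin_def by blast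
  obtain t' where t': "y = p + of_real t' * (q - p)"
    using collinear_param assms unfolding lin_def by blast
  have "t' \<noteq> t" using t t' assms by auto
  then show ?thesis unfolding lin_def t t' orient_param by auto
qed

text \<open>The three orientations with \<open>z\<close>, divided by \<open>orient a b c\<close>,
  are the barycentric coordinates of \<open>z\<close>.\<close>

lemma in_triangle_iff:
  assumes pos: "orient a b c > 0"
  shows "z \<in> convex hull {a, b, c} \<longleftrightarrow> 0 \<le> orient a b z \<and> 0 \<le> orient b c z \<and> 0 \<le> orient c a z"
proof
  assume "z \<in> convex hull {a, b, c}"
  then obtain u v w where uvw: "0 \<le> u" "0 \<le> v" "0 \<le> w" "u + v + w = 1"
    "z = u *\<^sub>R a + v *\<^sub>R b + w *\<^sub>R c"
    unfolding convex_hull_3 by blast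
  have u: "u = 1 - v - w" using uvw by simp
  have "orient a b z = w * orient a b c" "orient b c z = u * orient a b c" "orient c a z = v * orient a b c"
    unfolding uvw(5) u orient_def cr_def by (simp_all add: algebra_simps)
  then show "0 \<le> orient a b z \<and> 0 \<le> orient b c z \<and> 0 \<le> orient c a z"
    using uvw pos by simp
next
  assume as: "0 \<le> orient a b z \<and> 0 \<le> orient b c z \<and> 0 \<le> orient c a z"
  define D where "D = orient a b c"
  have D: "D > 0" using pos D_def by simp
  have "D *\<^sub>R z = orient b c z *\<^sub>R a + orient c a z *\<^sub>R b + orient a b z *\<^sub>R c"
    unfolding D_def complex_eq_iff orient_def cr_def by (simp add: algebra_simps)
  then have "z = (1 / D) *\<^sub>R (orient b c z *\<^sub>R a + orient c a z *\<^sub>R b + orient a b z *\<^sub>R c)"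
    using D by (metis divide_self_if less_irrefl scaleR_one scaleR_scaleR times_divide_eq_left mult_1)
  then have "z = (orient b c z / D) *\<^sub>R a + (orient c a z / D) *\<^sub>R b + (orient a b z / D) *\<^sub>R c"
    by (simp add: scaleR_right_distrib)
  moreover have "orient b c z / D + orient c a z / D + orient a b z / D = 1"
    using orient_sum[of a b z c] D unfolding D_def by (simp add: add_divide_distrib[symmetric] algebra_simps)
  ultimately show "z \<in> convex hull {a, b, c}"
    unfolding convex_hull_3 using as D by (smt (verit) divide_nonneg_pos mem_Collect_eq)
qed

lemma continuous_orient: "continuous_on UNIV (orient a b)"
  unfolding orient_def cr_def by (intro continuous_intros)

lemma strict_in_interior:
  assumes "orient a b z > 0" "orient b c z > 0" "orient c a z > 0"
  shows "z \<in> interior (convex hull {a, b, c})"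
proof (rule interiorI)
  let ?U = "{z. orient a b z > 0} \<inter> {z. orient b c z > 0} \<inter> {z. orient c a z > 0}"
  show "open ?U"
    by (intro open_Int open_Collect_less continuous_orient continuous_on_const)
  show "z \<in> ?U" using assms by auto
  have "orient a b c > 0" using orient_sum[of a b z c] assms by linarith
  then show "?U \<subseteq> convex hull {a, b, c}" using in_triangle_iff by fastforce
qed

text \<open>
  The signed crossing of a downward vertical ray from \<open>z\<close> with the directed edge from \<open>p\<close> to \<open>q\<close>.
  Vertical edges are never crossed.
\<close>

definition ray :: "complex \<Rightarrow> complex \<Rightarrow> complex \<Rightarrow> real" where
  "ray z p q = (of_bool (Re p < Re z) - of_bool (Re q < Re z)) *
     of_bool (if Re p < Re q then orient p q z > 0 else orient p q z < 0)"

text \<open>With only \<open>a\<close> left of the vertical line through \<open>z\<close>, the sum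
  is the indicator of \<open>z\<close> above \<open>ab\<close> minus that of \<open>z\<close> above
  \<open>ca\<close>. Positive orientation puts \<open>ca\<close> above \<open>ab\<close> there
  (\<open>n1\<close>), and between the two \<open>z\<close> is automatically on the inner side of
  \<open>bc\<close> (\<open>n2\<close>).\<close>

lemma ray_sum_1:
  assumes pos: "orient a b c > 0"
    and gen: "Re z \<noteq> Re a" "Re z \<noteq> Re b" "Re z \<noteq> Re c"
    and gen': "orient a b z \<noteq> 0" "orient b c z \<noteq> 0" "orient c a z \<noteq> 0"
    and ord: "Re a < Re z" "Re z < Re b" "Re z < Re c"
  shows "tri (ray z) a b c = of_bool (orient a b z > 0 \<and> orient b c z > 0 \<and> orient c a z > 0)"
proof -
  have id: "orient c a z * (Re b - Re a) + orient a b z * (Re c - Re a) = orient a b c * (Re z - Re a)"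
    by (simp add: orient_def cr_def algebra_simps)
  have id2: "orient a b c = orient a b z + orient b c z + orient c a z"
    using orient_sum[of a b z c] by simp
  have n1: "\<not> (orient a b z \<le> 0 \<and> orient c a z \<le> 0)"
  proof
    assume "orient a b z \<le> 0 \<and> orient c a z \<le> 0"
    then have "orient c a z * (Re b - Re a) \<le> 0" "orient a b z * (Re c - Re a) \<le> 0"
      using ord by (simp_all add: mult_nonpos_nonneg)
    moreover have "orient a b c * (Re z - Re a) > 0" using pos ord by simp
    ultimately show False using id by linarith
  qed
  have n2: "orient b c z > 0" if "orient a b z > 0" "orient c a z > 0"
  proof (rule ccontr)
    assume "\<not> ?thesis"
    then have le: "orient a b c \<le> orient a b z + orient c a z" using id2 by simp
    have "orient a b c * (Re z - Re a) \<le> (orient a b z + orient c a z) * (Re z - Re a)"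
      using le ord by (simp add: mult_right_mono)
    moreover have "orient c a z * (Re z - Re a) < orient c a z * (Re b - Re a)"
      "orient a b z * (Re z - Re a) < orient a b z * (Re c - Re a)"
      using that ord by simp_all
    ultimately show False using id by (simp add: algebra_simps)
  qed
  show ?thesis
    using ord n1 n2 gen' unfolding tri_def ray_def by (auto split: if_splits)
qed

text \<open>A half-turn keeps orientations but turns the downward ray upward, so the crossings of
  \<open>ab\<close> and of \<open>ca\<close> change by opposite amounts; only their sum is
  invariant.\<close>

lemma ray_sum_2:
  assumes pos: "orient a b c > 0"
    and gen: "Re z \<noteq> Re a" "Re z \<noteq> Re b" "Re z \<noteq> Re c"
    and gen': "orient a b z \<noteq> 0" "orient b c z \<noteq> 0" "orient c a z \<noteq> 0"
    and ord: "Re a > Re z" "Re z > Re b" "Re z > Re c"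
  shows "tri (ray z) a b c = of_bool (orient a b z > 0 \<and> orient b c z > 0 \<and> orient c a z > 0)"
proof -
  have neg: "orient (- x) (- y) (- w) = orient x y w" for x y w
    by (simp add: orient_def cr_def algebra_simps)
  have "tri (ray (-z)) (-a) (-b) (-c) = of_bool (orient a b z > 0 \<and> orient b c z > 0 \<and> orient c a z > 0)"
    using ray_sum_1[of "-a" "-b" "-c" "-z"] assms by (simp add: neg)
  moreover have "ray (-z) (-a) (-b) + ray (-z) (-c) (-a) = ray z a b + ray z c a"
    using ord gen' unfolding ray_def by (auto simp: neg split: if_splits)
  moreover have "ray (-z) (-b) (-c) = 0" "ray z b c = 0"
    using ord by (auto simp: ray_def)
  ultimately show ?thesis unfolding tri_def by simp
qed

lemma tri_cyc: "tri (F :: _ \<Rightarrow> _ \<Rightarrow> 'b::ab_semigroup_add) b c a = tri F a b c"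
  by (simp add: tri_def algebra_simps)

text \<open>The signed crossings give the winding number of the boundary around \<open>z\<close>. If
  all corners lie on one side of the vertical line, nothing is crossed and the barycentric identity
  \<open>idr\<close> keeps \<open>z\<close> outside; otherwise a cyclic shift makes the isolated
  corner the first one.\<close>

lemma ray_sum:
  assumes pos: "orient a b c > 0"
    and gen: "Re z \<noteq> Re a" "Re z \<noteq> Re b" "Re z \<noteq> Re c"
    and gen': "orient a b z \<noteq> 0" "orient b c z \<noteq> 0" "orient c a z \<noteq> 0"
  shows "tri (ray z) a b c = of_bool (orient a b z > 0 \<and> orient b c z > 0 \<and> orient c a z > 0)"
    (is "?L = of_bool ?R")
proof -
  have idr: "orient b c z * (Re a - Re z) + orient c a z * (Re b - Re z) + orient a b z * (Re c - Re z) = 0"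
    by (simp add: orient_def cr_def algebra_simps)
  have out1: ?thesis if "Re z < Re a" "Re z < Re b" "Re z < Re c"
  proof -
    have "\<not> ?R"
    proof
      assume ?R
      then have "orient b c z * (Re a - Re z) > 0" "orient c a z * (Re b - Re z) > 0"
        "orient a b z * (Re c - Re z) > 0" using that by simp_all
      then show False using idr by linarith
    qed
    moreover have "?L = 0" using that by (simp add: tri_def ray_def)
    ultimately show ?thesis by simp
  qed
  have out2: ?thesis if "Re z > Re a" "Re z > Re b" "Re z > Re c"
  proof -
    have "\<not> ?R"
    proof
      assume ?R
      then have "orient b c z * (Re a - Re z) < 0" "orient c a z * (Re b - Re z) < 0"
        "orient a b z * (Re c - Re z) < 0" using that by (simp_all add: mult_pos_neg)
      then show False using idr by linarith
    qed
    moreover have "?L = 0" using that by (simp add: tri_def ray_def)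
    ultimately show ?thesis by simp
  qed
  have p: "orient b c a > 0" "orient c a b > 0" using pos orient_cyc by metis+
  note r = ray_sum_1[of a b c z] ray_sum_1[of b c a z] ray_sum_1[of c a b z]
    ray_sum_2[of a b c z] ray_sum_2[of b c a z] ray_sum_2[of c a b z]
  show ?thesis
    using r out1 out2 pos p gen gen' tri_cyc[of "ray z" b c a] tri_cyc[of "ray z" a b c]
    by (smt (verit, best))
qed

lemma ray_eqI:
  assumes "Re z = Re z'" "orient p q z > 0 \<longleftrightarrow> orient p q z' > 0" "orient p q z < 0 \<longleftrightarrow> orient p q z' < 0"
  shows "ray z p q = ray z' p q"
  using assms by (simp add: ray_def)

lemma orient_up: "orient p q (z + of_real h * \<i>) = orient p q z + h * (Re q - Re p)"
  by (simp add: orient_def cr_def algebra_simps)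

lemma cr_self_scale: "cr d (of_real t * d) = 0"
  by (simp add: cr_def algebra_simps)

text \<open>
  Two points just above and just below \<open>z\<close> see every line that misses \<open>z\<close> in the same way, so the
  difference of the two ray sums isolates the edges on the line through \<open>z\<close>.
\<close>

lemma line_jump:
  fixes P Q :: "'e \<Rightarrow> complex" and w :: "'e \<Rightarrow> real"
  assumes fin: "finite E" and ne: "\<And>e. e \<in> E \<Longrightarrow> P e \<noteq> Q e"
    and H: "\<And>z. (\<And>e. e \<in> E \<Longrightarrow> Re z \<noteq> Re (P e) \<and> Re z \<noteq> Re (Q e) \<and> orient (P e) (Q e) z \<noteq> 0)
      \<Longrightarrow> (\<Sum>e\<in>E. w e * ray z (P e) (Q e)) = 0"
    and z: "\<And>e. e \<in> E \<Longrightarrow> Re z \<noteq> Re (P e) \<and> Re z \<noteq> Re (Q e)"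
    and zl: "\<And>e. e \<in> E \<Longrightarrow> z \<in> lin (P e) (Q e) \<longleftrightarrow> e \<in> EL"
    and EL: "EL \<subseteq> E" "\<And>e. e \<in> EL \<Longrightarrow> Re (P e) \<noteq> Re (Q e)"
  shows "(\<Sum>e\<in>EL. w e * (of_bool (Re (P e) < Re z) - of_bool (Re (Q e) < Re z))) = 0"
proof -
  have ev: "\<forall>\<^sub>F h in at_right (0::real). \<bar>h\<bar> * \<bar>Re (Q e) - Re (P e)\<bar> < \<bar>orient (P e) (Q e) z\<bar>"
    if "e \<in> E - EL" for e
  proof -
    have "orient (P e) (Q e) z \<noteq> 0" using zl[of e] that unfolding lin_def by blast
    then have lt: "\<bar>0\<bar> * \<bar>Re (Q e) - Re (P e)\<bar> < \<bar>orient (P e) (Q e) z\<bar>" by simp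
    have "((\<lambda>h. \<bar>h\<bar> * \<bar>Re (Q e) - Re (P e)\<bar>) \<longlongrightarrow> \<bar>0\<bar> * \<bar>Re (Q e) - Re (P e)\<bar>) (at_right (0::real))"
      by (intro tendsto_intros)
    from order_tendstoD(2)[OF this lt] show ?thesis .
  qed
  have "\<forall>\<^sub>F h in at_right (0::real). \<forall>e\<in>E - EL. \<bar>h\<bar> * \<bar>Re (Q e) - Re (P e)\<bar> < \<bar>orient (P e) (Q e) z\<bar>"
    by (rule eventually_ball_finite) (use fin ev in simp_all)
  moreover have "\<forall>\<^sub>F h in at_right (0::real). h > 0" by (simp add: eventually_at_right_less)
  ultimately have evh: "\<forall>\<^sub>F h in at_right (0::real). h > 0 \<and>
    (\<forall>e\<in>E - EL. \<bar>h\<bar> * \<bar>Re (Q e) - Re (P e)\<bar> < \<bar>orient (P e) (Q e) z\<bar>)"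
    by eventually_elim simp
  obtain h where h: "h > 0"
    "\<forall>e\<in>E - EL. \<bar>h\<bar> * \<bar>Re (Q e) - Re (P e)\<bar> < \<bar>orient (P e) (Q e) z\<bar>"
    using eventually_happens'[OF trivial_limit_at_right_real evh] by blast
  define z1 where "z1 = z + of_real h * \<i>"
  define z2 where "z2 = z + of_real (- h) * \<i>"
  have re: "Re z1 = Re z" "Re z2 = Re z" by (simp_all add: z1_def z2_def)
  have o1: "orient (P e) (Q e) z1 = orient (P e) (Q e) z + h * (Re (Q e) - Re (P e))"
    and o2: "orient (P e) (Q e) z2 = orient (P e) (Q e) z - h * (Re (Q e) - Re (P e))" for e
    unfolding z1_def z2_def orient_up by simp_all
  have off: "(orient (P e) (Q e) z1 > 0 \<longleftrightarrow> orient (P e) (Q e) z2 > 0) \<and>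
     (orient (P e) (Q e) z1 < 0 \<longleftrightarrow> orient (P e) (Q e) z2 < 0) \<and>
     orient (P e) (Q e) z1 \<noteq> 0 \<and> orient (P e) (Q e) z2 \<noteq> 0" if "e \<in> E - EL" for e
  proof -
    have "\<bar>h * (Re (Q e) - Re (P e))\<bar> < \<bar>orient (P e) (Q e) z\<bar>"
      using h(2) that by (simp only: abs_mult)
    then show ?thesis unfolding o1 o2
      by (cases "orient (P e) (Q e) z > 0") (auto simp only: abs_less_iff abs_of_pos abs_of_nonpos not_less)
  qed
  have on: "orient (P e) (Q e) z1 = h * (Re (Q e) - Re (P e)) \<and>
     orient (P e) (Q e) z2 = - h * (Re (Q e) - Re (P e))" if "e \<in> EL" for e
  proof -
    have "orient (P e) (Q e) z = 0" using zl that EL(1) unfolding lin_def by auto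
    then show ?thesis by (simp add: o1 o2)
  qed
  have nz: "orient (P e) (Q e) z1 \<noteq> 0 \<and> orient (P e) (Q e) z2 \<noteq> 0" if "e \<in> E" for e
    using off[of e] on[of e] EL(2)[of e] h(1) that by (cases "e \<in> EL") auto
  have s1: "(\<Sum>e\<in>E. w e * ray z1 (P e) (Q e)) = 0" by (rule H) (use z nz re in auto)
  have s2: "(\<Sum>e\<in>E. w e * ray z2 (P e) (Q e)) = 0" by (rule H) (use z nz re in auto)
  have "(\<Sum>e\<in>E. w e * ray z1 (P e) (Q e) - w e * ray z2 (P e) (Q e)) = 0"
    unfolding sum_subtractf s1 s2 by simp
  also have "(\<Sum>e\<in>E. w e * ray z1 (P e) (Q e) - w e * ray z2 (P e) (Q e))
     = (\<Sum>e\<in>EL. w e * ray z1 (P e) (Q e) - w e * ray z2 (P e) (Q e))"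
  proof (rule sum.mono_neutral_right[OF fin EL(1)], rule ballI)
    fix e assume "e \<in> E - EL"
    then have "ray z1 (P e) (Q e) = ray z2 (P e) (Q e)"
      using off[of e] re by (intro ray_eqI) auto
    then show "w e * ray z1 (P e) (Q e) - w e * ray z2 (P e) (Q e) = 0" by simp
  qed
  also have "\<dots> = (\<Sum>e\<in>EL. w e * (of_bool (Re (P e) < Re z) - of_bool (Re (Q e) < Re z)))"
  proof (rule sum.cong[OF refl])
    fix e assume e: "e \<in> EL"
    \<comment> \<open>Of the two points only the upper one lies above an edge on the line, whichever
      way the edge runs, so the orientation test drops out.\<close>
    have "ray z1 (P e) (Q e) - ray z2 (P e) (Q e) = of_bool (Re (P e) < Re z) - of_bool (Re (Q e) < Re z)"
      using on[OF e] EL(2)[OF e] h(1) unfolding ray_def re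
      by (cases "Re (P e) < Re (Q e)") (simp_all add: mult_less_0_iff zero_less_mult_iff)
    then show "w e * ray z1 (P e) (Q e) - w e * ray z2 (P e) (Q e) =
        w e * (of_bool (Re (P e) < Re z) - of_bool (Re (Q e) < Re z))"
      by (simp add: right_diff_distrib[symmetric])
  qed
  finally show ?thesis .
qed

text \<open>The sum in \<open>line_jump\<close> is a step function of the position along the line,
  changing only where an edge on this line starts or ends. Its values just before and just after
  \<open>x\<close> are both 0, and their difference isolates the endpoints equal to
  \<open>x\<close>.\<close>

lemma line_vertex_weight:
  fixes P Q :: "'e \<Rightarrow> complex" and w :: "'e \<Rightarrow> real"
  assumes fin: "finite E" and ne: "\<And>e. e \<in> E \<Longrightarrow> P e \<noteq> Q e"
    and H: "\<And>z. (\<And>e. e \<in> E \<Longrightarrow> Re z \<noteq> Re (P e) \<and> Re z \<noteq> Re (Q e) \<and> orient (P e) (Q e) z \<noteq> 0)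
      \<Longrightarrow> (\<Sum>e\<in>E. w e * ray z (P e) (Q e)) = 0"
    and pq: "Re p \<noteq> Re q"
  shows "(\<Sum>e | e \<in> E \<and> lin (P e) (Q e) = lin p q. w e * (of_bool (P e = x) - of_bool (Q e = x))) = 0"
proof -
  define EL where "EL = {e \<in> E. lin (P e) (Q e) = lin p q}"
  define pt where "pt t = p + of_real ((t - Re p) / (Re q - Re p)) * (q - p)" for t
  have Re_pt: "Re (pt t) = t" for t using pq by (simp add: pt_def)
  have pt_lin: "pt t \<in> lin p q" for t
    unfolding pt_def lin_def orient_def add_diff_cancel_left' mem_Collect_eq by (rule cr_self_scale)
  have lin_pt: "y = pt (Re y)" if y: "y \<in> lin p q" for y
  proof -
    have "p \<noteq> q" "orient p q y = 0" using pq y by (auto simp: lin_def)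
    then obtain t where "y = p + of_real t * (q - p)" by (rule collinear_param)
    then show ?thesis using pq by (simp add: pt_def)
  qed
  have EL_lin: "P e \<in> lin p q" "Q e \<in> lin p q" if "e \<in> EL" for e
    using that lin_mem unfolding EL_def by blast+
  have finEL: "finite EL" using fin unfolding EL_def by simp
  show ?thesis
  proof (cases "x \<in> lin p q")
    case False
    then show ?thesis using EL_lin unfolding EL_def[symmetric]
      by (intro sum.neutral) auto
  next
    case True
    have one: "finite {t. pt t \<in> lin (P e) (Q e)}" if "e \<in> E - EL" for e
    proof -
      have "t = t'" if "pt t \<in> lin (P e) (Q e)" "pt t' \<in> lin (P e) (Q e)" for t t'
      proof (rule ccontr)
        assume "t \<noteq> t'"
        then have "pt t \<noteq> pt t'" using Re_pt by metis
        then have "lin (P e) (Q e) = lin p q"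
          using lin_eq[OF ne that] lin_eq[of p q, OF _ pt_lin pt_lin] pq \<open>e \<in> E - EL\<close> by force
        then show False using \<open>e \<in> E - EL\<close> EL_def by blast
      qed
      then have "{t. pt t \<in> lin (P e) (Q e)} \<subseteq> {t0}" if "pt t0 \<in> lin (P e) (Q e)" for t0
        using that by auto
      then show ?thesis
        by (cases "\<exists>t0. pt t0 \<in> lin (P e) (Q e)") (auto intro: finite_subset)
    qed
    \<comment> \<open>Abscissas to avoid: endpoints of edges, and intersections of the line with the
      other edge lines.\<close>
    define X where "X = (\<lambda>e. Re (P e)) ` E \<union> (\<lambda>e. Re (Q e)) ` E \<union> (\<Union>e\<in>E - EL. {t. pt t \<in> lin (P e) (Q e)})"
    have finX: "finite X" unfolding X_def using fin one by auto
    have jump: "(\<Sum>e\<in>EL. w e * (of_bool (Re (P e) < t) - of_bool (Re (Q e) < t))) = 0" if t: "t \<notin> X" for t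
    proof -
      have "(\<Sum>e\<in>EL. w e * (of_bool (Re (P e) < Re (pt t)) - of_bool (Re (Q e) < Re (pt t)))) = 0"
      proof (rule line_jump[OF fin ne H])
        show "\<And>e. e \<in> E \<Longrightarrow> Re (pt t) \<noteq> Re (P e) \<and> Re (pt t) \<noteq> Re (Q e)"
          using t unfolding X_def Re_pt by auto
        show "\<And>e. e \<in> E \<Longrightarrow> (pt t \<in> lin (P e) (Q e)) = (e \<in> EL)"
          using t pt_lin unfolding X_def EL_def by auto
        show "EL \<subseteq> E" unfolding EL_def by auto
        show "Re (P e) \<noteq> Re (Q e)" if "e \<in> EL" for e
        proof
          assume "Re (P e) = Re (Q e)"
          then have "P e = Q e" using EL_lin[OF that] lin_pt by metis
          then show False using ne that unfolding EL_def by auto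
        qed
      qed auto
      then show ?thesis by (simp add: Re_pt)
    qed
    obtain d where d: "d > 0" "\<And>y. y \<in> X \<Longrightarrow> y \<noteq> Re x \<Longrightarrow> d \<le> dist (Re x) y"
      using finite_set_avoid[OF finX, of "Re x"] by blast
    define t1 where "t1 = Re x - d / 2"
    define t2 where "t2 = Re x + d / 2"
    have t12: "t1 \<notin> X" "t2 \<notin> X" using d(2)[of t1] d(2)[of t2] d(1)
      by (auto simp: t1_def t2_def dist_real_def)
    have ev: "(of_bool (Re y < t2) - of_bool (Re y < t1) :: real) = of_bool (y = x)"
      if "y \<in> lin p q" "Re y \<in> X" for y
    proof (cases "y = x")
      case True then show ?thesis using d(1) by (simp add: t1_def t2_def)
    next
      case False
      then have "Re y \<noteq> Re x" using lin_pt True that by metis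
      then have "d \<le> \<bar>Re x - Re y\<bar>" using d(2)[of "Re y"] that by (simp add: dist_real_def)
      then have "Re y < t2 \<longleftrightarrow> Re y < t1" using d(1) unfolding t1_def t2_def by linarith
      then show ?thesis using False by simp
    qed
    have XE: "Re (P e) \<in> X" "Re (Q e) \<in> X" if "e \<in> EL" for e
      using that unfolding X_def EL_def by auto
    have "0 = (\<Sum>e\<in>EL. w e * (of_bool (Re (P e) < t2) - of_bool (Re (Q e) < t2))) -
              (\<Sum>e\<in>EL. w e * (of_bool (Re (P e) < t1) - of_bool (Re (Q e) < t1)))"
      using jump t12 by simp
    also have "\<dots> = (\<Sum>e\<in>EL. w e * ((of_bool (Re (P e) < t2) - of_bool (Re (P e) < t1)) -
        (of_bool (Re (Q e) < t2) - of_bool (Re (Q e) < t1))))"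
      unfolding sum_subtractf[symmetric] by (intro sum.cong) (simp_all add: algebra_simps)
    also have "\<dots> = (\<Sum>e\<in>EL. w e * (of_bool (P e = x) - of_bool (Q e = x)))"
      using ev EL_lin XE by (intro sum.cong) simp_all
    finally show ?thesis unfolding EL_def by simp
  qed
qed

section \<open>Edge functionals that are additive over a tiling\<close>

text \<open>Summation by parts: sorted by line and point, the coefficient of \<open>G L x\<close> is
  the net weight of the edges on \<open>L\<close> that start or end at \<open>x\<close>, which is 0
  by \<open>K\<close>.\<close>

lemma sum_line_potential:
  fixes P Q :: "'e \<Rightarrow> complex" and w :: "'e \<Rightarrow> real" and G :: "complex set \<Rightarrow> complex \<Rightarrow> real"
  assumes fin: "finite E"
    and K: "\<And>L x. (\<Sum>e | e \<in> E \<and> lin (P e) (Q e) = L. w e * (of_bool (P e = x) - of_bool (Q e = x))) = 0"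
  shows "(\<Sum>e\<in>E. w e * (G (lin (P e) (Q e)) (Q e) - G (lin (P e) (Q e)) (P e))) = 0"
proof -
  define X where "X = P ` E \<union> Q ` E"
  have finX: "finite X" using fin by (simp add: X_def)
  have pick: "(\<Sum>x\<in>X. g x * of_bool (y = x)) = g y" if "y \<in> X" for g :: "complex \<Rightarrow> real" and y
  proof -
    have "(\<Sum>x\<in>X. g x * of_bool (y = x)) = (\<Sum>x\<in>X. if y = x then g x else 0)"
      by (intro sum.cong) auto
    then show ?thesis using that finX by (simp add: sum.delta')
  qed
  have "(\<Sum>e\<in>E. w e * (G (lin (P e) (Q e)) (P e) - G (lin (P e) (Q e)) (Q e)))
    = (\<Sum>e\<in>E. \<Sum>x\<in>X. w e * (G (lin (P e) (Q e)) x * of_bool (P e = x) - G (lin (P e) (Q e)) x * of_bool (Q e = x)))"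
  proof (rule sum.cong[OF refl])
    fix e assume "e \<in> E"
    then have "P e \<in> X" "Q e \<in> X" by (auto simp: X_def)
    then show "w e * (G (lin (P e) (Q e)) (P e) - G (lin (P e) (Q e)) (Q e)) =
      (\<Sum>x\<in>X. w e * (G (lin (P e) (Q e)) x * of_bool (P e = x) - G (lin (P e) (Q e)) x * of_bool (Q e = x)))"
      unfolding sum_distrib_left[symmetric] sum_subtractf by (simp only: pick)
  qed
  also have "\<dots> = (\<Sum>x\<in>X. \<Sum>e\<in>E. w e * (G (lin (P e) (Q e)) x * of_bool (P e = x) - G (lin (P e) (Q e)) x * of_bool (Q e = x)))"
    by (rule sum.swap)
  also have "\<dots> = 0"
  proof (rule sum.neutral, rule ballI)
    fix x
    have "(\<Sum>e\<in>E. w e * (G (lin (P e) (Q e)) x * of_bool (P e = x) - G (lin (P e) (Q e)) x * of_bool (Q e = x)))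
      = (\<Sum>L\<in>(\<lambda>e. lin (P e) (Q e)) ` E. \<Sum>e | e \<in> E \<and> lin (P e) (Q e) = L.
          w e * (G (lin (P e) (Q e)) x * of_bool (P e = x) - G (lin (P e) (Q e)) x * of_bool (Q e = x)))"
      by (rule sum.image_gen[OF fin])
    also have "\<dots> = (\<Sum>L\<in>(\<lambda>e. lin (P e) (Q e)) ` E. G L x * (\<Sum>e | e \<in> E \<and> lin (P e) (Q e) = L.
          w e * (of_bool (P e = x) - of_bool (Q e = x))))"
      unfolding sum_distrib_left by (intro sum.cong refl) (simp add: algebra_simps)
    also have "\<dots> = 0" unfolding K by simp
    finally show "(\<Sum>e\<in>E. w e * (G (lin (P e) (Q e)) x * of_bool (P e = x) - G (lin (P e) (Q e)) x * of_bool (Q e = x))) = 0" .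
  qed
  finally have "(\<Sum>e\<in>E. w e * (G (lin (P e) (Q e)) (P e) - G (lin (P e) (Q e)) (Q e))) = 0" .
  moreover have "(\<Sum>e\<in>E. w e * (G (lin (P e) (Q e)) (Q e) - G (lin (P e) (Q e)) (P e))) =
     - (\<Sum>e\<in>E. w e * (G (lin (P e) (Q e)) (P e) - G (lin (P e) (Q e)) (Q e)))"
    unfolding sum_negf[symmetric] by (intro sum.cong) (simp_all add: algebra_simps)
  ultimately show ?thesis by simp
qed

lemma lin_rot:
  assumes "w \<noteq> 0"
  shows "lin (w * u) (w * v) = (*) w ` lin u v"
proof -
  have "x \<in> (*) w ` lin u v" if "x \<in> lin (w * u) (w * v)" for x
  proof
    show "x = w * (x / w)" using assms by simp
    then have "orient (w * u) (w * v) (w * (x / w)) = 0" using that lin_def by simp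
    then show "x / w \<in> lin u v" using assms unfolding orient_rot lin_def by simp
  qed
  then show ?thesis by (auto simp: lin_def orient_rot)
qed

lemma lin_rot_eq_iff:
  assumes "w \<noteq> 0"
  shows "lin (w * u) (w * v) = lin (w * p) (w * q) \<longleftrightarrow> lin u v = lin p q"
  using assms by (simp add: lin_rot inj_image_eq_iff inj_on_def)

text \<open>Edges of a tile are numbered 0, 1, 2; passing \<open>b c a\<close> in place of
  \<open>a b c\<close> gives the end of the edge instead of its start.\<close>

definition corner :: "('i \<Rightarrow> complex) \<Rightarrow> ('i \<Rightarrow> complex) \<Rightarrow> ('i \<Rightarrow> complex) \<Rightarrow> 'i \<times> nat \<Rightarrow> complex" where
  "corner a b c e = (if snd e = 0 then a else if snd e = 1 then b else c) (fst e)"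

lemma sum_edges:
  assumes "finite I"
  shows "(\<Sum>e\<in>I \<times> {0,1,2}. w (fst e) * F (corner a b c e) (corner b c a e))
     = (\<Sum>i\<in>I. w i * tri F (a i) (b i) (c i) :: real)"
proof -
  have "(\<Sum>e\<in>I \<times> {0,1,2}. w (fst e) * F (corner a b c e) (corner b c a e))
    = (\<Sum>i\<in>I. \<Sum>k\<in>{0,1,2}. w i * F (corner a b c (i, k)) (corner b c a (i, k)))"
    unfolding sum.cartesian_product by (intro sum.cong) auto
  also have "\<dots> = (\<Sum>i\<in>I. w i * tri F (a i) (b i) (c i))"
    by (intro sum.cong refl) (simp add: corner_def tri_def algebra_simps)
  finally show ?thesis .
qed

text \<open>By \<open>ray_sum\<close> the ray sum over all edges is the weighted sum of the
  indicators of the triangles, which \<open>ind\<close> makes 0 at generic points.\<close>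

lemma triangle_chain_vertex_weight:
  fixes a b c :: "'i \<Rightarrow> complex" and w :: "'i \<Rightarrow> real"
  assumes fin: "finite I"
    and pos: "\<And>i. i \<in> I \<Longrightarrow> orient (a i) (b i) (c i) > 0"
    and ind: "\<And>z. (\<And>i. i \<in> I \<Longrightarrow> orient (a i) (b i) z \<noteq> 0 \<and> orient (b i) (c i) z \<noteq> 0 \<and> orient (c i) (a i) z \<noteq> 0)
      \<Longrightarrow> (\<Sum>i\<in>I. w i * of_bool (orient (a i) (b i) z > 0 \<and> orient (b i) (c i) z > 0 \<and> orient (c i) (a i) z > 0)) = 0"
    and pq: "Re p \<noteq> Re q"
  shows "(\<Sum>e | e \<in> I \<times> {0,1,2} \<and> lin (corner a b c e) (corner b c a e) = lin p q.
     w (fst e) * (of_bool (corner a b c e = x) - of_bool (corner b c a e = x))) = 0"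
proof (rule line_vertex_weight[OF _ _ _ pq])
  show "finite (I \<times> {0, 1, 2::nat})" using fin by simp
  have "a i \<noteq> b i \<and> b i \<noteq> c i \<and> c i \<noteq> a i" if "i \<in> I" for i
    using pos[OF that] by auto
  then show "corner a b c e \<noteq> corner b c a e" if "e \<in> I \<times> {0, 1, 2}" for e
    using that by (auto simp: corner_def)
  fix z
  assume gen: "\<And>e. e \<in> I \<times> {0, 1, 2::nat} \<Longrightarrow> Re z \<noteq> Re (corner a b c e) \<and>
      Re z \<noteq> Re (corner b c a e) \<and> orient (corner a b c e) (corner b c a e) z \<noteq> 0"
  have g: "Re z \<noteq> Re (a i) \<and> Re z \<noteq> Re (b i) \<and> Re z \<noteq> Re (c i) \<and>
     orient (a i) (b i) z \<noteq> 0 \<and> orient (b i) (c i) z \<noteq> 0 \<and> orient (c i) (a i) z \<noteq> 0" if "i \<in> I" for i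
    using gen[of "(i,0)"] gen[of "(i,1)"] gen[of "(i,2)"] that by (simp add: corner_def)
  have "(\<Sum>e\<in>I \<times> {0,1,2}. w (fst e) * ray z (corner a b c e) (corner b c a e))
     = (\<Sum>i\<in>I. w i * tri (ray z) (a i) (b i) (c i))"
    by (rule sum_edges[OF fin])
  also have "\<dots> = (\<Sum>i\<in>I. w i * of_bool (orient (a i) (b i) z > 0 \<and> orient (b i) (c i) z > 0 \<and> orient (c i) (a i) z > 0))"
    using g pos by (intro sum.cong refl arg_cong2[where f = "(*)"] ray_sum) auto
  also have "\<dots> = 0" using g by (intro ind) auto
  finally show "(\<Sum>e\<in>I \<times> {0,1,2}. w (fst e) * ray z (corner a b c e) (corner b c a e)) = 0" .
qed

lemma triangle_chain:
  fixes a b c :: "'i \<Rightarrow> complex" and w :: "'i \<Rightarrow> real"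
  assumes fin: "finite I"
    and pos: "\<And>i. i \<in> I \<Longrightarrow> orient (a i) (b i) (c i) > 0"
    and ind: "\<And>z. (\<And>i. i \<in> I \<Longrightarrow> orient (a i) (b i) z \<noteq> 0 \<and> orient (b i) (c i) z \<noteq> 0 \<and> orient (c i) (a i) z \<noteq> 0)
      \<Longrightarrow> (\<Sum>i\<in>I. w i * of_bool (orient (a i) (b i) z > 0 \<and> orient (b i) (c i) z > 0 \<and> orient (c i) (a i) z > 0)) = 0"
  shows "(\<Sum>i\<in>I. w i * tri (\<lambda>u v. G (lin u v) v - G (lin u v) u) (a i) (b i) (c i)) = 0"
proof -
  let ?E = "I \<times> {0,1,2::nat}"
  have ne: "corner a b c e \<noteq> corner b c a e" if "e \<in> ?E" for e
  proof -
    have "a i \<noteq> b i \<and> b i \<noteq> c i \<and> c i \<noteq> a i" if "i \<in> I" for i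
      using pos[OF that] by auto
    then show ?thesis using that by (auto simp: corner_def)
  qed
  have "(\<Sum>e\<in>?E. w (fst e) * (G (lin (corner a b c e) (corner b c a e)) (corner b c a e)
      - G (lin (corner a b c e) (corner b c a e)) (corner a b c e))) = 0"
  proof (rule sum_line_potential)
    show "finite ?E" using fin by simp
    fix L x
    show "(\<Sum>e | e \<in> ?E \<and> lin (corner a b c e) (corner b c a e) = L.
     w (fst e) * (of_bool (corner a b c e = x) - of_bool (corner b c a e = x))) = 0"
    proof (cases "\<exists>e\<in>?E. lin (corner a b c e) (corner b c a e) = L")
      case False
      then show ?thesis by (intro sum.neutral) auto
    next
      case True
      then obtain p q where L: "L = lin p q" and "p \<noteq> q" using ne by metis
      show ?thesis
      proof (cases "Re p = Re q")
        case False
        show ?thesis unfolding L using fin pos ind False by (rule triangle_chain_vertex_weight)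
      next
        \<comment> \<open>Rays do not see vertical edges; a quarter turn makes the line
          horizontal.\<close>
        case True
        with \<open>p \<noteq> q\<close> have "Re (\<i> * p) \<noteq> Re (\<i> * q)" by (simp add: complex_eq_iff)
        have co: "corner (\<lambda>i. \<i> * a i) (\<lambda>i. \<i> * b i) (\<lambda>i. \<i> * c i) e = \<i> * corner a b c e" for a b c :: "'i \<Rightarrow> complex" and e
          by (simp add: corner_def)
        have oi: "orient (\<i> * u) (\<i> * v) z = orient u v (z / \<i>)" for u v z
          using orient_rot[of \<i> u v "z / \<i>"] by simp
        have "(\<Sum>e | e \<in> ?E \<and> lin (\<i> * corner a b c e) (\<i> * corner b c a e) = lin (\<i> * p) (\<i> * q).
          w (fst e) * (of_bool (\<i> * corner a b c e = \<i> * x) - of_bool (\<i> * corner b c a e = \<i> * x))) = 0"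
          unfolding co[symmetric]
        proof (rule triangle_chain_vertex_weight)
          show "orient (\<i> * a i) (\<i> * b i) (\<i> * c i) > 0" if "i \<in> I" for i
            using pos[OF that] by (simp add: orient_rot)
          fix z
          assume "\<And>i. i \<in> I \<Longrightarrow> orient (\<i> * a i) (\<i> * b i) z \<noteq> 0 \<and>
            orient (\<i> * b i) (\<i> * c i) z \<noteq> 0 \<and> orient (\<i> * c i) (\<i> * a i) z \<noteq> 0"
          then show "(\<Sum>i\<in>I. w i * of_bool (orient (\<i> * a i) (\<i> * b i) z > 0 \<and>
             orient (\<i> * b i) (\<i> * c i) z > 0 \<and> orient (\<i> * c i) (\<i> * a i) z > 0)) = 0"
            unfolding oi by (rule ind)
        qed fact+
        then show ?thesis unfolding L by (simp add: lin_rot_eq_iff)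
      qed
    qed
  qed
  then show ?thesis unfolding sum_edges[OF fin, of w "\<lambda>u v. G (lin u v) v - G (lin u v) u"] .
qed

section \<open>Additive functionals on the boundaries of the tiles\<close>

locale triangle_tiling =
  fixes I :: "'i set" and a b c :: "'i \<Rightarrow> complex" and A B C :: complex
  assumes fin: "finite I"
    and pos: "i \<in> I \<Longrightarrow> orient (a i) (b i) (c i) > 0"
    and POS: "orient A B C > 0"
    and union: "(\<Union>i\<in>I. convex hull {a i, b i, c i}) = convex hull {A, B, C}"
    and disj: "i \<in> I \<Longrightarrow> j \<in> I \<Longrightarrow> i \<noteq> j \<Longrightarrow>
      interior (convex hull {a i, b i, c i}) \<inter> interior (convex hull {a j, b j, c j}) = {}"
begin

text \<open>
  The potential \<open>G\<close> is an arbitrary function of a line and a point, without any regularity: on each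
  line the boundary edges of the tiles and of the big triangle cancel as formal sums of segments.
\<close>

lemma line_potential:
  fixes G :: "complex set \<Rightarrow> complex \<Rightarrow> real"
  shows "(\<Sum>i\<in>I. tri (\<lambda>u v. G (lin u v) v - G (lin u v) u) (a i) (b i) (c i))
     = tri (\<lambda>u v. G (lin u v) v - G (lin u v) u) A B C"
  (is "(\<Sum>i\<in>I. tri ?F _ _ _) = _")
proof -
  \<comment> \<open>The big triangle joins the tiles as index \<open>None\<close> with weight -1, so
    that the weighted indicators cancel at generic points.\<close>
  define J where "J = insert None (Some ` I)"
  define w where "w = (\<lambda>j. case j of None \<Rightarrow> -1 | Some (i::'i) \<Rightarrow> (1::real))"
  define a' where "a' = (\<lambda>j. case j of None \<Rightarrow> A | Some i \<Rightarrow> a i)"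
  define b' where "b' = (\<lambda>j. case j of None \<Rightarrow> B | Some i \<Rightarrow> b i)"
  define c' where "c' = (\<lambda>j. case j of None \<Rightarrow> C | Some i \<Rightarrow> c i)"
  note d = J_def w_def a'_def b'_def c'_def
  have sumJ: "(\<Sum>j\<in>J. f j) = f None + (\<Sum>i\<in>I. f (Some i))" for f :: "'i option \<Rightarrow> real"
    unfolding J_def using fin by (simp add: sum.reindex image_iff)
  have "(\<Sum>j\<in>J. w j * tri ?F (a' j) (b' j) (c' j)) = 0"
  proof (rule triangle_chain)
    show "finite J" using fin by (simp add: J_def)
    show "orient (a' j) (b' j) (c' j) > 0" if "j \<in> J" for j
      using that pos POS by (auto simp: d)
    fix z
    assume gen: "\<And>j. j \<in> J \<Longrightarrow> orient (a' j) (b' j) z \<noteq> 0 \<and> orient (b' j) (c' j) z \<noteq> 0 \<and> orient (c' j) (a' j) z \<noteq> 0"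
    let ?in = "\<lambda>i. orient (a i) (b i) z > 0 \<and> orient (b i) (c i) z > 0 \<and> orient (c i) (a i) z > 0"
    let ?IN = "orient A B z > 0 \<and> orient B C z > 0 \<and> orient C A z > 0"
    have g: "?in i \<longleftrightarrow> z \<in> convex hull {a i, b i, c i}" if "i \<in> I" for i
      using gen[of "Some i"] that unfolding in_triangle_iff[OF pos[OF that]] by (auto simp: d)
    have G: "?IN \<longleftrightarrow> z \<in> convex hull {A, B, C}"
      using gen[of None] unfolding in_triangle_iff[OF POS] by (auto simp: d)
    have "(\<Sum>i\<in>I. of_bool (?in i)) = (of_bool ?IN :: real)"
    proof (cases ?IN)
      case True
      then obtain i where i: "i \<in> I" "z \<in> convex hull {a i, b i, c i}" using G union by blast
      have "j = i" if "j \<in> I" "?in j" for j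
      proof (rule ccontr)
        assume "j \<noteq> i"
        moreover have "z \<in> interior (convex hull {a j, b j, c j})" using that by (intro strict_in_interior) auto
        moreover have "z \<in> interior (convex hull {a i, b i, c i})" using i g by (intro strict_in_interior) auto
        ultimately show False using disj[of j i] that i by blast
      qed
      then have "(\<Sum>k\<in>I. of_bool (?in k)) = (\<Sum>k\<in>I. if k = i then 1 else (0::real))"
      proof (intro sum.cong refl)
        fix k assume "k \<in> I"
        moreover have "?in i" using i g by blast
        ultimately have "?in k \<longleftrightarrow> k = i" using \<open>\<And>j. j \<in> I \<Longrightarrow> ?in j \<Longrightarrow> j = i\<close> by blast
        then show "of_bool (?in k) = (if k = i then 1 else (0::real))" by simp
      qed
      then show ?thesis using True i fin by simp
    next
      case False
      then have "\<not> ?in i" if "i \<in> I" for i using G g union that by blast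
      then have "(\<Sum>k\<in>I. of_bool (?in k)) = (0::real)" by (intro sum.neutral) simp
      then show ?thesis using False by simp
    qed
    then show "(\<Sum>j\<in>J. w j * of_bool (orient (a' j) (b' j) z > 0 \<and> orient (b' j) (c' j) z > 0 \<and> orient (c' j) (a' j) z > 0)) = 0"
      unfolding sumJ by (simp add: d)
  qed
  then show ?thesis unfolding sumJ by (simp add: d)
qed

definition verts :: "complex set" where
  "verts = a ` I \<union> b ` I \<union> c ` I \<union> {A, B, C}"

text \<open>Fixing a base point on each line, additivity makes \<open>F u v\<close> a difference of
  values \<open>F (base L) _\<close>, a potential on that line. The set \<open>V\<close> admits
  functionals built from conjugation, which are additive only on a lattice.\<close>

lemma additive:
  fixes F :: "complex \<Rightarrow> complex \<Rightarrow> real"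
  assumes V: "verts \<subseteq> V"
    and add: "\<And>p q r. p \<in> V \<Longrightarrow> q \<in> V \<Longrightarrow> r \<in> V \<Longrightarrow> orient p q r = 0 \<Longrightarrow> F p q + F q r = F p r"
  shows "(\<Sum>i\<in>I. tri F (a i) (b i) (c i)) = tri F A B C"
proof -
  define base where "base L = (SOME x. x \<in> V \<and> x \<in> L)" for L
  define G where "G L x = F (base L) x" for L x
  let ?F = "\<lambda>u v. G (lin u v) v - G (lin u v) u"
  have e: "F u v = ?F u v" if "u \<in> V" "v \<in> V" for u v
  proof -
    have "\<exists>x. x \<in> V \<and> x \<in> lin u v" using that lin_mem by blast
    then have b: "base (lin u v) \<in> V \<and> base (lin u v) \<in> lin u v" unfolding base_def by (rule someI_ex)
    then have "orient (base (lin u v)) u v = 0" using orient_cyc[of u v "base (lin u v)"] unfolding lin_def by simp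
    then show ?thesis using add[of "base (lin u v)" u v] b that by (simp add: G_def)
  qed
  have "tri F (a i) (b i) (c i) = tri ?F (a i) (b i) (c i)" if "i \<in> I" for i
  proof -
    have "a i \<in> V" "b i \<in> V" "c i \<in> V" using that V unfolding verts_def by auto
    then show ?thesis unfolding tri_def by (simp only: e)
  qed
  then have "(\<Sum>i\<in>I. tri F (a i) (b i) (c i)) = (\<Sum>i\<in>I. tri ?F (a i) (b i) (c i))"
    by (intro sum.cong) auto
  moreover have "tri F A B C = tri ?F A B C"
  proof -
    have "A \<in> V" "B \<in> V" "C \<in> V" using V unfolding verts_def by auto
    then show ?thesis unfolding tri_def by (simp only: e)
  qed
  ultimately show ?thesis using line_potential[of G] by simp
qed

lemma area: "(\<Sum>i\<in>I. orient (a i) (b i) (c i)) = orient A B C"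
proof -
  have "(\<Sum>i\<in>I. tri cr (a i) (b i) (c i)) = tri cr A B C"
    by (rule additive[OF subset_UNIV]) (simp add: orient_def cr_def algebra_simps)
  then show ?thesis by (simp add: tri_def orient_alt)
qed

text \<open>
  The flagged tiles alone already fill up the area of the big triangle: apply \<open>line_potential\<close> to the
  area potential, switched off wherever the flag fails.
\<close>

lemma propagate:
  fixes H :: "complex set \<Rightarrow> complex \<Rightarrow> bool"
  assumes tile: "\<And>i. i \<in> I \<Longrightarrow> \<exists>h. \<forall>(u, v) \<in> {(a i, b i), (b i, c i), (c i, a i)}. H (lin u v) u = h \<and> H (lin u v) v = h"
    and T: "\<forall>(u, v) \<in> {(A, B), (B, C), (C, A)}. H (lin u v) u \<and> H (lin u v) v"
    and i: "i \<in> I"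
  shows "H (lin (a i) (b i)) (a i)"
proof -
  define base where "base L = (SOME x. x \<in> L)" for L :: "complex set"
  define G where "G L x = (if H L x then cr (base L) x else 0)" for L x
  let ?F = "\<lambda>u v. G (lin u v) v - G (lin u v) u"
  define good where "good i = H (lin (a i) (b i)) (a i)" for i
  \<comment> \<open>\<open>cr (base L)\<close> is a potential of \<open>cr\<close> along
    \<open>L\<close> because \<open>base L\<close> lies on \<open>L\<close>.\<close>
  have e: "cr (base (lin u v)) v - cr (base (lin u v)) u = cr u v" for u v
  proof -
    have "base (lin u v) \<in> lin u v" unfolding base_def using lin_mem someI by metis
    then have "orient u v (base (lin u v)) = 0" by (simp add: lin_def)
    moreover have "cr v (base (lin u v)) = - cr (base (lin u v)) v" by (simp add: cr_def)
    ultimately show ?thesis unfolding orient_alt by simp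
  qed
  have "tri ?F A B C = orient A B C"
    using T unfolding tri_def orient_alt G_def by (simp add: e)
  moreover have "tri ?F (a i) (b i) (c i) = of_bool (good i) * orient (a i) (b i) (c i)" if "i \<in> I" for i
    using tile[OF that] unfolding tri_def orient_alt G_def good_def by (cases "good i") (auto simp: e good_def)
  ultimately have "(\<Sum>i\<in>I. of_bool (good i) * orient (a i) (b i) (c i)) = (\<Sum>i\<in>I. orient (a i) (b i) (c i))"
    using line_potential[of G] area by simp
  then have "(\<Sum>i\<in>I. (1 - of_bool (good i)) * orient (a i) (b i) (c i)) = 0"
    by (simp add: left_diff_distrib sum_subtractf)
  moreover have "0 \<le> (1 - of_bool (good j)) * orient (a j) (b j) (c j)" if "j \<in> I" for j
    using pos[OF that] by simp
  ultimately have "\<forall>j\<in>I. (1 - of_bool (good j)) * orient (a j) (b j) (c j) = 0"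
    using sum_nonneg_eq_0_iff[OF fin, of "\<lambda>j. (1 - of_bool (good j)) * orient (a j) (b j) (c j)"] by simp
  then have "(1 - of_bool (good i)) * orient (a i) (b i) (c i) = 0" using i by (rule bspec)
  then show ?thesis using pos[OF i] by (simp add: good_def split: if_splits)
qed

end

section \<open>Angles subtended by edges\<close>

text \<open>The signed angle from \<open>p\<close> to \<open>q\<close> seen from \<open>z\<close>.
  The value 0 on the whole line, even strictly between \<open>p\<close> and \<open>q\<close>, is
  deliberate: a straight angle has no canonical sign, and additivity would fail.\<close>

definition ang :: "complex \<Rightarrow> complex \<Rightarrow> complex \<Rightarrow> real" where
  "ang z p q = (if orient z p q = 0 then 0 else Arg ((q - z) / (p - z)))"

lemma Im_quotient: "Im ((q - z) / (p - z)) = orient z p q / (norm (p - z))\<^sup>2"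
  unfolding cmod_power2 by (simp add: Im_divide orient_def cr_def algebra_simps)

lemma ang_bounds:
  "orient z p q > 0 \<Longrightarrow> 0 < ang z p q \<and> ang z p q < pi"
  "orient z p q < 0 \<Longrightarrow> - pi < ang z p q \<and> ang z p q < 0"
  "orient z p q = 0 \<Longrightarrow> ang z p q = 0"
proof -
  assume *: "orient z p q > 0"
  then have "p \<noteq> z" by auto
  then have "Im ((q - z) / (p - z)) > 0" unfolding Im_quotient using * by simp
  then show "0 < ang z p q \<and> ang z p q < pi" using * unfolding ang_def by (simp add: Arg_lt_pi)
next
  assume *: "orient z p q < 0"
  then have "p \<noteq> z" by auto
  then have "Im ((q - z) / (p - z)) < 0" unfolding Im_quotient using *
    by (simp add: divide_neg_pos)
  then show "- pi < ang z p q \<and> ang z p q < 0" using * mpi_less_Arg unfolding ang_def by (simp add: Arg_neg_iff)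
qed (simp add: ang_def)

lemma collinear_trans:
  assumes "p \<noteq> q" "orient p q x = 0" "orient p q y = 0"
  shows "orient q x y = 0" "orient p x y = 0"
proof -
  obtain s where x: "x = p + of_real s * (q - p)" using assms(1,2) by (rule collinear_param)
  obtain t where y: "y = p + of_real t * (q - p)" using assms(1,3) by (rule collinear_param)
  show "orient q x y = 0" "orient p x y = 0"
    unfolding x y orient_def cr_def by (simp_all add: algebra_simps)
qed

lemma orient0:
  assumes "orient a b c = 0"
  shows "orient b c a = 0 \<and> orient c a b = 0 \<and> orient a c b = 0 \<and> orient b a c = 0 \<and> orient c b a = 0"
  using assms orient_cyc[of b c a] orient_cyc[of c a b] orient_swap[of a c b] orient_swap[of b a c] orient_swap[of c b a]
  by simp

text \<open>If one of the first two orientations vanishes, an edge is degenerate or \<open>z\<close>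
  is on the line. Otherwise arguments add modulo 2 pi, and since \<open>orient z\<close> itself is
  additive along a line, the signs of the angles rule out a jump by 2 pi.\<close>

lemma ang_add:
  assumes "orient p q r = 0"
  shows "ang z p q + ang z q r = ang z p r"
proof -
  have sum: "orient z p q + orient z q r = orient z p r"
    using assms orient_sum[of p q z r] by (simp add: orient_def cr_def algebra_simps)
  have z1: "orient z q r = 0" if "orient z p q = 0" "p \<noteq> q"
    using collinear_trans(1)[OF that(2), of z r] orient0[OF that(1)] assms orient0 by blast
  have z2: "orient z p q = 0" if "orient z q r = 0" "q \<noteq> r"
    using collinear_trans(2)[OF that(2), of z p] orient0[OF that(1)] orient0[OF assms] orient0 by blast
  have z3: "orient z p q = 0" if "orient z p r = 0" "p \<noteq> r"
    using collinear_trans(2)[OF that(2), of z q] orient0[OF that(1)] orient0[OF assms] orient0 by blast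
  show ?thesis
  proof (cases "orient z p q = 0 \<or> orient z q r = 0")
    case True
    then show ?thesis using z1 z2 sum ang_bounds(3) by (smt (verit, best))
  next
    case False
    then have nz: "p \<noteq> z" "q \<noteq> z" "r \<noteq> z" by auto
    have "Arg ((r - z) / (p - z)) = ang z p r"
    proof (cases "orient z p r = 0")
      case True
      then have "p = r" using z3 False by blast
      then show ?thesis using nz True by (simp add: ang_def)
    qed (simp add: ang_def)
    moreover have "((q - z) / (p - z)) * ((r - z) / (q - z)) = (r - z) / (p - z)" using nz by simp
    ultimately have a3: "ang z p r = Arg (((q - z) / (p - z)) * ((r - z) / (q - z)))" by simp
    have a1: "ang z p q = Arg ((q - z) / (p - z))" and a2: "ang z q r = Arg ((r - z) / (q - z))"
      using False unfolding ang_def by simp_all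
    have e: "ang z p r = ang z p q + ang z q r +
       (if ang z p q + ang z q r \<in> {-pi<..pi} then 0 else if ang z p q + ang z q r > pi then - 2 * pi else 2 * pi)"
      unfolding a1 a2 a3 by (rule Arg_times') (use nz in auto)
    note b = ang_bounds[of z p q] ang_bounds[of z q r] ang_bounds[of z p r]
    consider "orient z p q > 0" "orient z q r > 0" | "orient z p q < 0" "orient z q r < 0"
      | "orient z p q > 0" "orient z q r < 0" | "orient z p q < 0" "orient z q r > 0"
      using False by linarith
    then show ?thesis
    proof cases
      case 1
      then have "ang z p r > 0" "ang z p q > 0" "ang z p q < pi" "ang z q r > 0" "ang z q r < pi" using b sum by auto
      then show ?thesis using e by (auto split: if_splits)
    next
      case 2
      then have "ang z p r < 0" "ang z p q < 0" "ang z p q > - pi" "ang z q r < 0" "ang z q r > - pi" using b sum by auto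
      then show ?thesis using e by (auto split: if_splits)
    qed (use b e in auto)
  qed
qed

lemma ang_swap: "ang z q p = - ang z p q"
  using ang_add[of p q p z] by (simp add: ang_def)

lemma of_int_pi_less: "real_of_int m * pi < real_of_int n * pi \<Longrightarrow> m < n"
  using mult_less_cancel_right_pos[OF pi_gt_zero, of "real_of_int m" "real_of_int n"] by simp

text \<open>The three quotients multiply to 1, so their arguments add up to a multiple of 2 pi; each
  edge line through \<open>z\<close> replaces an argument 0 or pi by 0. The bounds on single angles
  leave the values for \<open>z\<close> outside, on an edge, and inside.\<close>

lemma tri_ang_nonvertex:
  assumes pos: "orient a b c > 0" and z: "z \<noteq> a" "z \<noteq> b" "z \<noteq> c"
  shows "tri (ang z) a b c = 0 \<or> tri (ang z) a b c = pi \<or> tri (ang z) a b c = 2 * pi"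
proof -
  define x y w where "x = (b - z) / (a - z)" and "y = (c - z) / (b - z)" and "w = (a - z) / (c - z)"
  have nz: "x \<noteq> 0" "y \<noteq> 0" "w \<noteq> 0" using z by (auto simp: x_def y_def w_def)
  have "x * y * w = 1" using z by (simp add: x_def y_def w_def)
  then have "sgn x * sgn y * sgn w = 1" by (metis sgn_mult sgn_one)
  then have "cis (Arg x + Arg y + Arg w) = 1" using nz by (simp add: cis_mult[symmetric] cis_Arg)
  then have "cos (Arg x + Arg y + Arg w) = 1" by (simp add: complex_eq_iff)
  then obtain n :: int where n: "Arg x + Arg y + Arg w = of_int n * (2 * pi)" using cos_one_2pi_int by auto
  have m: "\<exists>m::int. ang z p q = Arg ((q - z) / (p - z)) - of_int m * pi \<and> (orient z p q \<noteq> 0 \<longrightarrow> m = 0)" for p q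
  proof (cases "orient z p q = 0")
    case True
    then have "Im ((q - z) / (p - z)) = 0" by (simp add: Im_quotient)
    then have "Arg ((q - z) / (p - z)) = 0 \<or> Arg ((q - z) / (p - z)) = pi"
      by (simp add: Arg_eq_0_pi complex_is_Real_iff)
    then show ?thesis using True by (auto simp: ang_def intro: exI[of _ 0] exI[of _ 1])
  qed (auto simp: ang_def intro: exI[of _ 0])
  obtain m1 m2 m3 :: int where m123:
    "ang z a b = Arg x - of_int m1 * pi" "orient z a b \<noteq> 0 \<longrightarrow> m1 = 0"
    "ang z b c = Arg y - of_int m2 * pi" "orient z b c \<noteq> 0 \<longrightarrow> m2 = 0"
    "ang z c a = Arg w - of_int m3 * pi" "orient z c a \<noteq> 0 \<longrightarrow> m3 = 0"
    using m[of a b] m[of b c] m[of c a] unfolding x_def y_def w_def by metis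
  define N where "N = 2 * n - m1 - m2 - m3"
  have tN: "tri (ang z) a b c = of_int N * pi"
    using n m123 by (simp add: tri_def N_def algebra_simps)
  have os: "orient z a b + orient z b c + orient z c a > 0"
    using orient_sum[of a b z c] orient_cyc pos by metis
  have lt: "ang z p q < pi" "- pi < ang z p q" for p q
    using ang_bounds[of z p q] pi_gt_zero by (cases "orient z p q" "0::real" rule: linorder_cases; simp)+
  have some: "ang z a b > 0 \<or> ang z b c > 0 \<or> ang z c a > 0"
    using os ang_bounds(1)[of z a b] ang_bounds(1)[of z b c] ang_bounds(1)[of z c a] by linarith
  note b = lt[of a b] lt[of b c] lt[of c a] some
  show ?thesis
  proof (cases "orient z a b \<noteq> 0 \<and> orient z b c \<noteq> 0 \<and> orient z c a \<noteq> 0")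
    case True
    then have "N = 2 * n" using m123 by (simp add: N_def)
    have "- 2 * pi < tri (ang z) a b c \<and> tri (ang z) a b c < 3 * pi"
      using b unfolding tri_def by (smt (verit))
    then have "real_of_int (- 2) * pi < of_int N * pi" "of_int N * pi < real_of_int 3 * pi" using tN by simp_all
    then have "- 2 < N" "N < 3" by (blast dest: of_int_pi_less)+
    then have "N = 0 \<or> N = 2" using \<open>N = 2 * n\<close> by presburger
    then show ?thesis using tN by auto
  next
    case False
    have "- pi < tri (ang z) a b c \<and> tri (ang z) a b c < 2 * pi"
      using b False ang_bounds(3)[of z a b] ang_bounds(3)[of z b c] ang_bounds(3)[of z c a] unfolding tri_def
      by (smt (verit))
    then have "real_of_int (- 1) * pi < of_int N * pi" "of_int N * pi < real_of_int 2 * pi" using tN by simp_all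
    then have "- 1 < N" "N < 2" by (blast dest: of_int_pi_less)+
    then have "N = 0 \<or> N = 1" by linarith
    then show ?thesis using tN by auto
  qed
qed

lemma tri_ang_vertex: "tri (ang a) a b c = ang a b c"
  by (simp add: tri_def ang_def)

lemma tri_ang_nonneg:
  assumes "orient a b c > 0"
  shows "0 \<le> tri (ang z) a b c"
proof -
  have "orient b c a > 0" "orient c a b > 0" using assms orient_cyc by metis+
  then show ?thesis
    using tri_ang_nonvertex[OF assms, of z] ang_bounds(1) assms tri_cyc tri_ang_vertex
    by (smt (verit) pi_gt_zero)
qed

text \<open>Half-angle formula: \<open>1 - cis (- t) = 2 * sin (t / 2) * cis ((pi - t) / 2)\<close>.
  The two expressions are the side quotients at the base corners of an isosceles triangle with apex
  angle \<open>t\<close>.\<close>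

lemma Arg_one_minus_cis:
  assumes "0 < t" "t < pi"
  shows "Arg (1 - cis (- t)) = (pi - t) / 2" "Arg (1 / (1 - cis t)) = (pi - t) / 2"
proof -
  have sin: "sin (t / 2) > 0" using assms by (intro sin_gt_zero) auto
  have c: "cos t = 1 - 2 * (sin (t / 2))\<^sup>2" "sin t = 2 * sin (t / 2) * cos (t / 2)"
    using cos_double_sin[of "t / 2"] sin_double[of "t / 2"] by simp_all
  have e: "cos ((pi - t) / 2) = sin (t / 2)" "sin ((pi - t) / 2) = cos (t / 2)"
    by (simp_all add: diff_divide_distrib cos_diff sin_diff)
  have 1: "1 - cis (- t) = rcis (2 * sin (t / 2)) ((pi - t) / 2)"
    by (simp add: complex_eq_iff rcis_def e c power2_eq_square)
  show "Arg (1 - cis (- t)) = (pi - t) / 2"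
    unfolding 1 using assms sin by (intro Arg_rcis) auto
  have "1 - cis t = cnj (1 - cis (- t))" by (simp add: complex_eq_iff)
  then have "1 - cis t = rcis (2 * sin (t / 2)) (- ((pi - t) / 2))"
    unfolding 1 by (simp add: complex_eq_iff)
  then have "inverse (1 - cis t) = rcis (1 / (2 * sin (t / 2))) (- (- ((pi - t) / 2)))"
    by (simp only: rcis_inverse)
  then have "1 / (1 - cis t) = rcis (1 / (2 * sin (t / 2))) ((pi - t) / 2)"
    by (simp only: inverse_eq_divide minus_minus)
  then show "Arg (1 / (1 - cis t)) = (pi - t) / 2"
    using assms sin by (simp only:) (intro Arg_rcis, auto)
qed

lemma ang_isosceles:
  assumes "0 < t" "t < pi" "u \<noteq> 0"
  shows "orient p (p + u) (p + u * cis t) > 0"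
    and "ang p (p + u) (p + u * cis t) = t"
    and "ang (p + u) (p + u * cis t) p = (pi - t) / 2"
    and "ang (p + u * cis t) p (p + u) = (pi - t) / 2"
proof -
  have "orient p (p + u) (p + u * cis t) = (norm u)\<^sup>2 * sin t"
    unfolding cmod_power2 by (simp add: orient_def cr_def algebra_simps power2_eq_square)
  then show pos: "orient p (p + u) (p + u * cis t) > 0" using assms by (simp add: sin_gt_zero)
  then have pos': "orient (p + u) (p + u * cis t) p > 0" "orient (p + u * cis t) p (p + u) > 0"
    using orient_cyc by metis+
  have c1: "cis t \<noteq> 1"
  proof
    assume "cis t = 1" then have "sin t = 0" by (simp add: complex_eq_iff)
    then show False using assms sin_gt_zero[of t] by simp
  qed
  show "ang p (p + u) (p + u * cis t) = t"
    using pos assms by (simp add: ang_def Arg_cis)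
  have "(p - (p + u)) / (p + u * cis t - (p + u)) = 1 / (1 - cis t)"
    using assms(3) c1 by (simp add: field_simps)
  then show "ang (p + u) (p + u * cis t) p = (pi - t) / 2"
    unfolding ang_def using pos' Arg_one_minus_cis[OF assms(1,2)] by simp
  have "(p + u - (p + u * cis t)) / (p - (p + u * cis t)) = 1 - cis (- t)"
    using assms(3) by (simp add: cis_inverse[symmetric] field_simps)
  then show "ang (p + u * cis t) p (p + u) = (pi - t) / 2"
    unfolding ang_def using pos' Arg_one_minus_cis[OF assms(1,2)] by simp
qed

lemma tri_ang_isosceles:
  fixes p :: complex
  assumes "0 < t" "t < pi" "u \<noteq> 0"
  defines "a \<equiv> p" and "b \<equiv> p + u" and "c \<equiv> p + u * cis t"
  shows "z = a \<Longrightarrow> tri (ang z) a b c = t" "z = b \<or> z = c \<Longrightarrow> tri (ang z) a b c = (pi - t) / 2"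
  using ang_isosceles(2-4)[OF assms(1-3), of p, folded a_def b_def c_def] tri_ang_vertex
    tri_cyc[of "ang z" b c a] tri_cyc[of "ang z" a b c]
  by metis+

lemma (in triangle_tiling) ang_sum:
  "(\<Sum>i\<in>I. tri (ang z) (a i) (b i) (c i)) = tri (ang z) A B C"
  by (rule additive[OF subset_UNIV]) (rule ang_add)

lemma real_comb_apex:
  fixes a b c :: real
  assumes "b = of_nat k * a" "b + 2 * a = c"
  shows "a * real x + b * real y = a * real (x + k * y)" "real j * c = a * real (j * (k + 2))"
  using assms(1) by (simp_all add: assms(2)[symmetric] algebra_simps)

section \<open>Tilings by isosceles triangles with unit legs\<close>

text \<open>Normal form: apex \<open>p i\<close>, first leg \<open>u i\<close> of length 1, second
  leg counterclockwise from it. A reflected isosceles tile has this form too, with its legs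
  exchanged, so reflections need no separate treatment.\<close>

locale iso_tiling =
  fixes I :: "'i set" and p u :: "'i \<Rightarrow> complex" and s \<beta> :: real
  assumes fin: "finite I"
    and unit: "i \<in> I \<Longrightarrow> norm (u i) = 1"
    and s: "s > 0"
    and \<beta>: "0 < \<beta>" "\<beta> < pi"
    and union: "(\<Union>i\<in>I. convex hull {p i, p i + u i, p i + u i * cis \<beta>}) = convex hull {0, of_real s, of_real s * cis \<beta>}"
    and disj: "i \<in> I \<Longrightarrow> j \<in> I \<Longrightarrow> i \<noteq> j \<Longrightarrow>
      interior (convex hull {p i, p i + u i, p i + u i * cis \<beta>}) \<inter>
      interior (convex hull {p j, p j + u j, p j + u j * cis \<beta>}) = {}"
begin

lemma u_nz: "i \<in> I \<Longrightarrow> u i \<noteq> 0"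
  using unit by fastforce

sublocale triangle_tiling I p "\<lambda>i. p i + u i" "\<lambda>i. p i + u i * cis \<beta>" 0 "of_real s" "of_real s * cis \<beta>"
proof
  show "0 < orient (p i) (p i + u i) (p i + u i * cis \<beta>)" if "i \<in> I" for i
    using ang_isosceles(1)[OF \<beta> u_nz[OF that]] .
  show "0 < orient 0 (of_real s) (of_real s * cis \<beta>)"
    using ang_isosceles(1)[OF \<beta>, of "of_real s" 0] s by simp
qed (use fin union disj in auto)

definition \<alpha> :: real where "\<alpha> = (pi - \<beta>) / 2"

lemma \<alpha>_pos: "\<alpha> > 0"
  using \<beta> by (simp add: \<alpha>_def)

lemma \<alpha>_sum: "\<beta> + 2 * \<alpha> = pi"
  unfolding \<alpha>_def by (simp add: diff_divide_distrib)

lemma orient_tile: "norm w = 1 \<Longrightarrow> orient q (q + w) (q + w * cis \<beta>) = sin \<beta>"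
proof -
  have "orient q (q + w) (q + w * cis \<beta>) = (norm w)\<^sup>2 * sin \<beta>"
    unfolding cmod_power2 by (simp add: orient_def cr_def algebra_simps power2_eq_square)
  then show "norm w = 1 \<Longrightarrow> ?thesis" by simp
qed

lemma sin_\<beta>: "sin \<beta> > 0"
  using \<beta> by (simp add: sin_gt_zero)

lemma card_eq: "real (card I) = s\<^sup>2"
proof -
  have "(\<Sum>i\<in>I. orient (p i) (p i + u i) (p i + u i * cis \<beta>)) = real (card I) * sin \<beta>"
    using orient_tile unit by simp
  moreover have "orient 0 (of_real s) (of_real s * cis \<beta>) = s\<^sup>2 * sin \<beta>"
    by (simp add: orient_def cr_def power2_eq_square)
  ultimately show ?thesis using area sin_\<beta> by simp
qed

text \<open>Numbers of tile corners with angle \<open>\<beta>\<close> and with angle \<open>\<alpha>\<close> at \<open>z\<close>, respectively.\<close>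

definition apexes :: "complex \<Rightarrow> nat" where
  "apexes z = (\<Sum>i\<in>I. of_bool (z = p i))"

definition bases :: "complex \<Rightarrow> nat" where
  "bases z = (\<Sum>i\<in>I. of_bool (z = p i + u i) + of_bool (z = p i + u i * cis \<beta>))"

lemma cis_\<beta>: "cis \<beta> \<noteq> 1" "cis \<beta> \<noteq> 0"
  using sin_\<beta> by (auto simp: complex_eq_iff)

text \<open>\<open>m\<close> is the contribution of a tile that has no corner at \<open>z\<close>: a
  straight angle if \<open>z\<close> is on an edge, a full angle if \<open>z\<close> is
  inside.\<close>

lemma tile_angle:
  assumes "i \<in> I"
  shows "\<exists>m::nat. tri (ang z) (p i) (p i + u i) (p i + u i * cis \<beta>) =
    \<alpha> * of_nat (of_bool (z = p i + u i) + of_bool (z = p i + u i * cis \<beta>)) +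
    \<beta> * of_nat (of_bool (z = p i)) + pi * of_nat m"
proof -
  let ?a = "p i" and ?b = "p i + u i" and ?c = "p i + u i * cis \<beta>"
  have d: "?a \<noteq> ?b" "?b \<noteq> ?c" "?a \<noteq> ?c" using u_nz[OF assms] cis_\<beta> by auto
  note v = tri_ang_isosceles[OF \<beta> u_nz[OF assms], of z "p i"]
  consider "z = ?a" | "z = ?b" | "z = ?c" | "z \<noteq> ?a" "z \<noteq> ?b" "z \<noteq> ?c" by blast
  then show ?thesis
  proof cases
    case 1
    then show ?thesis using v(1) d by (intro exI[of _ 0]) simp
  next
    case 2
    then have "tri (ang z) ?a ?b ?c = \<alpha>" using v(2) \<alpha>_def by simp
    moreover have "z \<noteq> ?a" "z \<noteq> ?c" using 2 d by auto
    ultimately show ?thesis using 2 by (intro exI[of _ 0]) simp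
  next
    case 3
    then have "tri (ang z) ?a ?b ?c = \<alpha>" using v(2) \<alpha>_def by simp
    moreover have "z \<noteq> ?a" "z \<noteq> ?b" using 3 d by auto
    ultimately show ?thesis using 3 by (intro exI[of _ 0]) simp
  next
    case 4
    then have "tri (ang z) ?a ?b ?c \<in> {pi * of_nat 0, pi * of_nat 1, pi * of_nat 2}"
      using tri_ang_nonvertex[OF pos[OF assms] 4] by auto
    then obtain m :: nat where "tri (ang z) ?a ?b ?c = pi * of_nat m" by blast
    then show ?thesis using 4 by (intro exI[of _ m]) simp
  qed
qed

lemma angle_count:
  obtains m :: nat where
    "\<alpha> * bases z + \<beta> * apexes z + pi * m = tri (ang z) 0 (of_real s) (of_real s * cis \<beta>)"
proof -
  obtain m where m: "\<And>i. i \<in> I \<Longrightarrow> tri (ang z) (p i) (p i + u i) (p i + u i * cis \<beta>) =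
    \<alpha> * of_nat (of_bool (z = p i + u i) + of_bool (z = p i + u i * cis \<beta>)) +
    \<beta> * of_nat (of_bool (z = p i)) + pi * of_nat (m i)"
    using tile_angle[of _ z] by metis
  have "tri (ang z) 0 (of_real s) (of_real s * cis \<beta>) = (\<Sum>i\<in>I.
    \<alpha> * of_nat (of_bool (z = p i + u i) + of_bool (z = p i + u i * cis \<beta>)) +
    \<beta> * of_nat (of_bool (z = p i)) + pi * of_nat (m i))"
    unfolding ang_sum[symmetric] by (intro sum.cong m) auto
  also have "\<dots> = \<alpha> * bases z + \<beta> * apexes z + pi * (\<Sum>i\<in>I. m i)"
    unfolding sum.distrib sum_distrib_left[symmetric] of_nat_sum[symmetric] bases_def apexes_def ..
  finally show ?thesis using that by metis
qed

lemma T_angle: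
  "tri (ang 0) 0 (of_real s) (of_real s * cis \<beta>) = \<beta>"
  "tri (ang (of_real s)) 0 (of_real s) (of_real s * cis \<beta>) = \<alpha>"
  "tri (ang (of_real s * cis \<beta>)) 0 (of_real s) (of_real s * cis \<beta>) = \<alpha>"
proof -
  have "complex_of_real s \<noteq> 0" using s by simp
  note v = tri_ang_isosceles[OF \<beta> this, of _ 0, unfolded add_0]
  show "tri (ang 0) 0 (of_real s) (of_real s * cis \<beta>) = \<beta>"
    "tri (ang (of_real s)) 0 (of_real s) (of_real s * cis \<beta>) = \<alpha>"
    "tri (ang (of_real s * cis \<beta>)) 0 (of_real s) (of_real s * cis \<beta>) = \<alpha>"
    using v[of 0] v[of "of_real s"] v[of "of_real s * cis \<beta>"] by (simp_all add: \<alpha>_def)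
qed

lemma count_at_corner:
  assumes "z \<in> {0, of_real s, of_real s * cis \<beta>}"
  shows "\<alpha> * bases z + \<beta> * apexes z = (if z = 0 then \<beta> else \<alpha>)"
proof -
  have nz: "complex_of_real s \<noteq> 0" "of_real s * cis \<beta> \<noteq> 0" using s by auto
  have T: "tri (ang z) 0 (of_real s) (of_real s * cis \<beta>) = (if z = 0 then \<beta> else \<alpha>)"
    using assms nz T_angle by auto
  obtain m :: nat where m: "\<alpha> * bases z + \<beta> * apexes z + pi * m = (if z = 0 then \<beta> else \<alpha>)"
    using angle_count[of z] unfolding T by blast
  \<comment> \<open>The angle is less than pi, so no tile has this corner inside an edge or in its
    interior.\<close>
  have "(if z = 0 then \<beta> else \<alpha>) < pi" using \<beta> \<alpha>_sum \<alpha>_pos by simp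
  moreover have "\<alpha> * bases z + \<beta> * apexes z \<ge> 0" using \<beta> \<alpha>_pos by simp
  ultimately have "pi * m < pi * 1" using m by linarith
  then have "m = 0" by simp
  then show ?thesis using m by simp
qed

lemma count_elsewhere:
  assumes "z \<notin> {0, of_real s, of_real s * cis \<beta>}"
  obtains j :: nat where "j \<le> 2" "\<alpha> * bases z + \<beta> * apexes z = j * pi"
proof -
  have "tri (ang z) 0 (of_real s) (of_real s * cis \<beta>) \<in> {pi * of_nat 0, pi * of_nat 1, pi * of_nat 2}"
    using tri_ang_nonvertex[OF POS, of z] assms by auto
  then obtain j :: nat where j: "j \<le> 2" "tri (ang z) 0 (of_real s) (of_real s * cis \<beta>) = pi * j"
    by (elim insertE emptyE) (erule that[rotated], simp)+
  obtain m :: nat where m: "\<alpha> * bases z + \<beta> * apexes z + pi * m = pi * j"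
    using angle_count[of z] unfolding j by blast
  have "\<alpha> * bases z + \<beta> * apexes z \<ge> 0" using \<beta> \<alpha>_pos by simp
  then have "pi * m \<le> pi * j" using m by linarith
  then have "m \<le> j" by simp
  then have "\<alpha> * bases z + \<beta> * apexes z = (j - m) * pi" "j - m \<le> 2"
    using m j by (simp_all add: of_nat_diff algebra_simps)
  then show ?thesis using that by blast
qed

section \<open>Balance of base corners against apexes\<close>

lemma finite_verts: "finite verts"
  unfolding verts_def using fin by simp

lemma sum_apexes: "(\<Sum>z\<in>verts. apexes z) = card I"
proof -
  have "(\<Sum>z\<in>verts. apexes z) = (\<Sum>i\<in>I. \<Sum>z\<in>verts. of_bool (z = p i))"
    unfolding apexes_def by (rule sum.swap)
  also have "\<dots> = (\<Sum>i\<in>I. 1)"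
  proof (rule sum.cong[OF refl])
    fix i assume "i \<in> I"
    then have "p i \<in> verts" by (simp add: verts_def)
    then show "(\<Sum>z\<in>verts. of_bool (z = p i)) = (1::nat)"
      using finite_verts by (simp add: of_bool_def)
  qed
  finally show ?thesis by simp
qed

lemma sum_bases: "(\<Sum>z\<in>verts. bases z) = 2 * card I"
proof -
  have "(\<Sum>z\<in>verts. bases z) = (\<Sum>i\<in>I. \<Sum>z\<in>verts. of_bool (z = p i + u i) + of_bool (z = p i + u i * cis \<beta>))"
    unfolding bases_def by (rule sum.swap)
  also have "\<dots> = (\<Sum>i\<in>I. 2)"
  proof (rule sum.cong[OF refl])
    fix i assume "i \<in> I"
    then have "p i + u i \<in> verts" "p i + u i * cis \<beta> \<in> verts" by (simp_all add: verts_def)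
    then show "(\<Sum>z\<in>verts. of_bool (z = p i + u i) + of_bool (z = p i + u i * cis \<beta>)) = (2::nat)"
      using finite_verts by (simp add: of_bool_def sum.distrib)
  qed
  finally show ?thesis by simp
qed

lemma count_balance: "(\<Sum>z\<in>verts. int (bases z) - 2 * int (apexes z)) = 0"
  unfolding sum_subtractf sum_distrib_left[symmetric] of_nat_sum[symmetric] sum_apexes sum_bases by simp

text \<open>For k \<ge> 5 the difference \<open>bases z - 2 * apexes z\<close> is never negative: j
  straight angles amount to j (k + 2) times \<alpha>, and j + 1 apexes would need k (j + 1) \<le> j
  (k + 2), that is k \<le> 2 j \<le> 4. At the split apex the difference is k > 0, against
  \<open>count_balance\<close>.\<close>

lemma apex_split_small:
  assumes k: "\<beta> = of_nat k * \<alpha>" and k3: "k \<ge> 3"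
    and v: "bases 0 = k" "apexes 0 = 0"
  shows "k = 3 \<or> k = 4"
proof (rule ccontr)
  assume "\<not> ?thesis"
  then have k5: "k \<ge> 5" using k3 by auto
  note comb = real_comb_apex[OF k \<alpha>_sum]
  have nn: "int (bases z) - 2 * int (apexes z) \<ge> 0" for z
  proof (cases "z \<in> {0, of_real s, of_real s * cis \<beta>}")
    case True
    show ?thesis
    proof (cases "z = 0")
      case False
      then have "\<alpha> * bases z + \<beta> * apexes z = \<alpha>" using count_at_corner[OF True] by simp
      then have "\<alpha> * (real (bases z + k * apexes z)) = \<alpha> * 1" unfolding comb by simp
      then have "real (bases z + k * apexes z) = 1" using \<alpha>_pos by simp
      then have "bases z + k * apexes z = 1" using of_nat_eq_1_iff by blast
      moreover have "apexes z = 0 \<or> k * apexes z \<ge> k" by (cases "apexes z") simp_all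
      ultimately have "apexes z = 0" using k5 by linarith
      then show ?thesis by simp
    qed (use v in simp)
  next
    case False
    then obtain j :: nat where j: "j \<le> 2" "\<alpha> * bases z + \<beta> * apexes z = j * pi"
      by (rule count_elsewhere)
    then have "\<alpha> * (real (bases z + k * apexes z)) = \<alpha> * real (j * (k + 2))" by (simp only: comb)
    then have "real (bases z + k * apexes z) = real (j * (k + 2))" using \<alpha>_pos by simp
    then have e: "bases z + k * apexes z = j * (k + 2)" using of_nat_eq_iff by blast
    have "apexes z \<le> j"
    proof (rule ccontr)
      assume "\<not> ?thesis"
      then have "k * (j + 1) \<le> k * apexes z" by (intro mult_le_mono2) simp
      then have "k * (j + 1) \<le> j * (k + 2)" using e by linarith
      then have "k \<le> 2 * j" by (simp add: algebra_simps)
      then show False using j k5 by linarith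
    qed
    then have "apexes z * (k + 2) \<le> j * (k + 2)" by (rule mult_le_mono1)
    then have "apexes z * (k + 2) \<le> bases z + k * apexes z" using e by simp
    then have "2 * apexes z \<le> bases z" by (simp add: algebra_simps)
    then show ?thesis by simp
  qed
  have "0 \<in> verts" by (simp add: verts_def)
  then have "int (bases 0) - 2 * int (apexes 0) = 0"
    using sum_nonneg_eq_0_iff[OF finite_verts, of "\<lambda>z. int (bases z) - 2 * int (apexes z)"] nn count_balance by blast
  then show False using v k5 by simp
qed

text \<open>For k \<ge> 3 the same difference is at most 0 except at the other base corner, where it
  is at most 1; at the split corner it is -2k \<le> -6. So the total is at most -5. Away from the
  corners, 2 j + 1 base corners would need k (2 j + 1) \<le> j (2 k + 1), that is k \<le> j \<le>
  2.\<close>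

lemma base_split_small:
  assumes k: "\<alpha> = of_nat k * \<beta>" and k2: "k \<ge> 2"
    and v: "v \<in> {of_real s, of_real s * cis \<beta>}" "bases v = 0" "apexes v = k"
  shows "k = 2"
proof (rule ccontr)
  assume "\<not> ?thesis"
  then have k3: "k \<ge> 3" using k2 by auto
  have pa: "pi = of_nat (2 * k + 1) * \<beta>" using k \<alpha>_sum by (simp add: algebra_simps)
  obtain v' where v': "{of_real s, of_real s * cis \<beta>} = {v, v'}" "v \<noteq> v'"
    using v(1) cis_\<beta> s by (metis doubleton_eq_iff insertE singletonD mult_cancel_left1 of_real_eq_0_iff less_irrefl)
  have "0 \<notin> {of_real s, of_real s * cis \<beta>}" using s cis_\<beta>(2) by simp
  then have nz: "v \<noteq> 0" "v' \<noteq> 0" unfolding v' by auto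
  define g where "g z = (if z = v' then 1 else 0) + (if z = v then - 6 else (0::int))" for z
  have le: "int (bases z) - 2 * int (apexes z) \<le> g z" for z
  proof (cases "z \<in> {0, of_real s, of_real s * cis \<beta>}")
    case True
    consider "z = v" | "z = v'" | "z = 0" "z \<noteq> v" "z \<noteq> v'" using True v' nz by blast
    then show ?thesis
    proof cases
      case 1
      then show ?thesis using v k3 v' by (simp add: g_def)
    next
      case 2
      then have "\<alpha> * bases z + \<beta> * apexes z = \<alpha>" using count_at_corner[OF True] nz by simp
      then have "\<alpha> * bases z \<le> \<alpha> * 1" using \<beta> by (smt (verit) mult_nonneg_nonneg of_nat_0_le_iff)
      then have "bases z \<le> 1" using \<alpha>_pos by simp
      then show ?thesis using 2 v' by (simp add: g_def)
    next
      case 3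
      then have "\<alpha> * bases z + \<beta> * apexes z = \<beta>" using count_at_corner[OF True] by simp
      then have "\<beta> * (real (k * bases z + apexes z)) = \<beta> * 1" unfolding k by (simp add: algebra_simps)
      then have "real (k * bases z + apexes z) = 1" using \<beta> by simp
      then have "k * bases z + apexes z = 1" using of_nat_eq_1_iff by blast
      moreover have "bases z = 0 \<or> k * bases z \<ge> k" by (cases "bases z") simp_all
      ultimately have "bases z = 0" using k3 by linarith
      then show ?thesis using 3 by (simp add: g_def)
    qed
  next
    case False
    then obtain j :: nat where j: "j \<le> 2" "\<alpha> * bases z + \<beta> * apexes z = j * pi"
      by (rule count_elsewhere)
    then have "\<beta> * (real (k * bases z + apexes z)) = \<beta> * real (j * (2 * k + 1))" unfolding k pa by (simp add: algebra_simps)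
    then have "real (k * bases z + apexes z) = real (j * (2 * k + 1))" using \<beta> by simp
    then have e: "k * bases z + apexes z = j * (2 * k + 1)" using of_nat_eq_iff by blast
    have "bases z \<le> 2 * j"
    proof (rule ccontr)
      assume "\<not> ?thesis"
      then have "k * (2 * j + 1) \<le> k * bases z" by (intro mult_le_mono2) simp
      then have "k * (2 * j + 1) \<le> j * (2 * k + 1)" using e by linarith
      then have "k \<le> j" by (simp add: algebra_simps)
      then show False using j k3 by linarith
    qed
    moreover have "j \<le> apexes z"
    proof -
      have "k * bases z \<le> k * (2 * j)" using \<open>bases z \<le> 2 * j\<close> by (rule mult_le_mono2)
      then have "j * (2 * k + 1) \<le> k * (2 * j) + apexes z" using e by linarith
      then show ?thesis by (simp add: algebra_simps)
    qed
    moreover have "g z = 0" using False v' v(1) unfolding g_def by auto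
    ultimately show ?thesis by simp
  qed
  have "v \<in> verts" "v' \<in> verts" using v' by (auto simp: verts_def)
  then have "(\<Sum>z\<in>verts. g z) = - 5"
    unfolding g_def sum.distrib using finite_verts by simp
  then show False using sum_mono[of verts "\<lambda>z. int (bases z) - 2 * int (apexes z)" g] le count_balance by simp
qed

text \<open>A tile corner of the same kind would fill the corner alone, so a split corner consists
  of corners of the other kind only, and its angle is an integer multiple of the other
  angle.\<close>

lemma split_cases:
  assumes v: "v \<in> {0, of_real s, of_real s * cis \<beta>}" and k: "bases v + apexes v \<ge> 2"
    and oblique: "\<beta> \<noteq> pi / 2"
  shows "v = 0 \<and> bases v > 0 \<and> (\<beta> = 3 * \<alpha> \<or> \<beta> = 4 * \<alpha>) \<or> v \<noteq> 0 \<and> apexes v > 0 \<and> \<alpha> = 2 * \<beta>"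
proof (cases "v = 0")
  case True
  have c: "\<alpha> * bases 0 + \<beta> * apexes 0 = \<beta>" using count_at_corner[of 0] by simp
  have y: "apexes 0 = 0"
  proof (rule ccontr)
    assume "apexes 0 \<noteq> 0"
    then obtain m where m: "apexes 0 = Suc m" by (metis not0_implies_Suc)
    then have "\<alpha> * bases 0 + \<beta> * m = 0" using c by (simp add: algebra_simps)
    moreover have "\<alpha> * bases 0 \<ge> 0" "\<beta> * m \<ge> 0" using \<alpha>_pos \<beta> by simp_all
    ultimately have "\<alpha> * bases 0 = 0" "\<beta> * m = 0" by linarith+
    then show False using k \<alpha>_pos \<beta> True m by simp
  qed
  then have b: "\<beta> = of_nat (bases 0) * \<alpha>" using c by (simp add: algebra_simps)
  \<comment> \<open>Two base corners would give \<beta> = 2 \<alpha> and, with \<beta> + 2 \<alpha>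
    = pi, a right angle.\<close>
  moreover have "bases 0 \<noteq> 2" using b oblique \<alpha>_sum by auto
  ultimately have "bases 0 = 3 \<or> bases 0 = 4" using apex_split_small[OF b] y k True by simp
  then show ?thesis using b True by auto
next
  case False
  have c: "\<alpha> * bases v + \<beta> * apexes v = \<alpha>" using count_at_corner[OF v] False by simp
  have y: "bases v = 0"
  proof (rule ccontr)
    assume "bases v \<noteq> 0"
    then obtain m where m: "bases v = Suc m" by (metis not0_implies_Suc)
    then have "\<alpha> * m + \<beta> * apexes v = 0" using c by (simp add: algebra_simps)
    moreover have "\<alpha> * m \<ge> 0" "\<beta> * apexes v \<ge> 0" using \<alpha>_pos \<beta> by simp_all
    ultimately have "\<alpha> * m = 0" "\<beta> * apexes v = 0" by linarith+
    then show False using k \<alpha>_pos \<beta> m by simp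
  qed
  then have b: "\<alpha> = of_nat (apexes v) * \<beta>" using c by (simp add: algebra_simps)
  then have "apexes v = 2" using base_split_small[OF b] y k False v by simp
  then show ?thesis using b False by auto
qed

end

section \<open>Conjugating the vertices of a tiling\<close>

definition emb :: "real \<Rightarrow> complex \<Rightarrow> int \<Rightarrow> int \<Rightarrow> int \<Rightarrow> int \<Rightarrow> complex" where
  "emb b z x y x' y' = of_real (of_int x + of_int y * b) + of_real (of_int x' + of_int y' * b) * z"

text \<open>\<open>b\<close> and \<open>b'\<close> are roots of the same polynomial X^2 - e X - f,
  and \<zeta> + 1 / \<zeta> = b, likewise for the primed pair. Hence \<open>b\<close> to
  \<open>b'\<close>, \<zeta> to \<open>\<zeta>'\<close> extends to a ring homomorphism on
  Z[b, \<zeta>].\<close>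

locale quad_conj =
  fixes b b' :: real and \<zeta> \<zeta>' :: complex and e f :: int
  assumes irr: "b \<notin> \<rat>"
    and b2: "b * b = of_int e * b + of_int f" "b' * b' = of_int e * b' + of_int f"
    and \<zeta>2: "\<zeta> * \<zeta> = of_real b * \<zeta> - 1" "\<zeta>' * \<zeta>' = of_real b' * \<zeta>' - 1"
    and Im_\<zeta>: "Im \<zeta> \<noteq> 0"
begin

lemma int_comb_eq_0:
  assumes "of_int x + of_int y * b = 0"
  shows "x = 0 \<and> y = 0"
proof -
  have "y = 0"
  proof (rule ccontr)
    assume "y \<noteq> 0"
    then have "b = - of_int x / of_int y" using assms by (simp add: field_simps eq_neg_iff_add_eq_0)
    then have "b \<in> \<rat>" by simp
    then show False using irr by simp
  qed
  then show ?thesis using assms by simp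
qed

text \<open>\<zeta> is not real, which separates the two coordinates in Z[b]; \<open>b\<close> is
  irrational, which separates the integers in each. This makes \<open>galois\<close> well
  defined.\<close>

lemma emb_inj:
  assumes "emb b \<zeta> x y x' y' = emb b \<zeta> v w v' w'"
  shows "x = v \<and> y = w \<and> x' = v' \<and> y' = w'"
proof -
  have "(of_int x' + of_int y' * b) * Im \<zeta> = (of_int v' + of_int w' * b) * Im \<zeta>"
    using arg_cong[OF assms, of Im] by (simp add: emb_def)
  then have 1: "of_int x' + of_int y' * b = of_int v' + of_int w' * b" using Im_\<zeta> by simp
  then have 2: "of_int x + of_int y * b = of_int v + of_int w * b"
    using arg_cong[OF assms, of Re] by (simp add: emb_def)
  show ?thesis
    using int_comb_eq_0[of "x' - v'" "y' - w'"] int_comb_eq_0[of "x - v" "y - w"] 1 2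
    by (simp add: algebra_simps)
qed

definition lattice :: "complex set" where
  "lattice = {z. \<exists>x y x' y'. z = emb b \<zeta> x y x' y'}"

text \<open>
  The conjugation \<open>b \<mapsto> b'\<close>, \<open>\<zeta> \<mapsto> \<zeta>'\<close>; only meaningful on \<open>lattice\<close>.
\<close>

definition galois :: "complex \<Rightarrow> complex" where
  "galois z = (THE w. \<exists>x y x' y'. z = emb b \<zeta> x y x' y' \<and> w = emb b' \<zeta>' x y x' y')"

lemma galois_emb: "galois (emb b \<zeta> x y x' y') = emb b' \<zeta>' x y x' y'"
  unfolding galois_def by (rule the_equality) (auto dest: emb_inj)

lemma lattice_emb: "emb b \<zeta> x y x' y' \<in> lattice"
  unfolding lattice_def by blast

lemma latticeE:
  assumes "z \<in> lattice"
  obtains x y x' y' where "z = emb b \<zeta> x y x' y'" "galois z = emb b' \<zeta>' x y x' y'"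
  using assms galois_emb unfolding lattice_def by blast

lemma emb_add: "emb c w x y x' y' + emb c w v z v' z' = emb c w (x + v) (y + z) (x' + v') (y' + z')"
  by (simp add: emb_def algebra_simps)

lemma emb_uminus: "- emb c w x y x' y' = emb c w (- x) (- y) (- x') (- y')"
  by (simp add: emb_def algebra_simps)

text \<open>Stated for any pair of roots \<open>c\<close>, \<open>w\<close>: the same integer
  coordinates then serve both embeddings, so \<open>galois\<close> commutes with these
  multiplications.\<close>

lemma emb_mult_gen:
  assumes c: "c * c = of_int e * c + of_int f" and w: "w * w = of_real c * w - 1"
  shows "w * emb c w x y x' y' = emb c w (- x') (- y') (x + f * y') (y + x' + e * y')"
    "of_real c * emb c w x y x' y' = emb c w (f * y) (x + e * y) (f * y') (x' + e * y')"
proof -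
  have c': "complex_of_real c * complex_of_real c = of_int e * of_real c + of_int f"
    using arg_cong[OF c, of complex_of_real] by simp
  have "w * emb c w x y x' y' = (of_int x + of_int y * of_real c) * w + (of_int x' + of_int y' * of_real c) * (w * w)"
    by (simp add: emb_def algebra_simps)
  also have "\<dots> = (of_int x + of_int y * of_real c) * w + of_int x' * of_real c * w
      + of_int y' * (of_real c * of_real c) * w - of_int x' - of_int y' * of_real c"
    unfolding w by (simp add: algebra_simps)
  also have "\<dots> = emb c w (- x') (- y') (x + f * y') (y + x' + e * y')"
    unfolding c' by (simp add: emb_def algebra_simps)
  finally show "w * emb c w x y x' y' = emb c w (- x') (- y') (x + f * y') (y + x' + e * y')" .
  have "of_real c * emb c w x y x' y' = of_int x * of_real c + of_int y * (of_real c * of_real c)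
     + (of_int x' * of_real c + of_int y' * (of_real c * of_real c)) * w"
    by (simp add: emb_def algebra_simps)
  also have "\<dots> = emb c w (f * y) (x + e * y) (f * y') (x' + e * y')"
    unfolding c' by (simp add: emb_def algebra_simps)
  finally show "of_real c * emb c w x y x' y' = emb c w (f * y) (x + e * y) (f * y') (x' + e * y')" .
qed

lemma lattice_add:
  assumes "z \<in> lattice" "w \<in> lattice"
  shows "z + w \<in> lattice" "galois (z + w) = galois z + galois w"
proof -
  obtain x y x' y' where z: "z = emb b \<zeta> x y x' y'" using assms(1) by (rule latticeE)
  obtain v t v' t' where w: "w = emb b \<zeta> v t v' t'" using assms(2) by (rule latticeE)
  show "z + w \<in> lattice" unfolding z w emb_add by (rule lattice_emb)
  show "galois (z + w) = galois z + galois w" unfolding z w emb_add galois_emb ..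
qed

lemma lattice_uminus:
  assumes "z \<in> lattice"
  shows "- z \<in> lattice" "galois (- z) = - galois z"
proof -
  obtain x y x' y' where z: "z = emb b \<zeta> x y x' y'" using assms(1) by (rule latticeE)
  show "- z \<in> lattice" unfolding z emb_uminus by (rule lattice_emb)
  show "galois (- z) = - galois z" unfolding z emb_uminus galois_emb ..
qed

lemma lattice_diff:
  assumes "z \<in> lattice" "w \<in> lattice"
  shows "z - w \<in> lattice" "galois (z - w) = galois z - galois w"
  using lattice_add[OF assms(1) lattice_uminus(1)[OF assms(2)]] lattice_uminus(2)[OF assms(2)] by simp_all

lemma lattice_mult:
  assumes "z \<in> lattice"
  shows "\<zeta> * z \<in> lattice" "galois (\<zeta> * z) = \<zeta>' * galois z"
    "of_real b * z \<in> lattice" "galois (of_real b * z) = of_real b' * galois z"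
proof -
  obtain x y x' y' where z: "z = emb b \<zeta> x y x' y'" using assms(1) by (rule latticeE)
  show "\<zeta> * z \<in> lattice" "of_real b * z \<in> lattice"
    unfolding z emb_mult_gen[OF b2(1) \<zeta>2(1)] by (rule lattice_emb)+
  show "galois (\<zeta> * z) = \<zeta>' * galois z" "galois (of_real b * z) = of_real b' * galois z"
    unfolding z emb_mult_gen[OF b2(1) \<zeta>2(1)] galois_emb emb_mult_gen[OF b2(2) \<zeta>2(2)] by simp_all
qed

lemma lattice_real:
  "of_real (of_int x + of_int y * b) \<in> lattice"
  "galois (of_real (of_int x + of_int y * b)) = of_real (of_int x + of_int y * b')"
  using lattice_emb[of x y 0 0] galois_emb[of x y 0 0] by (simp_all add: emb_def)

lemma lattice_0: "0 \<in> lattice" "galois 0 = 0"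
  using lattice_real[of 0 0] by simp_all

lemma lattice_1: "1 \<in> lattice" "galois 1 = 1"
  using lattice_real[of 1 0] by simp_all

lemma lattice_mult_pow:
  assumes "z \<in> lattice"
  shows "z * \<zeta> ^ k \<in> lattice \<and> galois (z * \<zeta> ^ k) = galois z * \<zeta>' ^ k"
proof (induction k)
  case (Suc k)
  then show ?case using lattice_mult(1,2)[of "z * \<zeta> ^ k"] by (simp add: algebra_simps)
qed (use assms in simp)

lemma lattice_pow: "\<zeta> ^ k \<in> lattice" "galois (\<zeta> ^ k) = \<zeta>' ^ k"
  using lattice_mult_pow[OF lattice_1(1), of k] lattice_1(2) by simp_all

lemma cr_emb:
  assumes c: "c * c = of_int e * c + of_int f"
  shows "cr (emb c w x y x' y') (emb c w v t v' t') =
    (of_int (x * v' + f * y * t' - x' * v - f * y' * t)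
     + of_int (x * t' + y * v' + e * y * t' - x' * t - y' * v - e * y' * t) * c) * Im w"
proof -
  have "cr (emb c w x y x' y') (emb c w v t v' t') =
     (of_int x * of_int v' - of_int x' * of_int v + (of_int x * of_int t' + of_int y * of_int v' - of_int x' * of_int t - of_int y' * of_int v) * c
       + (of_int y * of_int t' - of_int y' * of_int t) * (c * c)) * Im w"
    by (simp add: emb_def cr_def algebra_simps)
  then show ?thesis unfolding c by (simp add: algebra_simps)
qed

text \<open>The cross product of lattice vectors is \<open>Im \<zeta>\<close> times an element of
  Z[b]. If it vanishes, so do its integer coefficients, and the conjugate cross product has the same
  coefficients. This is what keeps edge functionals additive after the discontinuous map
  \<open>galois\<close>.\<close>

lemma galois_collinear:
  assumes l: "p \<in> lattice" "q \<in> lattice" "r \<in> lattice" and o: "orient p q r = 0"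
  shows "orient (galois p) (galois q) (galois r) = 0"
proof -
  obtain x y x' y' where 1: "q - p = emb b \<zeta> x y x' y'" "galois (q - p) = emb b' \<zeta>' x y x' y'"
    using lattice_diff(1)[OF l(2,1)] by (rule latticeE)
  obtain v t v' t' where 2: "r - p = emb b \<zeta> v t v' t'" "galois (r - p) = emb b' \<zeta>' v t v' t'"
    using lattice_diff(1)[OF l(3,1)] by (rule latticeE)
  have "of_int (x * v' + f * y * t' - x' * v - f * y' * t)
     + of_int (x * t' + y * v' + e * y * t' - x' * t - y' * v - e * y' * t) * b = 0"
    using o Im_\<zeta> unfolding orient_def 1(1) 2(1) cr_emb[OF b2(1)] by simp
  from int_comb_eq_0[OF this]
  have "cr (galois (q - p)) (galois (r - p)) = 0"
    unfolding 1(1) 2(1) galois_emb cr_emb[OF b2(2)] by simp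
  then show ?thesis unfolding orient_def using lattice_diff(2) l by simp
qed

section \<open>The real ring Z[b]\<close>

definition quadratic :: "real set" where
  "quadratic = {r. \<exists>x y :: int. r = of_int x + of_int y * b}"

lemma quadratic_add: "r \<in> quadratic \<Longrightarrow> t \<in> quadratic \<Longrightarrow> r + t \<in> quadratic"
proof -
  assume "r \<in> quadratic" "t \<in> quadratic"
  then obtain x y x' y' :: int where "r = of_int x + of_int y * b" "t = of_int x' + of_int y' * b"
    unfolding quadratic_def by blast
  then have "r + t = of_int (x + x') + of_int (y + y') * b" by (simp add: algebra_simps)
  then show ?thesis unfolding quadratic_def by blast
qed

lemma quadratic_uminus: "r \<in> quadratic \<Longrightarrow> - r \<in> quadratic"
proof -
  assume "r \<in> quadratic"
  then obtain x y :: int where "r = of_int x + of_int y * b"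
    unfolding quadratic_def by blast
  then have "- r = of_int (- x) + of_int (- y) * b" by (simp add: algebra_simps)
  then show ?thesis unfolding quadratic_def by blast
qed

lemma quadratic_0_1: "0 \<in> quadratic" "1 \<in> quadratic"
proof -
  have "0 = of_int 0 + of_int 0 * b" "1 = of_int 1 + of_int 0 * b" by simp_all
  then show "0 \<in> quadratic" "1 \<in> quadratic" unfolding quadratic_def by blast+
qed

lemma quadratic_sum: "(\<And>i. i \<in> J \<Longrightarrow> g i \<in> quadratic) \<Longrightarrow> sum g J \<in> quadratic"
  by (induction J rule: infinite_finite_induct) (auto intro: quadratic_add quadratic_0_1)

text \<open>The equation is compared coefficientwise in the basis 1, \<open>b\<close>, and the same
  coefficients describe the conjugate. It is meant for \<open>s\<close>, whose square is the number
  of tiles.\<close>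

lemma galois_square:
  assumes "r = of_int x + of_int y * b" "r * r = of_int N"
  shows "(of_int x + of_int y * b') * (of_int x + of_int y * b') = of_int N"
    "x * x + f * y * y = N" "y * (2 * x + e * y) = 0"
proof -
  have g: "(of_int x + of_int y * c) * (of_int x + of_int y * c) =
     of_int (x * x + f * y * y) + of_int (y * (2 * x + e * y)) * c"
    if "c * c = of_int e * c + of_int f" for c :: real
  proof -
    have "(of_int x + of_int y * c) * (of_int x + of_int y * c) =
      of_int x * of_int x + 2 * of_int x * of_int y * c + of_int y * of_int y * (c * c)"
      by (simp add: algebra_simps)
    then show ?thesis unfolding that by (simp add: algebra_simps)
  qed
  have "of_int (x * x + f * y * y - N) + of_int (y * (2 * x + e * y)) * b = 0"
    using g[OF b2(1)] assms by simp
  from int_comb_eq_0[OF this] show eq: "x * x + f * y * y = N" "y * (2 * x + e * y) = 0" by simp_all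
  show "(of_int x + of_int y * b') * (of_int x + of_int y * b') = of_int N"
    unfolding g[OF b2(2)] eq by simp
qed

end

text \<open>\<zeta> is a root of unity. The conditions on \<open>cis \<beta>\<close> and
  \<open>cis \<beta> - 1\<close> say that, relative to the first leg, every edge of a tile is a
  power of \<zeta> times an element of Z[b].\<close>

locale zeta_tiling = iso_tiling I p u s \<beta> + quad_conj b b' \<zeta> \<zeta>' e f
  for I :: "'i set" and p u :: "'i \<Rightarrow> complex" and s \<beta> b b' :: real and \<zeta> \<zeta>' :: complex and e f :: int +
  fixes n m g :: nat and c :: real
  assumes \<zeta>_norm: "norm \<zeta> = 1" and \<zeta>_n: "\<zeta> ^ n = - 1" and n: "n > 0"
    and \<eta>: "cis \<beta> = \<zeta> ^ m" and \<eta>1: "cis \<beta> - 1 = of_real c * \<zeta> ^ g" and c: "c \<noteq> 0" "c \<in> quadratic"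
begin

text \<open>The side of the big triangle on the real axis is a signed sum of edges of tiles.\<close>

lemma s_quadratic: "s \<in> quadratic"
proof -
  \<comment> \<open>Signed length along the real axis, 0 on all other edges. It is additive because
    a collinear triple with two distinct points on the axis lies on it.\<close>
  define F where "F x y = (if Im x = 0 \<and> Im y = 0 then Re y - Re x else 0)" for x y
  have eq: "x = y" if "Im x = 0" "Im y = 0" "orient x y z = 0" "Im z \<noteq> 0" for x y z
    using that by (simp add: orient_def cr_def complex_eq_iff)
  have "F x y + F y z = F x z" if "orient x y z = 0" for x y z
    using eq[of x y z] eq[of y z x] eq[of z x y] orient0[OF that] that unfolding F_def by auto
  then have "(\<Sum>i\<in>I. tri F (p i) (p i + u i) (p i + u i * cis \<beta>)) = tri F 0 (of_real s) (of_real s * cis \<beta>)"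
    by (intro additive[OF subset_UNIV])
  also have "\<dots> = s" using s sin_\<beta> by (simp add: tri_def F_def)
  finally have sum: "s = (\<Sum>i\<in>I. tri F (p i) (p i + u i) (p i + u i * cis \<beta>))" ..
  have edge: "F x y \<in> quadratic" if "norm (y - x) = \<bar>r\<bar>" "r \<in> quadratic" for x y r
  proof (cases "Im x = 0 \<and> Im y = 0")
    case True
    then have "\<bar>Re y - Re x\<bar> = \<bar>r\<bar>" using that(1) by (simp add: cmod_def)
    then have "F x y = r \<or> F x y = - r" using True by (simp add: F_def abs_eq_iff)
    then show ?thesis using that(2) quadratic_uminus by auto
  next
    case False
    then show ?thesis using quadratic_0_1 by (auto simp: F_def)
  qed
  show ?thesis unfolding sum
  proof (rule quadratic_sum)
    fix i assume i: "i \<in> I"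
    have "norm (cis \<beta> - 1) = \<bar>c\<bar>" unfolding \<eta>1 by (simp add: norm_mult norm_power \<zeta>_norm)
    moreover have "u i * cis \<beta> - u i = u i * (cis \<beta> - 1)" by (simp add: algebra_simps)
    ultimately have "norm (u i * cis \<beta> - u i) = \<bar>c\<bar>" using unit[OF i] by (simp add: norm_mult)
    then have "F (p i + u i) (p i + u i * cis \<beta>) \<in> quadratic"
      using c(2) by (intro edge[of _ _ c]) simp_all
    moreover have "F (p i) (p i + u i) \<in> quadratic" "F (p i + u i * cis \<beta>) (p i) \<in> quadratic"
      using unit[OF i] quadratic_0_1(2) by (auto intro!: edge[of _ _ 1] simp: norm_mult)
    ultimately show "tri F (p i) (p i + u i) (p i + u i * cis \<beta>) \<in> quadratic"
      unfolding tri_def by (intro quadratic_add)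
  qed
qed

definition dirgood :: "complex \<Rightarrow> bool" where
  "dirgood d \<longleftrightarrow> (\<exists>k::nat. Im (d * cnj (\<zeta> ^ k)) = 0)"

lemma \<zeta>_cnj: "\<zeta> * cnj \<zeta> = 1"
  using \<zeta>_norm complex_norm_square[of \<zeta>] by simp

lemma \<zeta>_nz: "\<zeta> \<noteq> 0"
  using \<zeta>_norm by auto

text \<open>On the unit circle conjugation inverts, and \<open>\<zeta> ^ (2 * n) = 1\<close>; so
  natural exponents suffice for dividing by powers of \<zeta>.\<close>

lemma cnj_\<zeta>: "cnj \<zeta> = \<zeta> ^ (2 * n - 1)"
proof -
  have "\<zeta> * \<zeta> ^ (2 * n - 1) = \<zeta> ^ (n + n)" using n by (simp flip: power_Suc add: mult_2)
  also have "\<dots> = \<zeta> * cnj \<zeta>" unfolding power_add \<zeta>_n \<zeta>_cnj by simp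
  finally show ?thesis using \<zeta>_nz by simp
qed

lemma cnj_pow: "cnj \<zeta> ^ (2 * n - 1) = \<zeta>"
  using arg_cong[OF cnj_\<zeta>, of cnj] by simp

lemma dirgood_mult: "r \<noteq> 0 \<Longrightarrow> dirgood (of_real r * d) \<longleftrightarrow> dirgood d"
  unfolding dirgood_def by (simp add: mult.assoc)

lemma dirgood_pow: "dirgood (d * \<zeta> ^ k) \<longleftrightarrow> dirgood d"
proof
  assume "dirgood (d * \<zeta> ^ k)"
  then obtain j where "Im (d * \<zeta> ^ k * cnj (\<zeta> ^ j)) = 0" unfolding dirgood_def by blast
  moreover have "\<zeta> ^ k * cnj (\<zeta> ^ j) = cnj (\<zeta> ^ (j + (2 * n - 1) * k))"
  proof -
    have "cnj (\<zeta> ^ (j + (2 * n - 1) * k)) = cnj \<zeta> ^ j * (cnj \<zeta> ^ (2 * n - 1)) ^ k"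
      by (simp only: complex_cnj_power complex_cnj_mult power_add power_mult)
    then show ?thesis unfolding cnj_pow by (simp add: mult.commute)
  qed
  ultimately have "Im (d * cnj (\<zeta> ^ (j + (2 * n - 1) * k))) = 0" by (simp only: mult.assoc)
  then show "dirgood d" unfolding dirgood_def by blast
next
  assume "dirgood d"
  then obtain j where "Im (d * cnj (\<zeta> ^ j)) = 0" unfolding dirgood_def by blast
  moreover have "\<zeta> ^ k * cnj (\<zeta> ^ (j + k)) = cnj (\<zeta> ^ j) * (\<zeta> * cnj \<zeta>) ^ k"
    by (simp only: power_add complex_cnj_power complex_cnj_mult power_mult_distrib mult_ac)
  ultimately have "Im (d * \<zeta> ^ k * cnj (\<zeta> ^ (j + k))) = 0" by (simp only: mult.assoc \<zeta>_cnj power_one mult_1_right)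
  then show "dirgood (d * \<zeta> ^ k)" unfolding dirgood_def by blast
qed

lemma dirgood_unit:
  assumes "norm d = 1"
  shows "dirgood d \<longleftrightarrow> (\<exists>j::nat. d = \<zeta> ^ j)"
proof
  assume "dirgood d"
  then obtain j where j: "Im (d * cnj (\<zeta> ^ j)) = 0" unfolding dirgood_def by blast
  define r where "r = Re (d * cnj (\<zeta> ^ j))"
  have r: "d * cnj (\<zeta> ^ j) = of_real r" using j by (simp add: r_def complex_eq_iff)
  have "norm (d * cnj (\<zeta> ^ j)) = 1" using assms \<zeta>_norm by (simp add: norm_mult norm_power)
  then have "\<bar>r\<bar> = 1" unfolding r by simp
  moreover have "d = of_real r * \<zeta> ^ j"
  proof -
    have "d = d * (\<zeta> * cnj \<zeta>) ^ j" unfolding \<zeta>_cnj by simp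
    also have "\<dots> = (d * cnj (\<zeta> ^ j)) * \<zeta> ^ j" by (simp add: power_mult_distrib)
    finally show ?thesis unfolding r .
  qed
  ultimately have "d = \<zeta> ^ j \<or> d = \<zeta> ^ (n + j)" by (auto simp: abs_if power_add \<zeta>_n split: if_splits)
  then show "\<exists>j::nat. d = \<zeta> ^ j" by blast
next
  assume "\<exists>j::nat. d = \<zeta> ^ j"
  then obtain j where "d = \<zeta> ^ j" by blast
  moreover have "dirgood 1" unfolding dirgood_def by (intro exI[of _ 0]) simp
  ultimately show "dirgood d" using dirgood_pow[of 1 j] by simp
qed

lemma dirgood_uminus: "dirgood (- d) \<longleftrightarrow> dirgood d"
  using dirgood_mult[of "- 1" d] by simp

lemma dirgood_edges:
  "dirgood (d * cis \<beta>) \<longleftrightarrow> dirgood d" "dirgood (d * cis \<beta> - d) \<longleftrightarrow> dirgood d"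
proof -
  show "dirgood (d * cis \<beta>) \<longleftrightarrow> dirgood d" unfolding \<eta> by (rule dirgood_pow)
  have "d * cis \<beta> - d = of_real c * (d * \<zeta> ^ g)"
    using arg_cong[OF \<eta>1, of "\<lambda>x. d * x"] by (simp add: algebra_simps)
  then show "dirgood (d * cis \<beta> - d) \<longleftrightarrow> dirgood d" using dirgood_mult[OF c(1)] dirgood_pow by simp
qed

text \<open>
  Membership of a vertex in \<open>lattice\<close> together with the direction of the edge is a flag that is
  constant on each tile, so \<open>propagate\<close> applies.
\<close>

lemma lattice_vertices:
  assumes "i \<in> I"
  shows "p i \<in> lattice \<and> (\<exists>j. u i = \<zeta> ^ j)"
proof -
  \<comment> \<open>The flag sees the line only as a set, so its direction is tested on all pairs of
    its points. On a tile with a bad direction the flag is false everywhere; with a good one the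
    vertices differ by lattice elements.\<close>
  define H where "H L x \<longleftrightarrow> x \<in> lattice \<and> (\<forall>y\<in>L. \<forall>y'\<in>L. dirgood (y' - y))" for L x
  have H: "H (lin v w) x \<longleftrightarrow> x \<in> lattice \<and> dirgood (w - v)" if "v \<noteq> w" for v w x
  proof -
    have "dirgood (y' - y)" if "y \<in> lin v w" "y' \<in> lin v w" "dirgood (w - v)" for y y'
    proof -
      obtain t where t: "y = v + of_real t * (w - v)"
        using collinear_param[OF \<open>v \<noteq> w\<close>, of y] \<open>y \<in> lin v w\<close> unfolding lin_def by blast
      obtain t' where t': "y' = v + of_real t' * (w - v)"
        using collinear_param[OF \<open>v \<noteq> w\<close>, of y'] \<open>y' \<in> lin v w\<close> unfolding lin_def by blast
      have "y' - y = of_real (t' - t) * (w - v)" unfolding t t' by (simp add: algebra_simps)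
      moreover have "dirgood 0" unfolding dirgood_def by simp
      ultimately show ?thesis using dirgood_mult[of "t' - t" "w - v"] that(3) by (cases "t' = t") auto
    qed
    moreover have "v \<in> lin v w" "w \<in> lin v w" by simp_all
    ultimately show ?thesis unfolding H_def by blast
  qed
  note edges = dirgood_edges
  have "H (lin (p i) (p i + u i)) (p i)"
  proof (rule propagate[OF _ _ assms])
    fix j assume j: "j \<in> I"
    have nz: "u j \<noteq> 0" "u j * cis \<beta> \<noteq> 0" "u j \<noteq> u j * cis \<beta>" using u_nz[OF j] cis_\<beta> by auto
    define h where "h \<longleftrightarrow> p j \<in> lattice \<and> dirgood (u j)"
    have mem: "p j + u j \<in> lattice \<and> p j + u j * cis \<beta> \<in> lattice \<longleftrightarrow> p j \<in> lattice"
      "p j + u j \<in> lattice \<longleftrightarrow> p j \<in> lattice" "p j + u j * cis \<beta> \<in> lattice \<longleftrightarrow> p j \<in> lattice" if D: "dirgood (u j)"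
    proof -
      obtain k where k: "u j = \<zeta> ^ k" using D dirgood_unit[OF unit[OF j]] by blast
      have l: "u j \<in> lattice" "u j * cis \<beta> \<in> lattice"
        unfolding k \<eta> power_add[symmetric] by (rule lattice_pow)+
      show 1: "p j + u j \<in> lattice \<longleftrightarrow> p j \<in> lattice"
        using lattice_add(1)[OF _ l(1), of "p j"] lattice_diff(1)[OF _ l(1), of "p j + u j"] by auto
      show 2: "p j + u j * cis \<beta> \<in> lattice \<longleftrightarrow> p j \<in> lattice"
        using lattice_add(1)[OF _ l(2), of "p j"] lattice_diff(1)[OF _ l(2), of "p j + u j * cis \<beta>"] by auto
      show "p j + u j \<in> lattice \<and> p j + u j * cis \<beta> \<in> lattice \<longleftrightarrow> p j \<in> lattice" using 1 2 by blast
    qed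
    have "dirgood (p j + u j - p j) \<longleftrightarrow> dirgood (u j)"
      "dirgood (p j + u j * cis \<beta> - (p j + u j)) \<longleftrightarrow> dirgood (u j)"
      "dirgood (p j - (p j + u j * cis \<beta>)) \<longleftrightarrow> dirgood (u j)"
      using edges[of "u j"] dirgood_uminus[of "u j * cis \<beta>"] by simp_all
    then have "\<forall>(v, w) \<in> {(p j, p j + u j), (p j + u j, p j + u j * cis \<beta>), (p j + u j * cis \<beta>, p j)}.
        H (lin v w) v = h \<and> H (lin v w) w = h"
      using mem nz by (auto simp: H h_def)
    then show "\<exists>h. \<forall>(v, w) \<in> {(p j, p j + u j), (p j + u j, p j + u j * cis \<beta>), (p j + u j * cis \<beta>, p j)}.
        H (lin v w) v = h \<and> H (lin v w) w = h" by blast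
  next
    obtain x y :: int where sxy: "s = of_int x + of_int y * b" using s_quadratic unfolding quadratic_def by blast
    have sl: "of_real s \<in> lattice" unfolding sxy by (rule lattice_real)
    have sl': "of_real s * cis \<beta> \<in> lattice" unfolding \<eta> using lattice_mult_pow[OF sl] by blast
    have nz: "complex_of_real s \<noteq> 0" using s by simp
    have "dirgood 1" using dirgood_unit[of 1] by (metis norm_one power_0)
    then have "dirgood (of_real s)" using dirgood_mult[of s 1] s by simp
    then have "dirgood (of_real s - 0)" "dirgood (of_real s * cis \<beta> - of_real s)" "dirgood (0 - of_real s * cis \<beta>)"
      using edges[of "of_real s"] dirgood_uminus[of "of_real s * cis \<beta>"] by simp_all
    then show "\<forall>(v, w) \<in> {(0, of_real s), (of_real s, of_real s * cis \<beta>), (of_real s * cis \<beta>, 0)}.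
      H (lin v w) v \<and> H (lin v w) w"
      using sl sl' nz lattice_0 cis_\<beta> by (auto simp: H)
  qed
  then have "p i \<in> lattice \<and> dirgood (u i)" using H[of "p i" "p i + u i"] u_nz[OF assms] by simp
  then show ?thesis using dirgood_unit[OF unit[OF assms]] by blast
qed

lemma additive_lattice:
  fixes F :: "complex \<Rightarrow> complex \<Rightarrow> real"
  assumes "\<And>p q r. p \<in> lattice \<Longrightarrow> q \<in> lattice \<Longrightarrow> r \<in> lattice \<Longrightarrow> orient p q r = 0 \<Longrightarrow> F p q + F q r = F p r"
  shows "(\<Sum>i\<in>I. tri F (p i) (p i + u i) (p i + u i * \<zeta> ^ m)) = tri F 0 (of_real s) (of_real s * \<zeta> ^ m)"
proof -
  have "verts \<subseteq> lattice"
  proof -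
    obtain x y :: int where sxy: "s = of_int x + of_int y * b" using s_quadratic unfolding quadratic_def by blast
    have sl: "of_real s \<in> lattice" unfolding sxy by (rule lattice_real)
    have "p i \<in> lattice \<and> p i + u i \<in> lattice \<and> p i + u i * cis \<beta> \<in> lattice" if i: "i \<in> I" for i
    proof -
      obtain j where j: "p i \<in> lattice" "u i = \<zeta> ^ j" using lattice_vertices[OF i] by blast
      then show ?thesis unfolding \<eta> j(2) power_add[symmetric]
        using lattice_add(1)[OF j(1) lattice_pow(1)] by blast
    qed
    moreover have "of_real s * cis \<beta> \<in> lattice" unfolding \<eta> using lattice_mult_pow[OF sl] by blast
    ultimately show ?thesis using sl lattice_0(1) unfolding verts_def by auto
  qed
  then show ?thesis using additive[of lattice F] assms unfolding \<eta> by blast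
qed

end

section \<open>Triangles with angles that are multiples of 36 degrees\<close>

lemma quadratic_irrational:
  fixes x :: real and e f :: int
  assumes x: "x * x = of_int e * x + of_int f" and k: "\<And>k::int. k * k \<noteq> e * k + f"
  shows "x \<notin> \<rat>"
proof
  assume "x \<in> \<rat>"
  have "algebraic_int x"
  proof (rule algebraic_int.intros)
    show "lead_coeff [:- of_int f, - of_int e, 1 :: real:] = 1" by simp
    show "\<forall>i. coeff [:- of_int f, - of_int e, 1 :: real:] i \<in> \<int>"
      by (simp add: coeff_pCons split: nat.split)
    show "poly [:- of_int f, - of_int e, 1:] x = 0" using x by (simp add: algebra_simps)
  qed
  then have "x \<in> \<int>" using \<open>x \<in> \<rat>\<close> by (rule rational_algebraic_int_is_int)
  then obtain k :: int where "x = of_int k" by (auto elim: Ints_cases)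
  then have "real_of_int (k * k) = real_of_int (e * k + f)" using x by simp
  then show False using k of_int_eq_iff by blast
qed

lemma cis_square: "cis t * cis t = of_real (2 * cos t) * cis t - 1"
proof -
  have "cos t * cos t + sin t * sin t = 1" using sin_cos_squared_add3 by simp
  then show ?thesis by (simp add: complex_eq_iff algebra_simps)
qed

text \<open>The assumption holds whenever 5 t is an odd multiple of pi. In c = cos t it reads (c +
  1)(4 c^2 - 2 c - 1) = 0, and the second factor is the golden ratio equation for 2 c.\<close>

lemma golden_root:
  fixes t :: real
  assumes "cos (3 * t) = - cos (2 * t)" "cos t \<noteq> - 1"
  shows "2 * cos t * (2 * cos t) = 2 * cos t + 1"
proof -
  have "4 * cos t ^ 3 - 3 * cos t = - (2 * (cos t)\<^sup>2 - 1)"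
    using assms(1) unfolding cos_treble_cos cos_double_cos .
  then have "(cos t + 1) * (2 * cos t * (2 * cos t) - 2 * cos t - 1) = 0"
    by (simp add: algebra_simps power2_eq_square power3_eq_cube)
  then show ?thesis using assms(2) by (simp add: add_eq_0_iff2)
qed

lemma golden_cos:
  "2 * cos (pi / 5) * (2 * cos (pi / 5)) = 2 * cos (pi / 5) + 1"
  "2 * cos (3 * pi / 5) * (2 * cos (3 * pi / 5)) = 2 * cos (3 * pi / 5) + 1"
proof -
  have "cos (3 * (pi / 5)) = cos (pi - 2 * (pi / 5))" by (simp add: field_simps)
  then have 1: "cos (3 * (pi / 5)) = - cos (2 * (pi / 5))" by (simp only: cos_pi_minus)
  have "cos (pi / 5) > 0" by (intro cos_gt_zero) auto
  then have 2: "cos (pi / 5) \<noteq> - 1" by linarith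
  show "2 * cos (pi / 5) * (2 * cos (pi / 5)) = 2 * cos (pi / 5) + 1" using 1 2 by (rule golden_root)
  have "cos (3 * (3 * pi / 5)) = cos (pi - 2 * (3 * pi / 5) + 2 * pi)" by (simp add: field_simps)
  then have 3: "cos (3 * (3 * pi / 5)) = - cos (2 * (3 * pi / 5))" by (simp only: cos_periodic cos_pi_minus)
  have "cos pi < cos (3 * pi / 5)" by (intro cos_monotone_0_pi) auto
  then have 4: "cos (3 * pi / 5) \<noteq> - 1" by simp
  show "2 * cos (3 * pi / 5) * (2 * cos (3 * pi / 5)) = 2 * cos (3 * pi / 5) + 1" using 3 4 by (rule golden_root)
qed

lemma golden_powers:
  "complex_of_real (2 * cos (pi / 5)) * of_real (2 * cos (pi / 5)) = of_real (2 * cos (pi / 5)) + 1"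
  "cis (pi / 5) ^ 3 = of_real (2 * cos (pi / 5)) * (cis (pi / 5) - 1)"
  "cis (pi / 5) ^ 4 = cis (pi / 5) - of_real (2 * cos (pi / 5))"
proof -
  define z B where "z = cis (pi / 5)" and "B = complex_of_real (2 * cos (pi / 5))"
  have g: "B * B = B + 1" using arg_cong[OF golden_cos(1), of complex_of_real] unfolding B_def by simp
  have z2: "z * z = B * z - 1" unfolding z_def B_def by (rule cis_square)
  have "z ^ 3 = z * z * z" by (simp add: power3_eq_cube)
  also have "\<dots> = B * (z * z) - z" by (subst z2) (simp add: algebra_simps)
  also have "\<dots> = (B * B) * z - B - z" unfolding z2 by (simp add: algebra_simps)
  also have "\<dots> = B * (z - 1)" unfolding g by (simp add: algebra_simps)
  finally have z3: "z ^ 3 = B * (z - 1)" .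
  have "z ^ 4 = z ^ 3 * z" by (simp add: eval_nat_numeral)
  also have "\<dots> = B * (z * z - z)" unfolding z3 by (simp add: algebra_simps)
  also have "\<dots> = (B * B - B) * z - B" unfolding z2 by (simp add: algebra_simps)
  also have "\<dots> = z - B" unfolding g by simp
  finally have z4: "z ^ 4 = z - B" .
  show "complex_of_real (2 * cos (pi / 5)) * of_real (2 * cos (pi / 5)) = of_real (2 * cos (pi / 5)) + 1"
    "cis (pi / 5) ^ 3 = of_real (2 * cos (pi / 5)) * (cis (pi / 5) - 1)"
    "cis (pi / 5) ^ 4 = cis (pi / 5) - of_real (2 * cos (pi / 5))"
    using g z3 z4 unfolding z_def B_def .
qed

context zeta_tiling
begin

text \<open>\<open>s * s\<close> is the number of tiles, an integer, so conjugation changes at most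
  the sign of \<open>s\<close> and cannot collapse the big triangle.\<close>

lemma galois_s:
  obtains s' where "of_real s \<in> lattice" "galois (of_real s) = of_real s'" "s' * s' = s * s"
proof -
  obtain x y :: int where sxy: "s = of_int x + of_int y * b" using s_quadratic unfolding quadratic_def by blast
  have "s * s = of_int (int (card I))" using card_eq by (simp add: power2_eq_square)
  note sq = galois_square(1)[OF sxy this]
  show ?thesis
  proof (rule that)
    show "of_real s \<in> lattice" unfolding sxy by (rule lattice_real)
    show "galois (of_real s) = of_real (of_int x + of_int y * b')" unfolding sxy by (rule lattice_real)
    show "(of_int x + of_int y * b') * (of_int x + of_int y * b') = s * s"
      using sq card_eq by (simp add: power2_eq_square)
  qed
qed

lemma galois_tile:
  assumes "i \<in> I"
  shows "galois (p i + u i) = galois (p i) + galois (u i)"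
    "galois (p i + u i * \<zeta> ^ m) = galois (p i) + galois (u i) * \<zeta>' ^ m" "galois (u i) \<noteq> 0" "p i \<in> lattice" "u i \<in> lattice"
proof -
  obtain j where j: "p i \<in> lattice" "u i = \<zeta> ^ j" using lattice_vertices[OF assms] by blast
  show "galois (p i + u i) = galois (p i) + galois (u i)"
    unfolding j(2) by (rule lattice_add(2)[OF j(1) lattice_pow(1)])
  show "galois (p i + u i * \<zeta> ^ m) = galois (p i) + galois (u i) * \<zeta>' ^ m"
    unfolding j(2) using lattice_add(2)[OF j(1)] lattice_mult_pow[OF lattice_pow(1)] by simp
  have "\<zeta>' \<noteq> 0"
  proof
    assume "\<zeta>' = 0" then show False using \<zeta>2(2) by simp
  qed
  then show "galois (u i) \<noteq> 0" unfolding j(2) by (simp add: lattice_pow)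
  show "p i \<in> lattice" "u i \<in> lattice" using j lattice_pow by auto
qed

text \<open>Angles subtended by conjugate edges are additive on the lattice, since
  \<open>galois\<close> preserves collinearity there. The conjugate tiles themselves need not form a
  tiling.\<close>

lemma galois_angle_sum:
  "(\<Sum>i\<in>I. tri (ang (galois v)) (galois (p i)) (galois (p i) + galois (u i)) (galois (p i) + galois (u i) * \<zeta>' ^ m))
    = tri (ang (galois v)) 0 (galois (of_real s)) (galois (of_real s) * \<zeta>' ^ m)"
proof -
  let ?F = "\<lambda>x y. ang (galois v) (galois x) (galois y)"
  have "(\<Sum>i\<in>I. tri ?F (p i) (p i + u i) (p i + u i * \<zeta> ^ m)) = tri ?F 0 (of_real s) (of_real s * \<zeta> ^ m)"
    by (rule additive_lattice) (intro ang_add galois_collinear)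
  moreover have "galois (of_real s * \<zeta> ^ m) = galois (of_real s) * \<zeta>' ^ m"
    using galois_s lattice_mult_pow by metis
  ultimately show ?thesis unfolding tri_def by (simp add: galois_tile lattice_0)
qed

end

lemma tri_ang_flip: "tri (ang z) a c b = - tri (ang z) a b c"
  using ang_swap[of z a c] ang_swap[of z c b] ang_swap[of z b a] by (simp add: tri_def)

context iso_tiling
begin

text \<open>The conjugation sends the primitive tenth root of unity \<open>cis (pi / 5)\<close> to
  its cube, and accordingly the golden ratio \<open>2 * cos (pi / 5)\<close> to the other root of
  X^2 = X + 1.\<close>

lemma fifth_tiling:
  assumes "cis \<beta> = cis (pi / 5) ^ m" "cis \<beta> - 1 = of_real (of_int x + of_int y * (2 * cos (pi / 5))) * cis (pi / 5) ^ g"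
  shows "zeta_tiling I p u s \<beta> (2 * cos (pi / 5)) (2 * cos (3 * pi / 5)) (cis (pi / 5)) (cis (3 * pi / 5)) 1 1 5 m g
    (of_int x + of_int y * (2 * cos (pi / 5)))"
proof -
  interpret q: quad_conj "2 * cos (pi / 5)" "2 * cos (3 * pi / 5)" "cis (pi / 5)" "cis (3 * pi / 5)" 1 1
  proof
    show "2 * cos (pi / 5) \<notin> \<rat>"
    proof (rule quadratic_irrational[of _ 1 1])
      show "k * k \<noteq> 1 * k + 1" for k :: int
      proof
        assume "k * k = 1 * k + 1"
        then have "k * (k - 1) = 1" by (simp add: algebra_simps)
        then have "k = 1 \<and> k - 1 = 1 \<or> k = -1 \<and> k - 1 = -1" by (simp only: zmult_eq_1_iff)
        then show False by auto
      qed
    qed (use golden_cos in simp)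
    show "Im (cis (pi / 5)) \<noteq> 0" using sin_gt_zero[of "pi / 5"] by simp
  qed (use golden_cos cis_square in auto)
  show ?thesis
  proof
    show "cis (pi / 5) ^ 5 = - 1" by (subst Complex.DeMoivre) simp
    show "of_int x + of_int y * (2 * cos (pi / 5)) \<noteq> 0"
    proof
      assume "of_int x + of_int y * (2 * cos (pi / 5)) = 0"
      then have "cis \<beta> = 1" using assms(2) by simp
      then show False using cis_\<beta> by simp
    qed
    show "of_int x + of_int y * (2 * cos (pi / 5)) \<in> q.quadratic" unfolding q.quadratic_def by blast
  qed (use assms in auto)
qed

text \<open>
  Conjugation turns the angles (36, 72, 72) into (108, 36, 36), so the 108 degree corner of a
  conjugate tile would have to fit into a 36 degree corner of the conjugate triangle.
\<close>

lemma no_split_36: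
  assumes \<beta>36: "\<beta> = pi / 5" and v: "v \<in> {of_real s, of_real s * cis \<beta>}" and i: "i \<in> I" "p i = v"
  shows False
proof -
  let ?z = "cis (pi / 5)"
  note g = golden_powers(1) and z3 = golden_powers(2)
  \<comment> \<open>With B = 2 cos (pi / 5) and z = \<open>cis (pi / 5)\<close>: z^3 = B (z - 1) and
    B (B - 1) = 1 give z - 1 = (B - 1) z^3 for the base.\<close>
  have "of_real (of_int (- 1) + of_int 1 * (2 * cos (pi / 5))) * ?z ^ 3 =
    (of_real (2 * cos (pi / 5)) * of_real (2 * cos (pi / 5)) - of_real (2 * cos (pi / 5))) * (?z - 1)"
    unfolding z3 by (simp add: algebra_simps)
  then have c: "cis \<beta> - 1 = of_real (of_int (- 1) + of_int 1 * (2 * cos (pi / 5))) * ?z ^ 3"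
    unfolding g \<beta>36 by simp
  interpret z: zeta_tiling I p u s \<beta> "2 * cos (pi / 5)" "2 * cos (3 * pi / 5)" ?z "cis (3 * pi / 5)" 1 1 5 1 3
    "of_int (- 1) + of_int 1 * (2 * cos (pi / 5))"
    by (rule fifth_tiling[OF _ c]) (simp only: \<beta>36 power_one_right)
  obtain s' where s': "of_real s \<in> z.lattice" "z.galois (of_real s) = of_real s'" "s' * s' = s * s"
    by (rule z.galois_s)
  have s'0: "complex_of_real s' \<noteq> 0" using s'(3) s by auto
  have t: "0 < 3 * pi / 5" "3 * pi / 5 < pi" by simp_all
  have "z.galois v = of_real s' \<or> z.galois v = of_real s' * cis (3 * pi / 5)"
    using v z.lattice_mult_pow[OF s'(1), of 1] s'(2) \<beta>36 by auto
  then have "tri (ang (z.galois v)) 0 (of_real s') (of_real s' * cis (3 * pi / 5)) = (pi - 3 * pi / 5) / 2"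
    using tri_ang_isosceles(2)[OF t s'0, of "z.galois v" 0] by simp
  then have "(\<Sum>i\<in>I. tri (ang (z.galois v)) (z.galois (p i)) (z.galois (p i) + z.galois (u i))
     (z.galois (p i) + z.galois (u i) * cis (3 * pi / 5))) = (pi - 3 * pi / 5) / 2"
    using z.galois_angle_sum[of v] s'(2) by simp
  moreover have "tri (ang (z.galois v)) (z.galois (p i)) (z.galois (p i) + z.galois (u i))
     (z.galois (p i) + z.galois (u i) * cis (3 * pi / 5)) \<le> (\<Sum>i\<in>I. tri (ang (z.galois v)) (z.galois (p i)) (z.galois (p i) + z.galois (u i))
     (z.galois (p i) + z.galois (u i) * cis (3 * pi / 5)))"
    by (rule member_le_sum[OF i(1) _ fin]) (intro tri_ang_nonneg ang_isosceles(1)[OF t] z.galois_tile(3), simp)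
  moreover have "tri (ang (z.galois v)) (z.galois (p i)) (z.galois (p i) + z.galois (u i))
     (z.galois (p i) + z.galois (u i) * cis (3 * pi / 5)) = 3 * pi / 5"
    by (rule tri_ang_isosceles(1)[OF t z.galois_tile(3)[OF i(1)]]) (simp add: i(2))
  ultimately have "3 * pi / 5 \<le> (pi - 3 * pi / 5) / 2" by simp
  then show False using pi_gt_zero by simp
qed

text \<open>
  Conjugation turns the angles (108, 36, 36) into (36, 72, 72) and reverses the orientation.
\<close>

lemma no_split_108:
  assumes \<beta>108: "\<beta> = 3 * pi / 5" and i: "i \<in> I" "0 \<in> {p i + u i, p i + u i * cis \<beta>}"
  shows False
proof -
  let ?z = "cis (pi / 5)"
  note g = golden_powers(1) and z3 = golden_powers(2) and z4 = golden_powers(3)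
  have b3: "cis \<beta> = ?z ^ 3" unfolding \<beta>108 Complex.DeMoivre by simp
  have "of_real (2 * cos (pi / 5)) * ?z ^ 4 =
      of_real (2 * cos (pi / 5)) * ?z - of_real (2 * cos (pi / 5)) * of_real (2 * cos (pi / 5))"
    unfolding z4 by (simp add: algebra_simps)
  also have "\<dots> = cis \<beta> - 1" unfolding g b3 z3 by (simp add: algebra_simps)
  finally have c: "cis \<beta> - 1 = of_real (of_int 0 + of_int 1 * (2 * cos (pi / 5))) * ?z ^ 4" by simp
  interpret z: zeta_tiling I p u s \<beta> "2 * cos (pi / 5)" "2 * cos (3 * pi / 5)" ?z "cis (3 * pi / 5)" 1 1 5 3 4
    "of_int 0 + of_int 1 * (2 * cos (pi / 5))"
    by (rule fifth_tiling[OF b3 c])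
  obtain s' where s': "of_real s \<in> z.lattice" "z.galois (of_real s) = of_real s'" "s' * s' = s * s"
    by (rule z.galois_s)
  have s'0: "complex_of_real s' \<noteq> 0" using s'(3) s by auto
  have t: "0 < pi / 5" "pi / 5 < pi" by simp_all
  define \<eta>' where "\<eta>' = cis (3 * pi / 5) ^ 3"
  \<comment> \<open>Three times 108 degrees is -36 degrees modulo a full turn. Exchanging the legs
    of a conjugate tile gives a positively oriented one with apex angle 36 degrees.\<close>
  have "\<eta>' = cis (- (pi / 5) + 2 * pi)" unfolding \<eta>'_def Complex.DeMoivre by (intro arg_cong[of _ _ cis]) simp
  then have e: "\<eta>' * cis (pi / 5) = 1" by (simp add: cis_mult)
  have nz: "\<eta>' \<noteq> 0" unfolding \<eta>'_def by simp
  have flip: "tri (ang w) q (q + d) (q + d * \<eta>') = - tri (ang w) q (q + d * \<eta>') (q + (d * \<eta>') * cis (pi / 5))" for w q d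
    unfolding mult.assoc e mult_1_right by (rule tri_ang_flip)
  have nn: "tri (ang w) q (q + d) (q + d * \<eta>') \<le> 0" if "d \<noteq> 0" for w q d
  proof -
    have "d * \<eta>' \<noteq> 0" using that nz by simp
    then show ?thesis unfolding flip
      using tri_ang_nonneg[OF ang_isosceles(1)[OF t], of "d * \<eta>'" w q] by simp
  qed
  have T: "tri (ang 0) 0 (of_real s') (of_real s' * \<eta>') = - (pi / 5)"
  proof -
    have "of_real s' * \<eta>' \<noteq> 0" using s'0 nz by simp
    from tri_ang_isosceles(1)[OF t this, of 0 0] show ?thesis
      using flip[of 0 0 "of_real s'"] by simp
  qed
  have "(\<Sum>i\<in>I. tri (ang 0) (z.galois (p i)) (z.galois (p i) + z.galois (u i))
     (z.galois (p i) + z.galois (u i) * \<eta>')) = - (pi / 5)"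
    using z.galois_angle_sum[of 0] s'(2) z.lattice_0(2) T unfolding \<eta>'_def by simp
  then have "(\<Sum>i\<in>I. - tri (ang 0) (z.galois (p i)) (z.galois (p i) + z.galois (u i))
     (z.galois (p i) + z.galois (u i) * \<eta>')) = pi / 5" unfolding sum_negf by simp
  moreover have "- tri (ang 0) (z.galois (p i)) (z.galois (p i) + z.galois (u i))
     (z.galois (p i) + z.galois (u i) * \<eta>') \<le> (\<Sum>i\<in>I. - tri (ang 0) (z.galois (p i)) (z.galois (p i) + z.galois (u i))
     (z.galois (p i) + z.galois (u i) * \<eta>'))"
    by (rule member_le_sum[OF i(1) _ fin]) (use nn z.galois_tile(3) in force)
  moreover have "- tri (ang 0) (z.galois (p i)) (z.galois (p i) + z.galois (u i))
     (z.galois (p i) + z.galois (u i) * \<eta>') = (pi - pi / 5) / 2"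
  proof -
    have "p i + u i = 0 \<or> p i + u i * ?z ^ 3 = 0" using i(2) unfolding b3 by auto
    then have "0 = z.galois (p i) + z.galois (u i) \<or> 0 = z.galois (p i) + z.galois (u i) * \<eta>'"
      using z.galois_tile(1,2)[OF i(1)] z.lattice_0(2) unfolding \<eta>'_def by metis
    then have "0 = z.galois (p i) + z.galois (u i) * \<eta>' \<or> 0 = z.galois (p i) + z.galois (u i) * \<eta>' * cis (pi / 5)"
      unfolding mult.assoc e by auto
    moreover have "z.galois (u i) * \<eta>' \<noteq> 0" using nz z.galois_tile(3)[OF i(1)] by simp
    ultimately show ?thesis unfolding flip using tri_ang_isosceles(2)[OF t] by simp
  qed
  \<comment> \<open>A conjugate base corner of 72 degrees would have to fit into the conjugate apex
    of 36 degrees.\<close>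
  ultimately have "(pi - pi / 5) / 2 \<le> pi / 5" by simp
  then show False using pi_gt_zero by simp
qed

end

section \<open>The triangle with angles 30, 30, 120 degrees\<close>

text \<open>Sees only edges of the one direction orthogonal to (A, B). The edges among collinear
  points share their direction, so any function \<open>g\<close> gives an additive
  functional.\<close>

definition dir_diff :: "real \<Rightarrow> real \<Rightarrow> (complex \<Rightarrow> real) \<Rightarrow> complex \<Rightarrow> complex \<Rightarrow> real" where
  "dir_diff A B g x y = (if A * Re (y - x) + B * Im (y - x) = 0 then g y - g x else 0)"

lemma dir_diff_add:
  assumes "orient x y z = 0"
  shows "dir_diff A B g x y + dir_diff A B g y z = dir_diff A B g x z"
proof (cases "x = y \<or> x = z")
  case True
  then show ?thesis
  proof
    assume "x = y"
    then show ?thesis by (simp add: dir_diff_def)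
  next
    assume "x = z"
    moreover have "A * Re (z - y) + B * Im (z - y) = - (A * Re (y - z) + B * Im (y - z))"
      by (simp add: algebra_simps)
    ultimately show ?thesis by (simp add: dir_diff_def)
  qed
next
  case False
  then have ne: "x \<noteq> y" "x \<noteq> z" by auto
  define d where "d = A * Re (y - x) + B * Im (y - x)"
  obtain t where t: "z = x + of_real t * (y - x)" using ne(1) assms by (rule collinear_param)
  have zx: "A * Re (z - x) + B * Im (z - x) = t * d" unfolding t d_def by (simp add: algebra_simps)
  have zy: "A * Re (z - y) + B * Im (z - y) = (t - 1) * d" unfolding t d_def by (simp add: algebra_simps)
  have "t \<noteq> 0" using t ne by auto
  show ?thesis
  proof (cases "t = 1")
    case True
    then have "z = y" using t by simp
    then show ?thesis by (simp add: dir_diff_def)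
  next
    case False
    then show ?thesis unfolding dir_diff_def zx zy d_def[symmetric] using \<open>t \<noteq> 0\<close> by simp
  qed
qed

lemma cis_120: "cis (2 * pi / 3) = Complex (- 1 / 2) (sqrt 3 / 2)"
  using cos_120 sin_120 by (simp add: complex_eq_iff mult.commute)

text \<open>Changing the sign of sqrt 3 = \<zeta> + 1 / \<zeta> allows - \<zeta> or its inverse as
  conjugate of \<zeta>. The choice - \<zeta> fixes \<open>\<zeta>\<^sup>2\<close>, hence the apex
  rotation \<open>\<zeta> ^ 4\<close>.\<close>

locale sixth_tiling =
  zeta_tiling I p u s "2 * pi / 3" "sqrt 3" "- sqrt 3" "cis (pi / 6)" "- cis (pi / 6)" 0 3 6 4 5 "sqrt 3"
  for I :: "'i set" and p u :: "'i \<Rightarrow> complex" and s :: real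
begin

abbreviation "\<zeta> \<equiv> cis (pi / 6)"
abbreviation "\<eta> \<equiv> cis (2 * pi / 3)"

lemma orient_cnj: "orient 0 w d = Im (d * cnj w)"
  by (simp add: orient_def cr_def algebra_simps)

text \<open>
  Here the conjugation multiplies a leg \<open>\<zeta> ^ j\<close> by \<open>(- 1) ^ j\<close>, so \<open>z \<mapsto> z \<plusminus> galois z\<close> doubles the
  tiles with one parity of \<open>j\<close> and collapses the others to points. The sign is chosen such that the
  big triangle is doubled; then comparing areas leaves no room for the collapsed tiles.
\<close>

lemma galois_dirgood:
  assumes d: "d \<in> lattice" and k: "Im (d * cnj (\<zeta> ^ k)) = 0"
  shows "orient 0 (\<zeta> ^ k) (d + of_real r * galois d) = 0"
proof -
  have 1: "orient 0 (\<zeta> ^ k) d = 0" using k by (simp only: orient_cnj)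
  have "orient (galois 0) (galois (\<zeta> ^ k)) (galois d) = 0"
    by (rule galois_collinear[OF lattice_0(1) lattice_pow(1) d 1])
  then have "orient 0 ((- \<zeta>) ^ k) (galois d) = 0" unfolding lattice_0(2) lattice_pow(2) .
  then have "(- 1) ^ k * orient 0 (\<zeta> ^ k) (galois d) = 0"
    unfolding power_minus[of \<zeta>] by (simp add: orient_def cr_def algebra_simps minus_one_power_iff split: if_splits)
  then have 2: "orient 0 (\<zeta> ^ k) (galois d) = 0" by simp
  have "orient 0 (\<zeta> ^ k) (d + of_real r * galois d) = orient 0 (\<zeta> ^ k) d + r * orient 0 (\<zeta> ^ k) (galois d)"
    by (simp add: orient_def cr_def algebra_simps)
  then show ?thesis using 1 2 by simp
qed

text \<open>\<open>P\<close> does not preserve collinearity in general, but it does along the powers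
  of \<zeta>: there a vector and its conjugate are parallel. This is why \<open>F\<close> is
  switched off in all other directions.\<close>

lemma folded_area_additive:
  fixes r :: real
  defines "P \<equiv> \<lambda>z. z + of_real r * galois z"
  defines "F \<equiv> \<lambda>x y. if dirgood (y - x) then cr (P x) (P y) else 0"
  assumes l: "x \<in> lattice" "y \<in> lattice" "z \<in> lattice" and o: "orient x y z = 0"
  shows "F x y + F y z = F x z"
proof (cases "x = y \<or> x = z \<or> y = z")
  case True
  have sym: "F w v = - F v w" for v w
  proof -
    have "cr (P w) (P v) = - cr (P v) (P w)" by (simp add: cr_def)
    moreover have "dirgood (v - w) \<longleftrightarrow> dirgood (w - v)" using dirgood_uminus[of "v - w"] by simp
    ultimately show ?thesis by (simp add: F_def)
  qed
  have self: "F v v = 0" for v by (simp add: F_def)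
  show ?thesis using True by (elim disjE) (use sym[of x y] self in simp_all)
next
  case False
  then have ne: "x \<noteq> y" "x \<noteq> z" "y \<noteq> z" by auto
  obtain t where t: "z = x + of_real t * (y - x)" using ne(1) o by (rule collinear_param)
  have t01: "t \<noteq> 0" "t - 1 \<noteq> 0" using t ne by auto
  have zx: "z - x = of_real t * (y - x)" and zy: "z - y = of_real (t - 1) * (y - x)"
    unfolding t by (simp_all add: algebra_simps)
  have g: "dirgood (z - x) \<longleftrightarrow> dirgood (y - x)" "dirgood (z - y) \<longleftrightarrow> dirgood (y - x)"
    unfolding zx zy using t01 by (simp_all only: dirgood_mult not_False_eq_True)
  show ?thesis
  proof (cases "dirgood (y - x)")
    case True
    then obtain k where k: "Im ((y - x) * cnj (\<zeta> ^ k)) = 0" unfolding dirgood_def by blast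
    then have k': "Im ((z - x) * cnj (\<zeta> ^ k)) = 0" unfolding zx mult.assoc by simp
    have Pd: "P v - P w = (v - w) + of_real r * galois (v - w)" if "v \<in> lattice" "w \<in> lattice" for v w
      unfolding P_def lattice_diff(2)[OF that] by (simp add: algebra_simps)
    have "orient 0 (P y - P x) (P z - P x) = 0"
    proof (rule collinear_trans(2))
      show "0 \<noteq> \<zeta> ^ k" by simp
      show "orient 0 (\<zeta> ^ k) (P y - P x) = 0" unfolding Pd[OF l(2,1)]
        by (rule galois_dirgood[OF lattice_diff(1)[OF l(2,1)] k])
      show "orient 0 (\<zeta> ^ k) (P z - P x) = 0" unfolding Pd[OF l(3,1)]
        by (rule galois_dirgood[OF lattice_diff(1)[OF l(3,1)] k'])
    qed
    then have "cr (P x) (P y) + cr (P y) (P z) + cr (P z) (P x) = 0"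
      unfolding orient_alt[symmetric] by (simp add: orient_def)
    moreover have "cr (P z) (P x) = - cr (P x) (P z)" by (simp add: cr_def)
    ultimately show ?thesis using True g by (simp add: F_def)
  qed (simp add: F_def g)
qed

lemma galois_u:
  assumes "u i = \<zeta> ^ j"
  shows "galois (u i) = of_real ((- 1) ^ j) * u i" "galois (u i * \<eta>) = of_real ((- 1) ^ j) * (u i * \<eta>)"
  using lattice_pow(2)[of j] lattice_pow(2)[of "j + 4"] unfolding assms \<eta>
  by (simp_all add: power_minus[of \<zeta>] power_add)

lemma tile_parity:
  assumes r: "galois (of_real s) = of_real (r * s)" "r = 1 \<or> r = - 1"
    and i: "i \<in> I" and ui: "u i = \<zeta> ^ j"
  shows "r = (- 1) ^ j"
proof -
  define P where "P = (\<lambda>z. z + of_real r * galois z)"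
  define F where "F = (\<lambda>x y. if dirgood (y - x) then cr (P x) (P y) else 0)"
  define k where "k i = (1 + r * (- 1) ^ (SOME j. u i = \<zeta> ^ j))\<^sup>2" for i
  have o: "orient q (q + w) (q + w * \<eta>) = (norm w)\<^sup>2 * sin (2 * pi / 3)" for q w
    unfolding cmod_power2 by (simp add: orient_def cr_def algebra_simps power2_eq_square)
  have dg: "tri F q (q + w) (q + w * \<eta>) = orient (P q) (P (q + w)) (P (q + w * \<eta>))" if "dirgood w" for q w
    using that dirgood_edges[of w] dirgood_uminus[of "w * \<eta>"] unfolding tri_def orient_alt F_def by simp
  have "(\<Sum>i\<in>I. tri F (p i) (p i + u i) (p i + u i * \<eta>)) = tri F 0 (of_real s) (of_real s * \<eta>)"
    unfolding \<eta> F_def P_def by (rule additive_lattice) (rule folded_area_additive)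
  moreover have "tri F 0 (of_real s) (of_real s * \<eta>) = 4 * s\<^sup>2 * sin (2 * pi / 3)"
  proof -
    have sl: "of_real s \<in> lattice" using galois_s by metis
    have rr: "r * (r * s) = s" using r(2) by auto
    have "P (of_real s) = of_real (2 * s)"
      using rr by (simp add: P_def r(1) flip: of_real_mult of_real_add)
    moreover have "P (of_real s * \<eta>) = of_real (2 * s) * \<eta>"
    proof -
      have "galois (of_real s * \<eta>) = of_real (r * s) * \<eta>"
        unfolding \<eta> using lattice_mult_pow[OF sl, of 4] r(1) by simp
      then have "P (of_real s * \<eta>) = of_real (s + r * (r * s)) * \<eta>"
        by (simp add: P_def algebra_simps)
      then show ?thesis unfolding rr by simp
    qed
    moreover have "P 0 = 0" by (simp add: P_def lattice_0)
    moreover have "dirgood (of_real s)" using dirgood_mult[of s 1] s dirgood_unit[of 1] by (metis less_irrefl mult_1_right norm_one power_0)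
    ultimately show ?thesis
      using dg[of "of_real s" 0] o[of 0 "of_real (2 * s)"] by (simp add: power_mult_distrib norm_mult)
  qed
  moreover have "tri F (p i) (p i + u i) (p i + u i * \<eta>) = k i * sin (2 * pi / 3)" if i: "i \<in> I" for i
  proof -
    define j where "j = (SOME j. u i = \<zeta> ^ j)"
    have "\<exists>j. u i = \<zeta> ^ j" using lattice_vertices[OF i] by (rule conjunct2)
    then have j: "u i = \<zeta> ^ j" unfolding j_def by (rule someI_ex)
    define c where "c = 1 + r * (- 1) ^ j"
    have pl: "p i \<in> lattice" using lattice_vertices[OF i] by blast
    have ul: "u i \<in> lattice" "u i * \<eta> \<in> lattice"
      unfolding j \<eta> power_add[symmetric] by (rule lattice_pow)+
    have "P (p i + u i) = P (p i) + of_real c * u i"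
      using lattice_add(2)[OF pl ul(1)] galois_u(1)[OF j] by (simp add: P_def c_def algebra_simps)
    moreover have "P (p i + u i * \<eta>) = P (p i) + of_real c * u i * \<eta>"
      using lattice_add(2)[OF pl ul(2)] galois_u(2)[OF j] by (simp add: P_def c_def algebra_simps)
    moreover have "dirgood (u i)" using dirgood_unit[OF unit[OF i]] j by blast
    ultimately have "tri F (p i) (p i + u i) (p i + u i * \<eta>) = c\<^sup>2 * sin (2 * pi / 3)"
      using dg[of "u i" "p i"] o[of "P (p i)" "of_real c * u i"] unit[OF i] by (simp add: norm_mult)
    then show ?thesis by (simp add: k_def c_def j_def)
  qed
  \<comment> \<open>By \<open>card_eq\<close> the factors \<open>k i\<close>, each at most 4, have
    mean 4, so all of them equal 4.\<close>
  ultimately have "(\<Sum>i\<in>I. k i * sin (2 * pi / 3)) = 4 * s\<^sup>2 * sin (2 * pi / 3)" by simp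
  then have "(\<Sum>i\<in>I. k i) * sin (2 * pi / 3) = (\<Sum>i\<in>I. 4) * sin (2 * pi / 3)"
    using card_eq by (simp add: sum_distrib_right)
  then have "(\<Sum>i\<in>I. k i) = (\<Sum>i\<in>I. 4)" using sin_\<beta> by (simp only: mult_cancel_right) simp
  then have "(\<Sum>i\<in>I. 4 - k i) = 0" by (simp add: sum_subtractf)
  moreover have k4: "k i \<le> 4" for i
  proof -
    have "(1 + r * (- 1) ^ j)\<^sup>2 \<le> 4" for j :: nat
      using r(2) by (auto simp: minus_one_power_iff)
    then show ?thesis by (simp add: k_def)
  qed
  ultimately have all: "\<forall>i\<in>I. 4 - k i = 0"
    using sum_nonneg_eq_0_iff[OF fin, of "\<lambda>i. 4 - k i"] by simp
  define j' where "j' = (SOME j. u i = \<zeta> ^ j)"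
  have j': "u i = \<zeta> ^ j'" unfolding j'_def using ui by (rule someI)
  have "(1 + r * (- 1) ^ j')\<^sup>2 = 4" using all i by (simp add: k_def j'_def)
  then have "r * (- 1) ^ j' = 1" using r(2) by (auto simp: minus_one_power_iff split: if_splits)
  then have rj: "r = (- 1) ^ j'" using r(2) by (auto simp: minus_one_power_iff split: if_splits)
  \<comment> \<open>The chosen exponent \<open>j'\<close> may differ from \<open>j\<close>; the two
    values of \<open>galois (u i)\<close> show that the parities agree.\<close>
  have "galois (u i) = of_real ((- 1) ^ j') * u i" "galois (u i) = of_real ((- 1) ^ j) * u i"
    using galois_u(1)[OF j'] galois_u(1)[OF ui] .
  then have "complex_of_real ((- 1) ^ j') = of_real ((- 1) ^ j)" using u_nz[OF i] by (metis mult_cancel_right)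
  then show ?thesis unfolding rj of_real_eq_iff .
qed

lemma \<zeta>_eq: "\<zeta> = Complex (sqrt 3 / 2) (1 / 2)"
  by (simp add: complex_eq_iff cos_30 sin_30)

lemma \<eta>_eq: "\<eta> = Complex (- 1 / 2) (sqrt 3 / 2)"
  by (rule cis_120)

lemma \<zeta>_sq: "\<zeta>\<^sup>2 = Complex (1 / 2) (sqrt 3 / 2)"
  unfolding \<zeta>_eq by (simp add: complex_eq_iff power2_eq_square)

text \<open>The set lists the sixth roots of unity, the even powers of \<zeta>, in coordinates, so
  that the edge functionals below can be evaluated tile by tile.\<close>

lemma even_units_mult:
  assumes "x \<in> {1, - 1, Complex (1 / 2) (sqrt 3 / 2), Complex (- 1 / 2) (- sqrt 3 / 2),
   Complex (- 1 / 2) (sqrt 3 / 2), Complex (1 / 2) (- sqrt 3 / 2)}"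
  shows "Complex (1 / 2) (sqrt 3 / 2) * x \<in> {1, - 1, Complex (1 / 2) (sqrt 3 / 2), Complex (- 1 / 2) (- sqrt 3 / 2),
   Complex (- 1 / 2) (sqrt 3 / 2), Complex (1 / 2) (- sqrt 3 / 2)}"
  using assms by (elim insertE emptyE; hypsubst; simp add: complex_eq_iff)

lemma even_units_turn:
  assumes "x \<in> {1, - 1, Complex (1 / 2) (sqrt 3 / 2), Complex (- 1 / 2) (- sqrt 3 / 2),
   Complex (- 1 / 2) (sqrt 3 / 2), Complex (1 / 2) (- sqrt 3 / 2)}"
  shows "Complex (sqrt 3 / 2) (1 / 2) * x \<in> {Complex (sqrt 3 / 2) (1 / 2), Complex (- sqrt 3 / 2) (- 1 / 2), Complex 0 1, Complex 0 (- 1),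
   Complex (- sqrt 3 / 2) (1 / 2), Complex (sqrt 3 / 2) (- 1 / 2)}"
  using assms by (elim insertE emptyE; hypsubst; simp add: complex_eq_iff)

lemma \<zeta>_even: "\<zeta> ^ (2 * k) \<in> {1, - 1, Complex (1 / 2) (sqrt 3 / 2), Complex (- 1 / 2) (- sqrt 3 / 2),
   Complex (- 1 / 2) (sqrt 3 / 2), Complex (1 / 2) (- sqrt 3 / 2)}"
proof (induction k)
  case (Suc k)
  have "\<zeta> ^ (2 * Suc k) = \<zeta>\<^sup>2 * \<zeta> ^ (2 * k)" by (simp add: power2_eq_square)
  then show ?case unfolding \<zeta>_sq using even_units_mult[OF Suc] by (simp only:)
qed simp

lemma \<zeta>_odd: "\<zeta> ^ (2 * k + 1) \<in> {Complex (sqrt 3 / 2) (1 / 2), Complex (- sqrt 3 / 2) (- 1 / 2), Complex 0 1, Complex 0 (- 1),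
   Complex (- sqrt 3 / 2) (1 / 2), Complex (sqrt 3 / 2) (- 1 / 2)}"
proof -
  have "\<zeta> ^ (2 * k + 1) = Complex (sqrt 3 / 2) (1 / 2) * \<zeta> ^ (2 * k)" by (simp add: \<zeta>_eq)
  then show ?thesis using even_units_turn[OF \<zeta>_even[of k]] by (simp only:)
qed

text \<open>
  \<open>F\<close> is a weighted sum of signed lengths, with weights that depend on the direction only. They are
  chosen such that the boundary of every odd tile has total weight 0.
\<close>

lemma not_all_odd:
  assumes "\<And>i. i \<in> I \<Longrightarrow> \<exists>k. u i = \<zeta> ^ (2 * k + 1)"
  shows False
proof -
  \<comment> \<open>Weights per unit length: - 1 / sqrt 3 in direction 1, 1 / sqrt 3 in direction
    \<eta>, and 1 in direction \<open>\<zeta> ^ 5\<close>. An odd tile has unit legs in odd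
    directions and a base of length sqrt 3 in an even one, so the base balances the legs.\<close>
  define F where "F x y = dir_diff 0 1 (\<lambda>z. - Re z / sqrt 3) x y + dir_diff (sqrt 3) 1 (\<lambda>z. - 2 * Re z / sqrt 3) x y
    + dir_diff 1 (sqrt 3) (\<lambda>z. 2 * Im z) x y" for x y
  have "F x y + F y z = F x z" if "orient x y z = 0" for x y z
    unfolding F_def dir_diff_add[OF that, symmetric] by simp
  then have "(\<Sum>i\<in>I. tri F (p i) (p i + u i) (p i + u i * \<eta>)) = tri F 0 (of_real s) (of_real s * \<eta>)"
    by (intro additive[OF subset_UNIV])
  note sum = this
  have zero: "tri F q (q + x) (q + x * \<eta>) = 0"
    if "x \<in> {Complex (sqrt 3 / 2) (1 / 2), Complex (- sqrt 3 / 2) (- 1 / 2), Complex 0 1, Complex 0 (- 1),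
      Complex (- sqrt 3 / 2) (1 / 2), Complex (sqrt 3 / 2) (- 1 / 2)}" for q x
    using that unfolding tri_def F_def dir_diff_def \<eta>_eq
    by (elim insertE emptyE; simp add: field_simps)
  have "tri F (p i) (p i + u i) (p i + u i * \<eta>) = 0" if i: "i \<in> I" for i
  proof -
    obtain k where "u i = \<zeta> ^ (2 * k + 1)" using assms[OF i] by blast
    then show ?thesis using \<zeta>_odd[of k] by (intro zero) (simp only:)
  qed
  then have "tri F 0 (of_real s) (of_real s * \<eta>) = 0" using sum by simp
  \<comment> \<open>For the big triangle the roles are exchanged: its base contributes s sqrt 3 and
    each leg - s / sqrt 3.\<close>
  moreover have "tri F 0 (of_real s) (of_real s * \<eta>) = s / sqrt 3"
    using s unfolding tri_def F_def dir_diff_def \<eta>_eq by (simp add: field_simps)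
  ultimately show False using s by simp
qed

text \<open>
  After the rotation by \<open>r\<close>, \<open>F\<close> integrates the imaginary part along edges of slope 0 and
  \<open>\<plusminus> 1 / sqrt 3\<close>, with weights for which the position of the tile cancels. It is negative on exactly the
  tiles that have a horizontal leg after the rotation, and the big triangle has no edge of these slopes.
\<close>

lemma all_even_horizontal:
  assumes ev: "\<And>i. i \<in> I \<Longrightarrow> \<exists>k. u i = \<zeta> ^ (2 * k)" and i: "i \<in> I"
  shows "u i = 1 \<or> u i = - 1"
proof -
  \<comment> \<open>Rotation by -60 degrees: the sides of the big triangle turn from 0, 120 and 150
    degrees to -60, 60 and 90 degrees, which \<open>G\<close> ignores.\<close>
  define r where "r = Complex (1 / 2) (- sqrt 3 / 2)"
  \<comment> \<open>For a tile with apex at height h, the horizontal leg contributes h or -h and the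
    base, which rises or falls by sqrt 3 / 2, contributes the opposite plus the constant - (sqrt 3 /
    2)^2 / sqrt 3 = - sqrt 3 / 4.\<close>
  define G where "G x y = dir_diff 0 1 (\<lambda>z. Re z * Im z) x y + dir_diff 1 (sqrt 3) (\<lambda>z. - (Im z)\<^sup>2 / sqrt 3) x y
    + dir_diff 1 (- sqrt 3) (\<lambda>z. (Im z)\<^sup>2 / sqrt 3) x y" for x y
  define F where "F x y = G (r * x) (r * y)" for x y
  have rx: "(x = 1 \<or> x = - 1) \<and> r * x \<in> {Complex (1 / 2) (- sqrt 3 / 2), Complex (- 1 / 2) (sqrt 3 / 2)} \<or>
      \<not> (x = 1 \<or> x = - 1) \<and> r * x \<in> {1, - 1, Complex (1 / 2) (sqrt 3 / 2), Complex (- 1 / 2) (- sqrt 3 / 2)}"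
    if "x \<in> {1, - 1, Complex (1 / 2) (sqrt 3 / 2), Complex (- 1 / 2) (- sqrt 3 / 2),
      Complex (- 1 / 2) (sqrt 3 / 2), Complex (1 / 2) (- sqrt 3 / 2)}" for x
    using that unfolding r_def by (elim insertE emptyE; hypsubst; simp add: complex_eq_iff)
  have v0: "tri G q (q + w) (q + w * \<eta>) = 0" if "w \<in> {Complex (1 / 2) (- sqrt 3 / 2), Complex (- 1 / 2) (sqrt 3 / 2)}" for q w
    using that unfolding tri_def G_def dir_diff_def \<eta>_eq
    by (elim insertE emptyE; simp add: field_simps)
  have v1: "tri G q (q + w) (q + w * \<eta>) = - sqrt 3 / 4"
    if "w \<in> {1, - 1, Complex (1 / 2) (sqrt 3 / 2), Complex (- 1 / 2) (- sqrt 3 / 2)}" for q w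
    using that unfolding tri_def G_def dir_diff_def \<eta>_eq
    by (elim insertE emptyE; simp add: field_simps power2_eq_square)
  have "F x y + F y z = F x z" if "orient x y z = 0" for x y z
  proof -
    have "orient (r * x) (r * y) (r * z) = 0" using that by (simp add: orient_rot)
    from dir_diff_add[OF this] show ?thesis unfolding F_def G_def by (simp only: dir_diff_add[OF \<open>orient (r * x) (r * y) (r * z) = 0\<close>, symmetric] add_ac)
  qed
  then have "(\<Sum>i\<in>I. tri F (p i) (p i + u i) (p i + u i * \<eta>)) = tri F 0 (of_real s) (of_real s * \<eta>)"
    by (intro additive[OF subset_UNIV])
  moreover have val: "tri F (p i) (p i + u i) (p i + u i * \<eta>) = (if u i = 1 \<or> u i = - 1 then 0 else - sqrt 3 / 4)"
    if i: "i \<in> I" for i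
  proof -
    have G: "tri F (p i) (p i + u i) (p i + u i * \<eta>) = tri G q (q + r * u i) (q + r * u i * \<eta>)" if "q = r * p i" for q
      unfolding tri_def F_def that by (simp add: algebra_simps)
    obtain k where "u i = \<zeta> ^ (2 * k)" using ev[OF i] by blast
    then have "u i \<in> {1, - 1, Complex (1 / 2) (sqrt 3 / 2), Complex (- 1 / 2) (- sqrt 3 / 2),
      Complex (- 1 / 2) (sqrt 3 / 2), Complex (1 / 2) (- sqrt 3 / 2)}"
      using \<zeta>_even[of k] by (simp only:)
    from rx[OF this] show ?thesis unfolding G[OF refl]
    proof (elim disjE conjE)
      assume "\<not> (u i = 1 \<or> u i = - 1)" "r * u i \<in> {1, - 1, Complex (1 / 2) (sqrt 3 / 2), Complex (- 1 / 2) (- sqrt 3 / 2)}"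
      from this(1) v1[OF this(2)] show "tri G (r * p i) (r * p i + r * u i) (r * p i + r * u i * \<eta>) =
        (if u i = 1 \<or> u i = - 1 then 0 else - sqrt 3 / 4)" by (simp only: if_False)
    next
      assume "u i = 1" "r * u i \<in> {Complex (1 / 2) (- sqrt 3 / 2), Complex (- 1 / 2) (sqrt 3 / 2)}"
      from this(1) v0[OF this(2)] show "tri G (r * p i) (r * p i + r * u i) (r * p i + r * u i * \<eta>) =
        (if u i = 1 \<or> u i = - 1 then 0 else - sqrt 3 / 4)" by (simp only: simp_thms if_True)
    next
      assume "u i = - 1" "r * u i \<in> {Complex (1 / 2) (- sqrt 3 / 2), Complex (- 1 / 2) (sqrt 3 / 2)}"
      from this(1) v0[OF this(2)] show "tri G (r * p i) (r * p i + r * u i) (r * p i + r * u i * \<eta>) =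
        (if u i = 1 \<or> u i = - 1 then 0 else - sqrt 3 / 4)" by (simp only: simp_thms if_True)
    qed
  qed
  moreover have "tri F 0 (of_real s) (of_real s * \<eta>) = 0"
    using s unfolding tri_def F_def G_def dir_diff_def \<eta>_eq r_def by (auto simp: field_simps)
  ultimately have "(\<Sum>i\<in>I. if u i = 1 \<or> u i = - 1 then 0 else - sqrt 3 / 4) = 0" by simp
  then have "(\<Sum>i\<in>I. if u i = 1 \<or> u i = - 1 then 0 else sqrt 3 / 4) = 0"
    using sum_negf[of "\<lambda>i. if u i = 1 \<or> u i = - 1 then 0 else sqrt 3 / 4" I] by (simp add: if_distrib cong: if_cong)
  then have "\<forall>i\<in>I. (if u i = 1 \<or> u i = - 1 then 0 else sqrt 3 / 4) = 0"
    using sum_nonneg_eq_0_iff[OF fin, of "\<lambda>i. if u i = 1 \<or> u i = - 1 then 0 else sqrt 3 / 4"] by simp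
  then show ?thesis using i by (auto split: if_splits)
qed

text \<open>Parity \<open>r = - 1\<close> is excluded by \<open>not_all_odd\<close>; for
  \<open>r = 1\<close> every tile is a translate of one fixed tile or of its half-turn, and neither
  fits into the cone at the apex with a base corner at 0.\<close>

lemma no_apex_split:
  assumes i: "i \<in> I" and z: "0 \<in> {p i + u i, p i + u i * \<eta>}"
  shows False
proof -
  obtain s' where s': "galois (of_real s) = of_real s'" "s' * s' = s * s" using galois_s by metis
  define r where "r = s' / s"
  have r: "galois (of_real s) = of_real (r * s)" "r = 1 \<or> r = - 1"
    using s' s square_eq_iff[of s' s] by (auto simp: r_def)
  have par: "\<exists>j. u i = \<zeta> ^ j \<and> r = (- 1) ^ j" if "i \<in> I" for i
    using lattice_vertices[OF that] tile_parity[OF r that] by blast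
  have "r = 1"
  proof (rule ccontr)
    assume "r \<noteq> 1"
    have "\<exists>k. u i = \<zeta> ^ (2 * k + 1)" if "i \<in> I" for i
    proof -
      obtain j where "u i = \<zeta> ^ j" "r = (- 1) ^ j" using par[OF \<open>i \<in> I\<close>] by blast
      moreover from this \<open>r \<noteq> 1\<close> have "odd j" by auto
      ultimately show ?thesis by (metis oddE)
    qed
    then show False by (rule not_all_odd)
  qed
  have "\<exists>k. u i = \<zeta> ^ (2 * k)" if "i \<in> I" for i
  proof -
    obtain j where "u i = \<zeta> ^ j" "r = (- 1) ^ j" using par[OF \<open>i \<in> I\<close>] by blast
    moreover from this \<open>r = 1\<close> have "even j" by (auto simp: minus_one_power_iff split: if_splits)
    ultimately show ?thesis by (metis evenE)
  qed
  then have u1: "u i = 1 \<or> u i = - 1" using i by (rule all_even_horizontal)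
  have in_T: "0 \<le> Im z \<and> 0 \<le> sqrt 3 * Re z + Im z" if "z \<in> {p i, p i + u i, p i + u i * \<eta>}" for z
  proof -
    have "z \<in> convex hull {p i, p i + u i, p i + u i * \<eta>}" using that by (rule hull_inc)
    then have "z \<in> convex hull {0, of_real s, of_real s * \<eta>}" using union i by blast
    then have "0 \<le> orient 0 (of_real s) z" "0 \<le> orient (of_real s * \<eta>) 0 z"
      unfolding in_triangle_iff[OF POS] by auto
    then have "0 \<le> s * Im z" "0 \<le> s / 2 * (sqrt 3 * Re z + Im z)"
      unfolding \<eta>_eq orient_def cr_def by (simp_all add: field_simps)
    then show ?thesis using s by (simp_all add: zero_le_mult_iff)
  qed
  have "p i = - u i \<or> p i = - (u i * \<eta>)" using z by (auto simp: eq_neg_iff_add_eq_0)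
  then show False using u1 in_T[of "p i"] in_T[of "p i + u i"] in_T[of "p i + u i * \<eta>"]
    unfolding \<eta>_eq by (auto simp: complex_eq_iff)
qed

end

lemma (in iso_tiling) no_split_120:
  assumes \<beta>120: "\<beta> = 2 * pi / 3" and i: "i \<in> I" "0 \<in> {p i + u i, p i + u i * cis \<beta>}"
  shows False
proof -
  interpret t: iso_tiling I p u s "2 * pi / 3" using iso_tiling_axioms unfolding \<beta>120 .
  interpret q: quad_conj "sqrt 3" "- sqrt 3" "cis (pi / 6)" "- cis (pi / 6)" 0 3
  proof
    show "sqrt 3 \<notin> \<rat>"
    proof (rule quadratic_irrational[of _ 0 3])
      show "k * k \<noteq> 0 * k + 3" for k :: int
      proof
        assume k: "k * k = 0 * k + 3"
        have "\<bar>k\<bar> < 2"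
        proof (rule ccontr)
          assume "\<not> ?thesis"
          then have "2 * 2 \<le> \<bar>k\<bar> * \<bar>k\<bar>" by (intro mult_mono) auto
          then show False using k by (simp flip: abs_mult)
        qed
        then have "k = -1 \<or> k = 0 \<or> k = 1" by linarith
        then show False using k by auto
      qed
    qed simp
    show "cis (pi / 6) * cis (pi / 6) = complex_of_real (sqrt 3) * cis (pi / 6) - 1"
      using cis_square[of "pi / 6"] by (simp add: cos_30)
    then show "- cis (pi / 6) * - cis (pi / 6) = complex_of_real (- sqrt 3) * - cis (pi / 6) - 1" by simp
    show "Im (cis (pi / 6)) \<noteq> 0" by (simp add: sin_30)
  qed simp_all
  interpret t: sixth_tiling I p u s
  proof
    show "norm (cis (pi / 6)) = 1" by simp
    show "cis (pi / 6) ^ 6 = - 1" unfolding Complex.DeMoivre by simp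
    show 4: "cis (2 * pi / 3) = cis (pi / 6) ^ 4" unfolding Complex.DeMoivre by simp
    have "cis (pi / 6) ^ 5 = cis (pi / 2) * cis (pi / 3)"
      unfolding Complex.DeMoivre cis_mult by (intro arg_cong[of _ _ cis]) simp
    also have "\<dots> = Complex (- sqrt 3 / 2) (1 / 2)" by (simp add: complex_eq_iff cos_60 sin_60)
    finally have 5: "cis (pi / 6) ^ 5 = Complex (- sqrt 3 / 2) (1 / 2)" .
    show "cis (2 * pi / 3) - 1 = complex_of_real (sqrt 3) * cis (pi / 6) ^ 5"
      unfolding 5 cis_120 by (simp add: complex_eq_iff)
    have "sqrt 3 = of_int 0 + of_int 1 * sqrt 3" by simp
    then show "sqrt 3 \<in> q.quadratic" unfolding q.quadratic_def by blast
  qed simp_all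
  show False using t.no_apex_split[OF i(1)] i(2) unfolding \<beta>120 .
qed

lemma (in iso_tiling) no_split:
  assumes v: "v \<in> {0, of_real s, of_real s * cis \<beta>}" and k: "bases v + apexes v \<ge> 2"
    and oblique: "\<beta> \<noteq> pi / 2"
  shows False
proof -
  have bs: "\<exists>i\<in>I. v \<in> {p i + u i, p i + u i * cis \<beta>}" if "bases v > 0"
  proof (rule ccontr)
    assume "\<not> ?thesis"
    then have "bases v = 0" unfolding bases_def by (intro sum.neutral) auto
    then show False using that by simp
  qed
  have ap: "\<exists>i\<in>I. p i = v" if "apexes v > 0"
  proof (rule ccontr)
    assume "\<not> ?thesis"
    then have "apexes v = 0" unfolding apexes_def by (intro sum.neutral) auto
    then show False using that by simp
  qed
  from split_cases[OF v k oblique] show False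
  proof (elim disjE conjE)
    assume "v = 0" "bases v > 0" "\<beta> = 3 * \<alpha>"
    have "\<beta> = 3 * pi / 5" using \<alpha>_sum \<open>\<beta> = 3 * \<alpha>\<close> by linarith
    moreover obtain i where "i \<in> I" "0 \<in> {p i + u i, p i + u i * cis \<beta>}"
      using bs[OF \<open>bases v > 0\<close>] \<open>v = 0\<close> by auto
    ultimately show False by (intro no_split_108)
  next
    assume "v = 0" "bases v > 0" "\<beta> = 4 * \<alpha>"
    have "\<beta> = 2 * pi / 3" using \<alpha>_sum \<open>\<beta> = 4 * \<alpha>\<close> by linarith
    moreover obtain i where "i \<in> I" "0 \<in> {p i + u i, p i + u i * cis \<beta>}"
      using bs[OF \<open>bases v > 0\<close>] \<open>v = 0\<close> by auto
    ultimately show False by (intro no_split_120)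
  next
    assume "v \<noteq> 0" "apexes v > 0" "\<alpha> = 2 * \<beta>"
    have "\<beta> = pi / 5" using \<alpha>_sum \<open>\<alpha> = 2 * \<beta>\<close> by linarith
    moreover have "v \<in> {of_real s, of_real s * cis \<beta>}" using v \<open>v \<noteq> 0\<close> by blast
    moreover obtain i where "i \<in> I" "p i = v" using ap[OF \<open>apexes v > 0\<close>] by blast
    ultimately show False by (intro no_split_36)
  qed
qed

section \<open>Transport from the real plane\<close>

definition to_complex :: "plane \<Rightarrow> complex" where
  "to_complex v = Complex (v $ 1) (v $ 2)"

lemma to_complex_simps [simp]: "Re (to_complex v) = v $ 1" "Im (to_complex v) = v $ 2"
  by (simp_all add: to_complex_def)

lemma linear_to_complex: "linear to_complex"
  by (rule linearI) (simp_all add: complex_eq_iff)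

lemma norm_to_complex: "norm (to_complex v) = norm v"
  by (simp add: cmod_def norm_vec_def L2_set_def sum_2)

lemma similarity_props:
  fixes f :: "plane \<Rightarrow> plane"
  assumes s: "s > 0" and f: "\<And>x y. dist (f x) (f y) = s * dist x y"
  shows "inj f" "surj f" "f ` (convex hull S) = convex hull (f ` S)"
proof -
  define g where "g x = (1 / s) *\<^sub>R (f x - f 0)" for x
  have "dist (g x) (g y) = dist x y" for x y
  proof -
    have "g x - g y = (1 / s) *\<^sub>R (f x - f y)" by (simp add: g_def scaleR_right_diff_distrib)
    then have "dist (g x) (g y) = (1 / s) * dist (f x) (f y)" using s by (simp add: dist_norm)
    then show ?thesis using f s by simp
  qed
  then have orth: "orthogonal_transformation g"
    unfolding orthogonal_transformation_isometry by (simp add: g_def)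
  have fg: "f = (\<lambda>x. f 0 + x) \<circ> (\<lambda>x. s *\<^sub>R g x)" using s by (auto simp: g_def)
  show "inj f"
  proof (rule injI)
    fix x y assume "f x = f y"
    then have "s * dist x y = 0" using f[of x y] by simp
    then show "x = y" using s by simp
  qed
  show "surj f"
  proof (rule surjI)
    fix y
    show "f (inv g ((1 / s) *\<^sub>R (y - f 0))) = y"
      using s orthogonal_transformation_surj[OF orth]
      by (subst fg) (simp add: surj_f_inv_f)
  qed
  have "linear (\<lambda>x. s *\<^sub>R g x)"
    using orth by (intro linear_compose_scale_right) (simp add: orthogonal_transformation_def)
  then have "(\<lambda>x. s *\<^sub>R g x) ` (convex hull S) = convex hull ((\<lambda>x. s *\<^sub>R g x) ` S)"
    by (rule convex_hull_linear_image)
  then show "f ` (convex hull S) = convex hull (f ` S)"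
    by (subst (1 2) fg) (simp only: image_comp[symmetric] convex_hull_translation)
qed

text \<open>The quotient w / u has modulus 1 and the same real part as \<open>e\<close>, so it is
  \<open>e\<close> or its conjugate; the latter means that the two legs are exchanged.\<close>

lemma unit_pair:
  fixes u w e :: complex
  assumes "norm u = 1" "norm w = 1" "norm (u - w) = norm (e - 1)" "norm e = 1"
  shows "w = u * e \<or> u = w * e"
proof -
  have sq: "(norm z)\<^sup>2 = 1" if "norm z = 1" for z :: complex using that by simp
  define r where "r = w * cnj u"
  have uu: "u * cnj u = 1" "e * cnj e = 1" using assms complex_norm_square[of u] complex_norm_square[of e] by simp_all
  have nr: "norm r = 1" using assms by (simp add: r_def norm_mult)
  have "w = u * r" using uu by (simp add: r_def algebra_simps)
  have "u - w = u * (1 - r)" unfolding \<open>w = u * r\<close> by (simp add: algebra_simps)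
  then have "norm (1 - r) = norm (e - 1)" using assms by (simp add: norm_mult)
  then have "(norm (1 - r))\<^sup>2 = (norm (e - 1))\<^sup>2" by simp
  then have re: "Re r = Re e"
    using sq[OF nr] sq[OF assms(4)] unfolding cmod_power2 by (simp add: power2_eq_square algebra_simps)
  then have "(Im r)\<^sup>2 = (Im e)\<^sup>2" using sq[OF nr] sq[OF assms(4)] unfolding cmod_power2 by simp
  then have "r = e \<or> r = cnj e" using re by (auto simp: complex_eq_iff power2_eq_iff)
  then show ?thesis
  proof
    assume "r = cnj e"
    then have "w * e = u * (e * cnj e)" using \<open>w = u * r\<close> by (simp add: mult_ac)
    then show ?thesis using uu by simp
  qed (use \<open>w = u * r\<close> in simp)
qed

lemma collinear_of_orient:
  assumes "orient (to_complex a) (to_complex b) (to_complex c) = 0"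
  shows "collinear {a, b, c}"
proof (cases "to_complex a = to_complex b")
  case True
  then have "a = b" by (simp add: complex_eq_iff vec_eq_iff forall_2)
  then show ?thesis by simp
next
  case False
  then obtain t where "to_complex c = to_complex a + of_real t * (to_complex b - to_complex a)"
    using assms by (rule collinear_param)
  then have "c - a = t *\<^sub>R (b - a)" by (simp add: complex_eq_iff vec_eq_iff forall_2)
  then have "collinear {0, b - a, c - a}" unfolding collinear_lemma by blast
  then have "collinear {b, a, c}" using collinear_3[of b a c] by simp
  then show ?thesis by (simp add: insert_commute)
qed

lemma isosceles_triangle_positive:
  assumes "isosceles_triangle T"
  obtains a b c where "T = convex hull {a, b, c}" "dist a b = dist a c"
    "orient (to_complex a) (to_complex b) (to_complex c) > 0"
    "orthogonal (b - a) (c - a) \<longrightarrow> right_triangle T"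
proof -
  obtain a b c where T: "triangle_on T a b c" "dist a b = dist a c"
    using assms unfolding isosceles_triangle_def by blast
  then have o: "orient (to_complex a) (to_complex b) (to_complex c) \<noteq> 0" and h: "T = convex hull {a, b, c}"
    using collinear_of_orient unfolding triangle_on_def by blast+
  have sw: "triangle_on T a c b" using T(1) unfolding triangle_on_def by (simp add: insert_commute)
  show ?thesis
  proof (cases "orient (to_complex a) (to_complex b) (to_complex c) > 0")
    case True
    have "right_triangle T" if "orthogonal (b - a) (c - a)"
      using T(1) that unfolding right_triangle_def by blast
    then show ?thesis using h T(2) True that[of a b c] by simp
  next
    case False
    then have "orient (to_complex a) (to_complex c) (to_complex b) > 0"
      using o orient_swap[of "to_complex a" "to_complex c" "to_complex b"] by linarith
    moreover have "right_triangle T" if "orthogonal (c - a) (b - a)"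
      using sw that unfolding right_triangle_def by blast
    moreover have "T = convex hull {a, c, b}" using h by (simp add: insert_commute)
    ultimately show ?thesis using T(2) that[of a c b] by simp
  qed
qed

text \<open>Similarity alone could give each tile its own ratio; composing with the congruences to
  one fixed tile makes \<open>s\<close> common to all.\<close>

lemma reptiling_similarities:
  assumes "reptiling r T \<T>"
  obtains s f where "s > 0" "\<And>S. S \<in> \<T> \<Longrightarrow> f S ` S = T"
    "\<And>S x y. S \<in> \<T> \<Longrightarrow> dist (f S x) (f S y) = s * dist (x :: plane) (y :: plane)"
proof -
  have "\<T> \<noteq> {}" using assms unfolding reptiling_def by auto
  then obtain S0 where S0: "S0 \<in> \<T>" by blast
  then obtain s f where sf: "s > 0" "\<And>x y. dist (f x) (f y) = s * dist (x :: plane) (y :: plane)" "f ` S0 = T"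
    using assms unfolding reptiling_def similar_figures_def by blast
  have "\<exists>h. (\<forall>x y. dist (h x) (h y) = s * dist (x :: plane) (y :: plane)) \<and> h ` S = T" if S: "S \<in> \<T>" for S
  proof -
    obtain g :: "plane \<Rightarrow> plane" where g: "\<And>x y. dist (g x) (g y) = dist x y" "g ` S = S0"
      using assms S S0 unfolding reptiling_def congruent_figures_def by meson
    have "(f \<circ> g) ` S = T" using g(2) sf(3) by (simp only: image_comp[symmetric])
    then show ?thesis using sf(2) g(1) by (intro exI[of _ "f \<circ> g"]) simp
  qed
  then obtain h where "\<And>S. S \<in> \<T> \<Longrightarrow> (\<forall>x y. dist (h S x) (h S y) = s * dist (x :: plane) (y :: plane)) \<and> h S ` S = T"
    by metis
  then show ?thesis using that[of s h] sf(1) by blast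
qed

theorem theorem10:
  fixes T :: "plane set" and k :: nat
  assumes "isosceles_triangle T" and "oblique_triangle T" and "k \<ge> 2"
  shows "\<not> (\<exists>\<T>. splitting_reptiling k T \<T>)"
proof
  assume "\<exists>\<T>. splitting_reptiling k T \<T>"
  then obtain \<T> r v where rep: "reptiling r T \<T>" and v: "v extreme_point_of T" and card: "card {S \<in> \<T>. v \<in> S} = k"
    unfolding splitting_reptiling_def by blast
  obtain a b c where T: "T = convex hull {a, b, c}" and iso: "dist a b = dist a c"
    and abc: "orient (to_complex a) (to_complex b) (to_complex c) > 0"
    and right: "orthogonal (b - a) (c - a) \<longrightarrow> right_triangle T"
    using assms(1) by (rule isosceles_triangle_positive)
  obtain s f where s: "s > 0" and fS: "\<And>S. S \<in> \<T> \<Longrightarrow> f S ` S = T"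
    and fd: "\<And>S x y. S \<in> \<T> \<Longrightarrow> dist (f S x) (f S y) = s * dist (x :: plane) (y :: plane)"
    using rep by (rule reptiling_similarities) blast
  have fin: "finite \<T>" using rep unfolding reptiling_def by (metis card.infinite not_numeral_le_zero)
  have sub: "S \<subseteq> T" if "S \<in> \<T>" for S using rep that unfolding reptiling_def by blast
  define A B C where "A = to_complex a" and "B = to_complex b" and "C = to_complex c"
  have AB: "A \<noteq> B" using abc by (auto simp: A_def B_def)
  define K where "K = of_real s / (B - A)"
  \<comment> \<open>Moves the apex of \<open>T\<close> to 0 and scales its legs to length
    \<open>s\<close>, so that the legs of the tiles get length 1.\<close>
  define \<psi> where "\<psi> x = - (K * A) + K * to_complex x" for x
  define e where "e = (C - A) / (B - A)"
  have normdiff: "norm (to_complex x - to_complex y) = dist x y" for x y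
    using norm_to_complex[of "x - y"] linear_diff[OF linear_to_complex, of x y] by (simp add: dist_norm)
  have L: "dist a b > 0" using AB unfolding A_def B_def by auto
  have normK: "norm K = s / dist a b" using s normdiff[of b a]
    by (simp add: K_def norm_divide A_def B_def dist_commute)
  have K0: "K \<noteq> 0" using s AB by (simp add: K_def)
  have dist_\<psi>: "norm (\<psi> x - \<psi> y) = s / dist a b * dist x y" for x y
  proof -
    have "\<psi> x - \<psi> y = K * (to_complex x - to_complex y)" by (simp add: \<psi>_def algebra_simps)
    then show ?thesis using normdiff normK by (simp add: norm_mult)
  qed
  have inj: "inj \<psi>"
  proof (rule injI)
    fix x y assume "\<psi> x = \<psi> y"
    then show "x = y" using dist_\<psi>[of x y] s L by simp
  qed
  have \<psi>_abc: "\<psi> a = 0" "\<psi> b = of_real s" "\<psi> c = of_real s * e"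
  proof -
    have e: "\<psi> x = K * (to_complex x - A)" for x by (simp add: \<psi>_def algebra_simps)
    show "\<psi> a = 0" unfolding e A_def by simp
    show "\<psi> b = of_real s" "\<psi> c = of_real s * e"
      using AB unfolding e B_def[symmetric] C_def[symmetric] K_def e_def by simp_all
  qed
  have hull_\<psi>: "\<psi> ` (convex hull S) = convex hull (\<psi> ` S)" for S
  proof -
    have lin: "linear (\<lambda>x. K * to_complex x)"
      by (rule linearI) (simp_all add: linear_add[OF linear_to_complex] linear_cmul[OF linear_to_complex] algebra_simps)
    have \<psi>_comp: "\<psi> = (\<lambda>x. - (K * A) + x) \<circ> (\<lambda>x. K * to_complex x)" by (auto simp: \<psi>_def)
    show ?thesis unfolding \<psi>_comp image_comp[symmetric] convex_hull_linear_image[OF lin] convex_hull_translation ..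
  qed
  have cont: "continuous_on UNIV \<psi>"
    unfolding \<psi>_def by (intro continuous_intros linear_continuous_on linear_to_complex[unfolded linear_conv_bounded_linear])
  have interior_\<psi>: "interior (\<psi> ` S) \<subseteq> \<psi> ` interior S" for S
  proof
    fix z assume z: "z \<in> interior (\<psi> ` S)"
    then obtain x where x: "z = \<psi> x" using interior_subset by blast
    have "open (\<psi> -` interior (\<psi> ` S))" using cont by (intro open_vimage) simp_all
    moreover have "\<psi> -` interior (\<psi> ` S) \<subseteq> S" using interior_subset inj by (metis inj_vimage_image_eq vimage_mono)
    ultimately have "x \<in> interior S" using z x by (meson interiorI vimageI2)
    then show "z \<in> \<psi> ` interior S" using x by blast
  qed
  have ne: "norm e = 1" using normdiff[of c a] normdiff[of b a] iso L
    by (simp add: e_def norm_divide A_def B_def C_def dist_commute)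
  have Ime: "Im e > 0"
  proof -
    have "Im e = orient A B C / (norm (B - A))\<^sup>2" unfolding e_def by (rule Im_quotient)
    then show ?thesis using abc AB by (simp add: A_def B_def C_def)
  qed
  define \<beta> where "\<beta> = Arg e"
  have \<beta>: "0 < \<beta>" "\<beta> < pi" using Ime Arg_lt_pi unfolding \<beta>_def by blast+
  have "e \<noteq> 0" using ne by auto
  then have cis: "cis \<beta> = e" using ne cis_Arg[of e] by (simp add: \<beta>_def sgn_div_norm)
  have \<beta>2: "\<beta> \<noteq> pi / 2"
  proof
    assume "\<beta> = pi / 2"
    moreover have "cis (pi / 2) = \<i>" by (simp add: complex_eq_iff)
    ultimately have "e = \<i>" using cis by metis
    then have "C - A = \<i> * (B - A)" using AB by (simp add: e_def field_simps)
    from arg_cong[OF this, of Re] arg_cong[OF this, of Im]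
    have "c $ 1 - a $ 1 = - (b $ 2 - a $ 2)" "c $ 2 - a $ 2 = b $ 1 - a $ 1"
      by (simp_all add: A_def B_def C_def)
    then have "orthogonal (b - a) (c - a)"
      unfolding orthogonal_def inner_vec_def sum_2 vector_minus_component by (simp only: inner_real_def) (simp add: algebra_simps)
    then show False using right assms(2) unfolding oblique_triangle_def by blast
  qed
  have tile: "\<exists>p u. norm u = 1 \<and> \<psi> ` S = convex hull {p, p + u, p + u * cis \<beta>} \<and>
     (v \<in> S \<longrightarrow> \<psi> v \<in> {p, p + u, p + u * cis \<beta>})" if S: "S \<in> \<T>" for S
  proof -
    note sim = similarity_props[OF s fd[OF S]]
    obtain a' b' c' where abc': "f S a' = a" "f S b' = b" "f S c' = c" using sim(2) by (metis surjD)
    have "f S ` (convex hull {a', b', c'}) = f S ` S" unfolding sim(3) fS[OF S] T by (simp add: abc')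
    then have hull: "S = convex hull {a', b', c'}" using inj_image_eq_iff[OF sim(1)] by blast
    have d: "norm (\<psi> x - \<psi> y) = dist (f S x) (f S y) / dist a b" for x y
      unfolding dist_\<psi> fd[OF S] by simp
    define u w where "u = \<psi> b' - \<psi> a'" and "w = \<psi> c' - \<psi> a'"
    have "norm u = 1" "norm w = 1" using iso L by (simp_all add: u_def w_def d abc' dist_commute)
    moreover have "norm (u - w) = norm (e - 1)"
    proof -
      have "of_real s * (e - 1) = \<psi> c - \<psi> b" by (simp add: \<psi>_abc algebra_simps)
      then have "s * norm (e - 1) = s / dist a b * dist c b" using dist_\<psi>[of c b] s
        by (metis abs_of_pos norm_mult norm_of_real)
      then have "s * norm (e - 1) = s * (dist c b / dist a b)" by simp
      then have "norm (e - 1) = dist c b / dist a b" using s by (metis less_irrefl mult_left_cancel)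
      moreover have "u - w = \<psi> b' - \<psi> c'" by (simp add: u_def w_def)
      ultimately show ?thesis by (simp add: d abc' dist_commute)
    qed
    ultimately have uw: "w = u * e \<or> u = w * e" using ne by (intro unit_pair)
    have img: "\<psi> ` {a', b', c'} = {\<psi> a', \<psi> a' + u, \<psi> a' + w}" by (simp add: u_def w_def)
    have vS: "\<psi> v \<in> \<psi> ` {a', b', c'}" if "v \<in> S"
    proof -
      \<comment> \<open>An extreme point of \<open>T\<close> stays extreme in every tile containing
        it and is thus a corner of that tile; so tiles at \<open>v\<close> can be counted by their
        corners there.\<close>
      have "v extreme_point_of S" using v that sub[OF S] unfolding extreme_point_of_def by blast
      then show ?thesis unfolding hull by (intro imageI extreme_point_of_convex_hull)
    qed
    from uw show ?thesis
    proof
      assume w: "w = u * e"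
      have "norm u = 1 \<and> \<psi> ` S = convex hull {\<psi> a', \<psi> a' + u, \<psi> a' + u * cis \<beta>} \<and>
         (v \<in> S \<longrightarrow> \<psi> v \<in> {\<psi> a', \<psi> a' + u, \<psi> a' + u * cis \<beta>})"
        using \<open>norm u = 1\<close> hull_\<psi>[of "{a', b', c'}"] vS unfolding img w hull[symmetric] cis by blast
      then show ?thesis by blast
    next
      assume u: "u = w * e"
      have img': "\<psi> ` {a', b', c'} = {\<psi> a', \<psi> a' + w, \<psi> a' + w * e}" unfolding img u by blast
      have "norm w = 1 \<and> \<psi> ` S = convex hull {\<psi> a', \<psi> a' + w, \<psi> a' + w * cis \<beta>} \<and>
         (v \<in> S \<longrightarrow> \<psi> v \<in> {\<psi> a', \<psi> a' + w, \<psi> a' + w * cis \<beta>})"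
        using \<open>norm w = 1\<close> hull_\<psi>[of "{a', b', c'}"] vS unfolding img' hull[symmetric] cis by blast
      then show ?thesis by blast
    qed
  qed
  obtain p u where pu: "\<And>S. S \<in> \<T> \<Longrightarrow> norm (u S) = 1 \<and> \<psi> ` S = convex hull {p S, p S + u S, p S + u S * cis \<beta>} \<and>
     (v \<in> S \<longrightarrow> \<psi> v \<in> {p S, p S + u S, p S + u S * cis \<beta>})"
    using tile by metis
  interpret iso_tiling \<T> p u s \<beta>
  proof
    show "(\<Union>S\<in>\<T>. convex hull {p S, p S + u S, p S + u S * cis \<beta>}) = convex hull {0, of_real s, of_real s * cis \<beta>}"
    proof -
      have "(\<Union>S\<in>\<T>. convex hull {p S, p S + u S, p S + u S * cis \<beta>}) = (\<Union>S\<in>\<T>. \<psi> ` S)"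
        using pu by (intro SUP_cong) auto
      also have "\<dots> = \<psi> ` T" using rep unfolding reptiling_def by blast
      also have "\<dots> = convex hull {0, of_real s, of_real s * cis \<beta>}"
        unfolding T hull_\<psi> cis by (simp add: \<psi>_abc)
      finally show ?thesis .
    qed
    show "interior (convex hull {p S, p S + u S, p S + u S * cis \<beta>}) \<inter>
        interior (convex hull {p S', p S' + u S', p S' + u S' * cis \<beta>}) = {}"
      if "S \<in> \<T>" "S' \<in> \<T>" "S \<noteq> S'" for S S'
    proof -
      have "interior S \<inter> interior S' = {}"
        using rep that unfolding reptiling_def pairwise_def disjnt_def by blast
      then have "\<psi> ` interior S \<inter> \<psi> ` interior S' = {}"
        unfolding image_Int[OF inj, symmetric] by simp
      then have "interior (\<psi> ` S) \<inter> interior (\<psi> ` S') = {}" using interior_\<psi>[of S] interior_\<psi>[of S'] by blast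
      then show ?thesis using pu[OF that(1)] pu[OF that(2)] by simp
    qed
  qed (use fin pu s \<beta> in auto)
  have "v \<in> {a, b, c}" using v unfolding T by (rule extreme_point_of_convex_hull)
  then have "\<psi> v \<in> {0, of_real s, of_real s * cis \<beta>}" using \<psi>_abc cis by auto
  moreover have "bases (\<psi> v) + apexes (\<psi> v) \<ge> 2"
  proof -
    have "k = (\<Sum>S\<in>\<T>. of_bool (v \<in> S))" using card fin by (simp add: sum.inter_filter[symmetric] of_bool_def)
    also have "\<dots> \<le> (\<Sum>S\<in>\<T>. (of_bool (\<psi> v = p S + u S) + of_bool (\<psi> v = p S + u S * cis \<beta>)) + of_bool (\<psi> v = p S))"
      using pu by (intro sum_mono) auto
    also have "\<dots> = bases (\<psi> v) + apexes (\<psi> v)" unfolding bases_def apexes_def by (simp add: sum.distrib)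
    finally show ?thesis using assms(3) by simp
  qed
  ultimately show False using \<beta>2 by (rule no_split)
qed

end
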